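(* Let $(X,d,\mu)$ satisfy the standard assumptions (A), let $\Omega\subset X$ be open and let $u\in BV(\Omega)$. Then $$co\mathcal H^1(\Lambda_t)<\infty\quad\text{for a.e. }t\in\mathbb R.$$ If, in addition, $u$ is continuous (or merely approximately continuous) at every point of $\Omega$, then $co\mathcal H^1(u^{-1}(t))<\infty$ for a.e. $t\in\mathbb R$.
   Context: $(X,d)$ is a metric space with a Borel regular measure $\mu$; $B(x,r)$ denotes the open ball. Standard assumptions (A): $X$ is complete; $\mu$ is doubling, i.e. $\mu(B(x,2r))\le C_\mu\,\mu(B(x,r))$ and $0<\mu(B(x,r))<\infty$ for all open balls; and $X$ supports the $BV$-Poincaré inequality: there are constants $C_P\ge1$, $\lambda_P\ge1$ such that for every ball $B(x,r)$ and every $u\in BV(X)$ $$\int_{B(x,r)}|u-u_{B(x,r)}|\,d\mu\le C_P\,r\,V(u,B(x,\lambda_P r)),$$ where $u_{B(x,r)}$ is the mean value of $u$ in $B(x,r)$. Here, for an open set $G\subset X$ and $u\in L^1_{\mathrm{loc}}(G)$, $$V(u,G)=\inf\Bigl\{\liminf_i\int_G|\nabla u_i|\,d\mu:\ u_i\in\mathrm{Lip}_{\mathrm{loc}}(G),\ u_i\to u\text{ in }L^1_{\mathrm{loc}}(G)\Bigr\},$$ $\mathrm{Lip}_{\mathrm{loc}}(G)$ is the set of locally Lipschitz functions in $G$, $|\nabla u(x)|=\liminf_{r\to0}\sup_{y\in B(x,r)}|u(y)-u(x)|/r$, and $u\in BV(G)$ means $u\in L^1_{\mathrm{loc}}(G)$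 and $V(u,G)<\infty$. For a measurable set $A$ write $D(A,x)=\lim_{r\to0}\mu(A\cap B(x,r))/\mu(B(x,r))$ when the limit exists. For $u\in BV(\Omega)$ and $x\in\Omega$ the upper and lower approximate limits are $$u^+(x)=\inf\{s:\ D(\{u>s\},x)=0\},\qquad u^-(x)=\sup\{t:\ D(\{u<t\},x)=0\}.$$ $u$ is approximately continuous at $x$ if $u^+(x)=u^-(x)=u(x)$. For $t\in\mathbb R$, $\Lambda_t=\{x\in\Omega:\ u^-(x)\le t\le u^+(x)\}$. $co\mathcal H^1(A)=\sup_{\delta>0}co\mathcal H^1_\delta(A)$, where $co\mathcal H^1_\delta(A)=\inf\{\sum_{j=1}^\infty\mu(B(x_j,r_j))/r_j:\ A\subset\bigcup_{j=1}^\infty B(x_j,r_j),\ \sup_jr_j<\delta\}$. *)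

theory Defs
  imports "HOL-Analysis.Analysis"
begin

section \<open>Assumptions on the measure\<close>

text \<open>
  A Borel regular outer measure is represented by its restriction \<open>M\<close> to a sigma-algebra of
  measurable sets containing the Borel sets; both the Borel sigma-algebra itself and its
  completion are admitted. The first condition forces \<open>space M = UNIV\<close>.
\<close>

definition borel_regular :: "'a::topological_space measure \<Rightarrow> bool" where
  "borel_regular M \<longleftrightarrow>
     sets borel \<subseteq> sets M \<and>
     (\<forall>A\<in>sets M. \<exists>B\<in>sets borel. A \<subseteq> B \<and> emeasure M B = emeasure M A)"

definition doubling_measure :: "'a::metric_space measure \<Rightarrow> bool" where
  "doubling_measure M \<longleftrightarrow>
     (\<exists>C::real. \<forall>x r. 0 < r \<longrightarrow>
        emeasure M (ball x (2 * r)) \<le> ennreal C * emeasure M (ball x r)) \<and>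
     (\<forall>x r. 0 < r \<longrightarrow> 0 < emeasure M (ball x r) \<and> emeasure M (ball x r) < \<infinity>)"


section \<open>Functions of bounded variation\<close>

text \<open>
  A function on an open set \<open>G\<close> is represented by a total function whose values outside \<open>G\<close>
  are irrelevant.
\<close>

definition Lip_loc :: "'a::metric_space set \<Rightarrow> ('a \<Rightarrow> real) set" where
  "Lip_loc G = {u. \<forall>x\<in>G. \<exists>r>0. \<exists>L. L-lipschitz_on (ball x r \<inter> G) u}"

text \<open>
  A complete metric space with a doubling measure is proper, so for open \<open>G\<close> the formulation of
  local integrability and convergence by compact subsets agrees with the one by neighbourhoods of
  points, and local integrability implies measurability on \<open>G\<close>.
\<close>

definition L1_loc :: "'a::metric_space measure \<Rightarrow> 'a set \<Rightarrow> ('a \<Rightarrow> real) set" where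
  "L1_loc M G = {u. \<forall>K. compact K \<and> K \<subseteq> G \<longrightarrow> set_integrable M K u}"

definition converges_L1_loc ::
    "'a::metric_space measure \<Rightarrow> 'a set \<Rightarrow> (nat \<Rightarrow> 'a \<Rightarrow> real) \<Rightarrow> ('a \<Rightarrow> real) \<Rightarrow> bool" where
  "converges_L1_loc M G U u \<longleftrightarrow>
     (\<forall>K. compact K \<and> K \<subseteq> G \<longrightarrow>
        (\<lambda>i. \<integral>\<^sup>+y\<in>K. ennreal \<bar>U i y - u y\<bar> \<partial>M) \<longlonglongrightarrow> 0)"

text \<open>For \<open>x\<close> in an open set \<open>G\<close> the limit inferior only sees values of \<open>u\<close> in \<open>G\<close>.\<close>

definition lip_slope :: "('a::metric_space \<Rightarrow> real) \<Rightarrow> 'a \<Rightarrow> ennreal" where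
  "lip_slope u x =
     Liminf (at_right 0) (\<lambda>r. SUP y\<in>ball x r. ennreal (\<bar>u y - u x\<bar> / r))"

definition total_variation :: "'a::metric_space measure \<Rightarrow> ('a \<Rightarrow> real) \<Rightarrow> 'a set \<Rightarrow> ennreal" where
  "total_variation M u G =
     Inf {liminf (\<lambda>i. \<integral>\<^sup>+y\<in>G. lip_slope (U i) y \<partial>M) | U.
            (\<forall>i. U i \<in> Lip_loc G) \<and> converges_L1_loc M G U u}"

definition BV :: "'a::metric_space measure \<Rightarrow> 'a set \<Rightarrow> ('a \<Rightarrow> real) set" where
  "BV M G = {u. u \<in> L1_loc M G \<and> total_variation M u G < \<infinity>}"

definition mean_value :: "'a measure \<Rightarrow> 'a set \<Rightarrow> ('a \<Rightarrow> real) \<Rightarrow> real" where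
  "mean_value M A u = (LINT y:A|M. u y) / measure M A"

definition BV_poincare :: "'a::metric_space measure \<Rightarrow> bool" where
  "BV_poincare M \<longleftrightarrow>
     (\<exists>C_P::real. \<exists>lam_P::real. C_P \<ge> 1 \<and> lam_P \<ge> 1 \<and>
        (\<forall>x r u. 0 < r \<and> u \<in> BV M UNIV \<longrightarrow>
           (\<integral>\<^sup>+y\<in>ball x r. ennreal \<bar>u y - mean_value M (ball x r) u\<bar> \<partial>M)
             \<le> ennreal (C_P * r) * total_variation M u (ball x (lam_P * r))))"

definition standard_assumptions :: "'a::metric_space measure \<Rightarrow> bool" where
  "standard_assumptions M \<longleftrightarrow>
     complete (UNIV :: 'a set) \<and> borel_regular M \<and> doubling_measure M \<and> BV_poincare M"


section \<open>Approximate limits\<close>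

text \<open>\<open>has_density M A x l\<close>: the limit defining \<open>D(A, x)\<close> exists and equals \<open>l\<close>.\<close>

definition has_density :: "'a::metric_space measure \<Rightarrow> 'a set \<Rightarrow> 'a \<Rightarrow> real \<Rightarrow> bool" where
  "has_density M A x l \<longleftrightarrow>
     ((\<lambda>r. measure M (A \<inter> ball x r) / measure M (ball x r)) \<longlongrightarrow> l) (at_right 0)"

definition approx_upper ::
    "'a::metric_space measure \<Rightarrow> 'a set \<Rightarrow> ('a \<Rightarrow> real) \<Rightarrow> 'a \<Rightarrow> ereal" where
  "approx_upper M \<Omega> u x = Inf {ereal s | s. has_density M {y\<in>\<Omega>. u y > s} x 0}"

definition approx_lower ::
    "'a::metric_space measure \<Rightarrow> 'a set \<Rightarrow> ('a \<Rightarrow> real) \<Rightarrow> 'a \<Rightarrow> ereal" where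
  "approx_lower M \<Omega> u x = Sup {ereal t | t. has_density M {y\<in>\<Omega>. u y < t} x 0}"

definition approx_continuous_at ::
    "'a::metric_space measure \<Rightarrow> 'a set \<Rightarrow> ('a \<Rightarrow> real) \<Rightarrow> 'a \<Rightarrow> bool" where
  "approx_continuous_at M \<Omega> u x \<longleftrightarrow>
     approx_upper M \<Omega> u x = ereal (u x) \<and> approx_lower M \<Omega> u x = ereal (u x)"

definition Lambda_level ::
    "'a::metric_space measure \<Rightarrow> 'a set \<Rightarrow> ('a \<Rightarrow> real) \<Rightarrow> real \<Rightarrow> 'a set" where
  "Lambda_level M \<Omega> u t =
     {x\<in>\<Omega>. approx_lower M \<Omega> u x \<le> ereal t \<and> ereal t \<le> approx_upper M \<Omega> u x}"


section \<open>Codimension-one Hausdorff measure\<close>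

text \<open>
  Coverings are by at most countably many balls of positive radius, indexed by \<open>I \<subseteq> \<nat>\<close>. Finite
  coverings have to be admitted: on the real line with Lebesgue measure every ball contributes 2,
  so with genuinely infinite coverings even the empty set would have infinite content.
\<close>

definition coH1_delta :: "'a::metric_space measure \<Rightarrow> real \<Rightarrow> 'a set \<Rightarrow> ennreal" where
  "coH1_delta M \<delta> A =
     Inf {(\<Sum>j. emeasure M (ball (c j) (r j)) / ennreal (r j) * indicator I j) | c r (I::nat set).
            (\<forall>j\<in>I. 0 < r j) \<and> A \<subseteq> (\<Union>j\<in>I. ball (c j) (r j)) \<and>
            (SUP j\<in>I. ennreal (r j)) < ennreal \<delta>}"

definition coH1 :: "'a::metric_space measure \<Rightarrow> 'a set \<Rightarrow> ennreal" where
  "coH1 M A = (SUP \<delta>\<in>{0<..}. coH1_delta M \<delta> A)"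

end

theory Submission
  imports Defs
begin

text \<open>
  By a weak form of the coarea formula, \<open>{u > s}\<close> has finite perimeter in \<open>\<Omega>\<close> for almost every \<open>s\<close>.
  Hence almost every \<open>t\<close> is approached from both sides by levels \<open>s' < t < s\<close> whose perimeters stay
  bounded, and \<open>{u = t}\<close> is a null set. For such \<open>s'\<close> and \<open>s\<close> close to \<open>t\<close>, at a fixed scale around a
  point \<open>x\<close> of \<open>\<Lambda>\<^sub>t\<close> one of the sets \<open>{u > s}\<close> and \<open>{u \<le> s'}\<close> fills a definite part of the ball. Since
  neither \<open>{u \<le> s}\<close> nor \<open>{u > s'}\<close> has density 0 at \<open>x\<close>, either one of the two level sets has
  intermediate density at some smaller scale, or one of them has small but non-vanishing density
  at \<open>x\<close>. In the first case the relative isoperimetric inequality and Vitali's covering lemma bound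
  the Hausdorff content by the perimeter. The points of the second kind form a null set, because
  the perimeter does not charge regions of small density.

  All limits are taken in shells of \<open>\<Omega>\<close>: the levels can be chosen uniformly only on
  compact parts of \<open>\<Omega>\<close>, and the perimeter bound is distributed over the shells.
\<close>

section \<open>Doubling spaces\<close>

text \<open>The variation is never shown to be a Borel measure. Superadditivity over finitely many
  disjoint open sets and lower semicontinuity take the place of additivity, and the covering and
  limit arguments are shaped to use only these two. Membership in \<open>Lambda_level\<close>
  constrains the levels strictly above and strictly below t, but not t itself:
  \<open>{u > t}\<close> may have density 0 at such a point. Hence two neighbouring levels are used,
  and how near to t they must lie depends on the covering scale \<delta>. So each
  \<open>coH1_delta\<close> is bounded with levels of its own; the bound is uniform because the
  perimeters are. The threshold \<open>low_density\<close> comes from an absorption argument: boxing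
  at scale r/2^k carries the factor 2^(-k), so for a small enough density a cut-off costs at most
  half of the nearby perimeter V, and V \<le> e + V/2 yields V \<le> 2e. The Poincare inequality
  concerns functions on the whole space, while level sets have finite perimeter only in \<Omega>; a
  Lipschitz cut-off therefore precedes its use.\<close>

locale doubling_poincare =
  fixes M :: "'a::metric_space measure" and C P L :: real
  assumes complete: "complete (UNIV :: 'a set)"
    and borel_sets: "sets borel \<subseteq> sets M"
    and C_ge_1: "C \<ge> 1"
    and doubling: "\<And>x r. 0 < r \<Longrightarrow> emeasure M (ball x (2 * r)) \<le> ennreal C * emeasure M (ball x r)"
    and emeasure_ball_pos: "\<And>x r. 0 < r \<Longrightarrow> 0 < emeasure M (ball x r)"
    and emeasure_ball_finite: "\<And>x r. 0 < r \<Longrightarrow> emeasure M (ball x r) < \<infinity>"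
    and P_ge_1: "P \<ge> 1" and L_ge_1: "L \<ge> 1"
    and poincare: "\<And>x r u. 0 < r \<Longrightarrow> u \<in> BV M UNIV \<Longrightarrow>
           (\<integral>\<^sup>+y\<in>ball x r. ennreal \<bar>u y - mean_value M (ball x r) u\<bar> \<partial>M)
             \<le> ennreal (P * r) * total_variation M u (ball x (L * r))"
begin

lemma space_M [simp]: "space M = UNIV"
  using borel_sets sets.sets_into_space[of UNIV M] by force

lemma open_sets [measurable]: "open A \<Longrightarrow> A \<in> sets M"
  using borel_sets by auto

lemma closed_sets [measurable]: "closed A \<Longrightarrow> A \<in> sets M"
  using borel_sets by auto

lemma borel_measurable_M: "f \<in> borel_measurable borel \<Longrightarrow> f \<in> borel_measurable M"
  unfolding measurable_def using borel_sets by auto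

lemma ball_fmeasurable [simp]: "ball x r \<in> fmeasurable M"
  using emeasure_ball_finite[of r x] by (cases "r > 0") (auto simp: fmeasurable_def ball_empty)

lemma bounded_emeasure_finite:
  assumes "bounded A" shows "emeasure M A < \<infinity>"
proof -
  obtain x e where "A \<subseteq> cball x e" using assms bounded_subset_cball by blast
  then have "A \<subseteq> ball x (\<bar>e\<bar> + 1)" by auto
  then have "emeasure M A \<le> emeasure M (ball x (\<bar>e\<bar> + 1))"
    by (intro emeasure_mono) auto
  also have "\<dots> < \<infinity>" by (rule emeasure_ball_finite) auto
  finally show ?thesis .
qed

lemma bounded_fmeasurable: "bounded A \<Longrightarrow> A \<in> sets M \<Longrightarrow> A \<in> fmeasurable M"
  using bounded_emeasure_finite by (auto simp: fmeasurable_def)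

lemma measure_ball_pos: "0 < r \<Longrightarrow> 0 < measure M (ball x r)"
  using emeasure_ball_pos[of r x] emeasure_ball_finite[of r x]
  by (auto simp: measure_def enn2real_positive_iff)

lemma emeasure_ball: "emeasure M (ball x r) = ennreal (measure M (ball x r))"
  by (rule emeasure_eq_measure2) simp

lemma Int_ball_fmeasurable: "A \<in> sets M \<Longrightarrow> A \<inter> ball x r \<in> fmeasurable M"
  by (intro bounded_fmeasurable) (auto intro: bounded_subset[OF bounded_ball])

lemma measure_doubling: "0 < r \<Longrightarrow> measure M (ball x (2 * r)) \<le> C * measure M (ball x r)"
  using doubling[of r x] C_ge_1 unfolding emeasure_ball
  by (subst (asm) ennreal_mult[symmetric]) (auto simp: ennreal_le_iff)

lemma measure_doubling_power: "0 < r \<Longrightarrow> measure M (ball x (2 ^ k * r)) \<le> C ^ k * measure M (ball x r)"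
proof (induction k)
  case (Suc k)
  have "measure M (ball x (2 * (2 ^ k * r))) \<le> C * measure M (ball x (2 ^ k * r))"
    using Suc.prems by (intro measure_doubling) auto
  also have "\<dots> \<le> C * (C ^ k * measure M (ball x r))"
    using Suc C_ge_1 by (intro mult_left_mono) auto
  finally show ?case by (simp add: mult_ac)
qed simp

lemma measure_ball_mono: "ball x r \<subseteq> ball y s \<Longrightarrow> measure M (ball x r) \<le> measure M (ball y s)"
  by (intro measure_mono_fmeasurable) auto

lemma measure_doubling_le:
  assumes "0 < r" "dist x y + s \<le> 2 ^ k * r"
  shows "measure M (ball y s) \<le> C ^ k * measure M (ball x r)"
proof -
  have "ball y s \<subseteq> ball x (2 ^ k * r)"
  proof
    fix z assume "z \<in> ball y s"
    then show "z \<in> ball x (2 ^ k * r)" using assms(2) dist_triangle[of x z y] by auto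
  qed
  then show ?thesis
    using measure_ball_mono measure_doubling_power[OF assms(1), of x k] by (meson order_trans)
qed

section \<open>Properness of the space and Vitali's covering lemma\<close>

text \<open>The balls of radius \<open>e / 2\<close> about points of \<open>S\<close> are disjoint
  and lie in one fixed ball, and by doubling each has at least the fraction \<open>1 / C ^ k\<close>
  of its measure. This bounds their number.\<close>

lemma finite_separated:
  fixes A :: "'a set"
  assumes "bounded A" "e > 0" "S \<subseteq> A" and sep: "\<And>x y. x \<in> S \<Longrightarrow> y \<in> S \<Longrightarrow> x \<noteq> y \<Longrightarrow> e \<le> dist x y"
  shows "finite S"
proof (cases "A = {}")
  case False
  then obtain a where a: "a \<in> A" by auto
  obtain R where R: "R > 0" "\<And>x. x \<in> A \<Longrightarrow> dist a x \<le> R"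
    using assms(1) bounded_any_center[of A a] by (metis le_max_iff_disj less_max_iff_disj zero_less_one max.strict_coboundedI1 order.strict_trans2 order.refl)
  obtain k :: nat where k: "(2 * R + e) / (e/2) < 2 ^ k" using real_arch_pow[of 2] by auto
  define b where "b = measure M (ball a (R + e))"
  have b: "0 < b" unfolding b_def using R assms by (intro measure_ball_pos) auto
  have lower: "b \<le> C ^ k * measure M (ball x (e / 2))" if "x \<in> S" for x
    unfolding b_def
  proof (rule measure_doubling_le)
    show "dist x a + (R + e) \<le> 2 ^ k * (e / 2)"
      using R(2)[of x] that assms(2,3) k by (auto simp: field_simps dist_commute)
  qed (use assms in auto)
  have "card T \<le> C ^ k" if T: "finite T" "T \<subseteq> S" for T
  proof -
    have "real (card T) * b = (\<Sum>x\<in>T. b)" by simp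
    also have "\<dots> \<le> (\<Sum>x\<in>T. C ^ k * measure M (ball x (e / 2)))"
      using lower T by (intro sum_mono) auto
    also have "\<dots> = C ^ k * (\<Sum>x\<in>T. measure M (ball x (e / 2)))" by (simp add: sum_distrib_left)
    also have "(\<Sum>x\<in>T. measure M (ball x (e / 2))) = measure M (\<Union>x\<in>T. ball x (e / 2))"
    proof (rule measure_finite_Union[symmetric])
      show "disjoint_family_on (\<lambda>x. ball x (e / 2)) T"
        unfolding disjoint_family_on_def
      proof safe
        fix x y z assume "x \<in> T" "y \<in> T" "x \<noteq> y" "z \<in> ball x (e/2)" "z \<in> ball y (e/2)"
        then show "z \<in> {}" using sep[of x y] T dist_triangle2[of x y z] by auto
      qed
    qed (use T emeasure_ball_finite assms in \<open>auto simp: emeasure_ball\<close>)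
    also have "\<dots> \<le> b" unfolding b_def
    proof (intro measure_mono_fmeasurable UN_least)
      fix x assume "x \<in> T"
      then have "dist a x \<le> R" using R T assms by auto
      then show "ball x (e/2) \<subseteq> ball a (R + e)"
      proof (intro subsetI)
        fix z assume "z \<in> ball x (e/2)"
        then show "z \<in> ball a (R + e)"
          using \<open>dist a x \<le> R\<close> dist_triangle[of a z x] assms(2) by auto
      qed
    qed (use T in auto)
    finally have "real (card T) * b \<le> C ^ k * b" using C_ge_1 by (simp add: mult_left_mono)
    then show ?thesis using b by simp
  qed
  then have "card T \<le> nat \<lceil>C ^ k\<rceil>" if "finite T" "T \<subseteq> S" for T
    using that by (meson le_nat_iff of_nat_ceiling order_trans real_nat_ceiling_ge of_nat_le_iff)
  then show "finite S" by (meson finite_if_finite_subsets_card_bdd)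
qed (use assms in auto)

text \<open>Total boundedness is the point: a maximal \<open>e\<close>-separated subset is finite by
  \<open>finite_separated\<close>, and by maximality its \<open>e\<close>-balls cover
  \<open>A\<close>.\<close>

lemma closed_bounded_compact:
  assumes "closed A" "bounded A" shows "compact (A :: 'a set)"
  unfolding compact_eq_totally_bounded
proof (intro conjI allI impI)
  show "complete A" using complete assms(1) complete_closed_subset[of A UNIV] by auto
  fix e :: real assume e: "e > 0"
  define S where "S = {S. S \<subseteq> A \<and> (\<forall>x\<in>S. \<forall>y\<in>S. x \<noteq> y \<longrightarrow> e \<le> dist x y)}"
  have "\<exists>T\<in>S. \<forall>X\<in>S. T \<subseteq> X \<longrightarrow> X = T"
  proof (rule subset_Zorn')
    fix c assume c: "subset.chain S c"
    have "\<exists>Z\<in>c. x \<in> Z \<and> y \<in> Z" if "x \<in> \<Union>c" "y \<in> \<Union>c" for x y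
      using c that unfolding subset.chain_def by blast
    moreover have "c \<subseteq> S" using c by (simp add: subset.chain_def)
    ultimately show "\<Union>c \<in> S" unfolding S_def by blast
  qed
  then obtain T where T: "T \<in> S" "\<And>X. X \<in> S \<Longrightarrow> T \<subseteq> X \<Longrightarrow> X = T" by blast
  have "finite T" by (rule finite_separated[OF assms(2) e]) (use T(1) in \<open>auto simp: S_def\<close>)
  moreover have "A \<subseteq> (\<Union>x\<in>T. ball x e)"
  proof
    fix y assume y: "y \<in> A"
    show "y \<in> (\<Union>x\<in>T. ball x e)"
    proof (rule ccontr)
      assume "\<not> ?thesis"
      then have far: "e \<le> dist x y" if "x \<in> T" for x using that by force
      then have "insert y T \<in> S" using T(1) y by (auto simp: S_def dist_commute)
      then have "y \<in> T" using T(2)[of "insert y T"] by auto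
      then show False using far[of y] e by simp
    qed
  qed
  ultimately show "\<exists>k. finite k \<and> A \<subseteq> (\<Union>x\<in>k. ball x e)" by blast
qed

lemma compact_cball: "compact (cball (x::'a) r)"
  by (intro closed_bounded_compact) auto

lemma sigma_finite_M: "sigma_finite_measure M"
proof
  fix x :: 'a
  have "\<Union> (range (\<lambda>n. ball x (real n))) = UNIV" by (auto simp: reals_Archimedean2)
  then show "\<exists>A::'a set set. countable A \<and> A \<subseteq> sets M \<and> \<Union> A = space M \<and> (\<forall>a\<in>A. emeasure M a \<noteq> \<infinity>)"
    by (intro exI[of _ "range (\<lambda>n. ball x (real n))"]) (auto simp: emeasure_ball)
qed

text \<open>Zorn's lemma replaces the greedy selection of nearly largest balls. Every ball then
  meets a selected one of at least half its radius, which puts its centre well inside the fivefold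
  dilation.\<close>

lemma vitali_covering:
  fixes r :: "'a \<Rightarrow> real"
  assumes "bounded A" and r: "\<And>x. x \<in> A \<Longrightarrow> 0 < r x" "\<And>x. x \<in> A \<Longrightarrow> r x \<le> R"
  obtains S where "countable S" "S \<subseteq> A" "disjoint_family_on (\<lambda>x. ball x (r x)) S"
    "A \<subseteq> (\<Union>x\<in>S. ball x (5 * r x))"
proof -
  \<comment> \<open>The last clause is the greedy invariant: a ball that meets the family meets a
    member of at least half its radius. It passes to unions of chains.\<close>
  define F where "F = {S. S \<subseteq> A \<and> disjoint_family_on (\<lambda>x. ball x (r x)) S \<and>
     (\<forall>y\<in>A. (\<exists>x\<in>S. ball x (r x) \<inter> ball y (r y) \<noteq> {}) \<longrightarrow>
            (\<exists>x\<in>S. ball x (r x) \<inter> ball y (r y) \<noteq> {} \<and> r y \<le> 2 * r x))}"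
  have "\<exists>S\<in>F. \<forall>X\<in>F. S \<subseteq> X \<longrightarrow> X = S"
  proof (rule subset_Zorn')
    fix c assume c: "subset.chain F c"
    have 1: "\<exists>Z\<in>c. x \<in> Z \<and> y \<in> Z" if "x \<in> \<Union>c" "y \<in> \<Union>c" for x y
      using c that unfolding subset.chain_def by blast
    have 2: "c \<subseteq> F" using c by (simp add: subset.chain_def)
    show "\<Union>c \<in> F" unfolding F_def
    proof (intro CollectI conjI ballI impI)
      show "\<Union>c \<subseteq> A" using 2 by (auto simp: F_def)
      show "disjoint_family_on (\<lambda>x. ball x (r x)) (\<Union>c)"
        unfolding disjoint_family_on_def
      proof (intro ballI impI)
        fix x y assume xy: "x \<in> \<Union>c" "y \<in> \<Union>c" "x \<noteq> y"
        then obtain Z where Z: "Z \<in> c" "x \<in> Z" "y \<in> Z" using 1 by blast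
        then have "disjoint_family_on (\<lambda>x. ball x (r x)) Z" using 2 by (auto simp: F_def)
        then show "ball x (r x) \<inter> ball y (r y) = {}" using Z xy by (auto simp: disjoint_family_on_def)
      qed
    next
      fix y assume y: "y \<in> A" "\<exists>x\<in>\<Union>c. ball x (r x) \<inter> ball y (r y) \<noteq> {}"
      then obtain Z x where Z: "Z \<in> c" "x \<in> Z" "ball x (r x) \<inter> ball y (r y) \<noteq> {}" by blast
      then have "\<exists>x\<in>Z. ball x (r x) \<inter> ball y (r y) \<noteq> {} \<and> r y \<le> 2 * r x"
        using 2 y by (auto simp: F_def)
      then show "\<exists>x\<in>\<Union>c. ball x (r x) \<inter> ball y (r y) \<noteq> {} \<and> r y \<le> 2 * r x" using Z by blast
    qed
  qed
  then obtain S where S: "S \<in> F" "\<And>X. X \<in> F \<Longrightarrow> S \<subseteq> X \<Longrightarrow> X = S" by blast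
  have SA: "S \<subseteq> A" and disj: "disjoint_family_on (\<lambda>x. ball x (r x)) S" using S by (auto simp: F_def)
  define G where "G = {y\<in>A. \<forall>x\<in>S. ball x (r x) \<inter> ball y (r y) = {}}"
  have "G = {}"
  proof (rule ccontr)
    assume ne: "G \<noteq> {}"
    have bdd: "bdd_above (r ` G)" using r by (auto simp: G_def intro!: bdd_aboveI[of _ R])
    obtain g where g: "g \<in> G" using ne by auto
    have "0 < r g" using r g by (auto simp: G_def)
    also have "r g \<le> (SUP y\<in>G. r y)" using g bdd by (rule cSUP_upper)
    finally have pos: "(SUP y\<in>G. r y) / 2 < (SUP y\<in>G. r y)" by simp
    \<comment> \<open>A radius above half the supremum over the remaining balls preserves the
      invariant when this ball is added.\<close>
    obtain y where y: "y \<in> G" "(SUP y\<in>G. r y) / 2 < r y"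
      using less_cSUP_iff[OF ne bdd] pos by blast
    have "insert y S \<in> F" unfolding F_def
    proof (intro CollectI conjI ballI impI)
      show "insert y S \<subseteq> A" using SA y by (auto simp: G_def)
      show "disjoint_family_on (\<lambda>x. ball x (r x)) (insert y S)"
        using disj y by (auto simp: G_def disjoint_family_on_def)
      fix z assume z: "z \<in> A" "\<exists>x\<in>insert y S. ball x (r x) \<inter> ball z (r z) \<noteq> {}"
      show "\<exists>x\<in>insert y S. ball x (r x) \<inter> ball z (r z) \<noteq> {} \<and> r z \<le> 2 * r x"
      proof (cases "z \<in> G")
        case True
        then have "ball y (r y) \<inter> ball z (r z) \<noteq> {}" using z(2) by (auto simp: G_def)
        moreover have "r z \<le> (SUP y\<in>G. r y)" using True bdd by (rule cSUP_upper)
        ultimately show ?thesis using y by auto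
      next
        case False
        then have "\<exists>x\<in>S. ball x (r x) \<inter> ball z (r z) \<noteq> {}" using z by (auto simp: G_def)
        then show ?thesis using S(1) z(1) by (auto simp: F_def)
      qed
    qed
    then have "y \<in> S" using S(2)[of "insert y S"] by auto
    then have "ball y (r y) = {}" using y by (auto simp: G_def)
    moreover have "y \<in> ball y (r y)" using y r by (auto simp: G_def)
    ultimately show False by simp
  qed
  have "A \<subseteq> (\<Union>x\<in>S. ball x (5 * r x))"
  proof
    fix y assume y: "y \<in> A"
    then have "\<exists>x\<in>S. ball x (r x) \<inter> ball y (r y) \<noteq> {} \<and> r y \<le> 2 * r x"
      using S(1) \<open>G = {}\<close> by (auto simp: F_def G_def)
    then obtain x z where xz: "x \<in> S" "dist x z < r x" "dist y z < r y" "r y \<le> 2 * r x" by auto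
    then have "dist x y < 5 * r x" using dist_triangle2[of x y z] r(1)[of x] SA by auto
    then show "y \<in> (\<Union>x\<in>S. ball x (5 * r x))" using xz by auto
  qed
  moreover have "countable S"
  proof -
    \<comment> \<open>Centres of disjoint balls of radius at least \<open>1 / real (Suc n)\<close>
      are separated by that distance.\<close>
    have "finite {x\<in>S. r x \<ge> 1 / real (Suc n)}" for n
    proof (rule finite_separated[OF assms(1), of "1 / real (Suc n)"])
      fix x y assume xy: "x \<in> {x\<in>S. r x \<ge> 1 / real (Suc n)}" "y \<in> {x\<in>S. r x \<ge> 1 / real (Suc n)}" "x \<noteq> y"
      then have "ball x (r x) \<inter> ball y (r y) = {}" using disj by (auto simp: disjoint_family_on_def)
      moreover have "y \<in> ball y (r y)" using xy SA r by auto
      ultimately have "y \<notin> ball x (r x)" by auto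
      then show "1 / real (Suc n) \<le> dist x y" using xy by auto
    qed (use SA in auto)
    then have "countable (\<Union>n. {x\<in>S. r x \<ge> 1 / real (Suc n)})" by (intro countable_UN countableI_type) (rule countable_finite)
    moreover have "S \<subseteq> (\<Union>n. {x\<in>S. r x \<ge> 1 / real (Suc n)})"
    proof
      fix x assume x: "x \<in> S"
      then have "0 < r x" using SA r by auto
      then obtain n where "1 / real (Suc n) < r x" using nat_approx_posE by blast
      then show "x \<in> (\<Union>n. {x\<in>S. r x \<ge> 1 / real (Suc n)})"
        using x less_imp_le by blast
    qed
    ultimately show ?thesis using countable_subset by blast
  qed
  ultimately show thesis using that SA disj by blast
qed

end

section \<open>The pointwise slope\<close>

text \<open>Source of the chain and product rules below: the increment bound survives division by
  \<open>r\<close> because \<open>dist x y < r\<close>, and the continuous increasing map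
  \<open>\<lambda>z. ennreal a * z + ennreal b\<close> commutes with \<open>Liminf\<close>.\<close>

lemma lip_slope_affine_le:
  assumes e: "e > 0" and a: "0 \<le> a" and b: "0 \<le> b"
    and le: "\<And>y. y \<in> ball x e \<Longrightarrow> \<bar>v y - v x\<bar> \<le> a * \<bar>u y - u x\<bar> + b * dist x y"
  shows "lip_slope v x \<le> ennreal a * lip_slope u x + ennreal b"
proof -
  define S where "S = (\<lambda>r. SUP y\<in>ball x r. ennreal (\<bar>u y - u x\<bar> / r))"
  have "lip_slope v x \<le> Liminf (at_right 0) (\<lambda>r. ennreal a * S r + ennreal b)"
    unfolding lip_slope_def
  proof (rule Liminf_mono)
    have "eventually (\<lambda>r. r \<in> {0<..<e}) (at_right 0)"
      using e by (intro eventually_at_right_real)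
    then show "eventually (\<lambda>r. (SUP y\<in>ball x r. ennreal (\<bar>v y - v x\<bar> / r)) \<le> ennreal a * S r + ennreal b) (at_right 0)"
    proof eventually_elim
      case (elim r)
      show ?case
      proof (rule SUP_least)
        fix y assume y: "y \<in> ball x r"
        then have "\<bar>v y - v x\<bar> \<le> a * \<bar>u y - u x\<bar> + b * dist x y" using elim by (intro le) auto
        also have "\<dots> \<le> a * \<bar>u y - u x\<bar> + b * r"
          using y b by (intro add_left_mono mult_left_mono) auto
        finally have "\<bar>v y - v x\<bar> / r \<le> a * (\<bar>u y - u x\<bar> / r) + b" using elim by (simp add: field_simps)
        then have "ennreal (\<bar>v y - v x\<bar> / r) \<le> ennreal a * ennreal (\<bar>u y - u x\<bar> / r) + ennreal b"
          using elim a b by (subst ennreal_mult[symmetric], auto simp flip: ennreal_plus intro!: ennreal_leI)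
        also have "ennreal (\<bar>u y - u x\<bar> / r) \<le> S r" unfolding S_def using y by (intro SUP_upper)
        finally show "ennreal (\<bar>v y - v x\<bar> / r) \<le> ennreal a * S r + ennreal b"
          by (simp add: add_mono mult_left_mono)
      qed
    qed
  qed
  also have "\<dots> = ennreal a * Liminf (at_right 0) S + ennreal b"
    by (rule Liminf_compose_continuous_mono[of "\<lambda>z. ennreal a * z + ennreal b"])
       (auto intro!: continuous_on_add_ennreal ennreal_continuous_on_cmult monoI add_mono mult_left_mono continuous_on_id)
  finally show ?thesis by (simp add: lip_slope_def S_def)
qed

lemma lip_slope_le:
  assumes "e > 0" "\<And>y. y \<in> ball x e \<Longrightarrow> \<bar>v y - v x\<bar> \<le> \<bar>u y - u x\<bar>"
  shows "lip_slope v x \<le> lip_slope u x"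
  using lip_slope_affine_le[of e 1 0 x v u] assms by simp

lemma lip_slope_locally_const:
  assumes "e > 0" "\<And>y. y \<in> ball x e \<Longrightarrow> v y = v x"
  shows "lip_slope v x = 0"
proof -
  have "lip_slope v x \<le> ennreal 0 * lip_slope v x + ennreal 0"
  proof (rule lip_slope_affine_le[OF assms(1)])
    fix y assume "y \<in> ball x e"
    from assms(2)[OF this] show "\<bar>v y - v x\<bar> \<le> 0 * \<bar>v y - v x\<bar> + 0 * dist x y" by simp
  qed auto
  then show ?thesis by simp
qed

text \<open>Rational radii suffice because the balls are open. This gives measurability of the slope.\<close>

lemma lip_slope_eq_rational:
  "lip_slope u x = (SUP n. INF q\<in>{q\<in>\<rat>. 0 < q \<and> q < 1 / real (Suc n)}. SUP y\<in>ball x q. ennreal (\<bar>u y - u x\<bar> / q))"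
  (is "_ = (SUP n. INF q\<in>?Q n. ?S q)")
proof (rule antisym)
  show "lip_slope u x \<le> (SUP n. INF q\<in>?Q n. ?S q)"
    unfolding lip_slope_def Liminf_def
  proof (rule SUP_least)
    fix R assume "R \<in> {R. eventually R (at_right (0::real))}"
    then obtain b where b: "b > 0" "\<And>r. 0 < r \<Longrightarrow> r < b \<Longrightarrow> R r"
      by (auto simp: eventually_at_right_field)
    obtain n where n: "1 / real (Suc n) < b" using b nat_approx_posE by blast
    have "(INF r\<in>Collect R. ?S r) \<le> (INF q\<in>?Q n. ?S q)"
      using b n by (intro INF_superset_mono) auto
    then show "(INF r\<in>Collect R. ?S r) \<le> (SUP n. INF q\<in>?Q n. ?S q)"
      by (rule order_trans) (rule SUP_upper, simp)
  qed
next
  show "(SUP n. INF q\<in>?Q n. ?S q) \<le> lip_slope u x"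
  proof (rule SUP_least)
    fix n
    have key: "(INF q\<in>?Q n. ?S q) \<le> ?S r" if r: "0 < r" "r < 1 / real (Suc n)" for r
    proof -
      define I where "I = (INF q\<in>?Q n. ?S q)"
      \<comment> \<open>A rational \<open>q\<close> with \<open>z * r < q < r\<close> costs at most
        the factor \<open>z\<close>, and \<open>z\<close> may then tend to 1.\<close>
      have le: "ennreal z * I \<le> ?S r" if z: "0 < z" "z < 1" for z
      proof -
        obtain q where q: "q \<in> \<rat>" "z * r < q" "q < r"
          using Rats_dense_in_real[of "z * r" r] z r by auto
        then have q0: "0 < q" using z r by (smt (verit) mult_pos_pos)
        have "ennreal z * I \<le> ennreal z * ?S q"
          unfolding I_def using q q0 r by (intro mult_left_mono INF_lower) auto
        also have "\<dots> = (SUP y\<in>ball x q. ennreal z * ennreal (\<bar>u y - u x\<bar> / q))"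
          using q0 by (intro SUP_mult_left_ennreal)
        also have "\<dots> \<le> ?S r"
        proof (rule SUP_least)
          fix y assume y: "y \<in> ball x q"
          have "z / q \<le> 1 / r" using q q0 r by (simp add: field_simps)
          then have "(z / q) * \<bar>u y - u x\<bar> \<le> (1 / r) * \<bar>u y - u x\<bar>" by (intro mult_right_mono) auto
          then have "ennreal z * ennreal (\<bar>u y - u x\<bar> / q) \<le> ennreal (\<bar>u y - u x\<bar> / r)"
            using z q0 by (simp flip: ennreal_mult add: ennreal_leI)
          also have "\<dots> \<le> ?S r" using y q by (intro SUP_upper) auto
          finally show "ennreal z * ennreal (\<bar>u y - u x\<bar> / q) \<le> ?S r" .
        qed
        finally show ?thesis .
      qed
      show ?thesis
      proof (cases "?S r = top")
        case False
        have "ennreal (1/2) * I \<le> ?S r" by (rule le) auto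
        have "I \<noteq> top"
        proof
          assume "I = top"
          then have "ennreal (1/2) * I = top" by (simp add: ennreal_mult_top)
          then show False using \<open>ennreal (1/2) * I \<le> ?S r\<close> False by (metis top_unique)
        qed
        then obtain i where i: "I = ennreal i" "0 \<le> i" by (cases I) auto
        obtain s where s: "?S r = ennreal s" "0 \<le> s" using False by (cases "?S r") auto
        have "z * i \<le> s" if "0 < z" "z < 1" for z
          using le[OF that] that i s by (simp flip: ennreal_mult)
        then have "i \<le> s" by (rule field_le_mult_one_interval)
        then show ?thesis using i s I_def by (simp add: ennreal_leI)
      next
        case True
        show ?thesis unfolding True by simp
      qed
    qed
    have "eventually (\<lambda>r. r \<in> {0<..<1 / real (Suc n)}) (at_right 0)"
      by (intro eventually_at_right_real) auto
    then have "eventually (\<lambda>r. (INF q\<in>?Q n. ?S q) \<le> ?S r) (at_right 0)"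
      by eventually_elim (use key in auto)
    then show "(INF q\<in>?Q n. ?S q) \<le> lip_slope u x"
      unfolding lip_slope_def by (rule Liminf_bounded)
  qed
qed

lemma borel_measurable_lip_slope:
  assumes G: "open G" and u: "continuous_on G u"
  shows "(\<lambda>x. lip_slope u x * indicator G x) \<in> borel_measurable borel"
proof -
  let ?Q = "\<lambda>n. {q\<in>\<rat>. 0 < q \<and> q < 1 / real (Suc n)}"
  let ?S = "\<lambda>q x. SUP y\<in>ball x q. ennreal (\<bar>u y - u x\<bar> / q)"
  have meas: "(\<lambda>x. ?S q x * indicator G x) \<in> borel_measurable borel" for q
  proof (rule borel_measurableI_greater)
    fix c :: ennreal
    \<comment> \<open>Centre and competitor exchange roles: for fixed \<open>y\<close>, both
      \<open>x \<in> ball y q\<close> and the bound on the quotient are open conditions on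
      \<open>x\<close>.\<close>
    have "{x. c < ?S q x * indicator G x} =
        (\<Union>y. ball y q \<inter> ((\<lambda>x. ennreal (\<bar>u y - u x\<bar> / q)) -` {c<..} \<inter> G))"
      by (auto simp: indicator_def less_SUP_iff dist_commute split: if_splits)
    moreover have "open ((\<lambda>x. ennreal (\<bar>u y - u x\<bar> / q)) -` {c<..} \<inter> G)" for y
    proof -
      have "continuous_on G (\<lambda>x. ennreal (\<bar>u y - u x\<bar> / q))"
        by (intro continuous_on_ennreal) (auto simp: divide_inverse intro!: continuous_intros u)
      then show ?thesis using continuous_on_open_vimage[OF G] open_greaterThan by metis
    qed
    ultimately have "open {x. c < ?S q x * indicator G x}" by (simp add: open_UN open_Int)
    then show "{x \<in> space borel. c < ?S q x * indicator G x} \<in> sets borel" by simp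
  qed
  \<comment> \<open>Over an empty index set the infimum would be \<open>top\<close> instead of 0
    outside \<open>G\<close>.\<close>
  have ne: "?Q n \<noteq> {}" for n
  proof -
    obtain q where "q \<in> \<rat>" "0 < q" "q < 1 / real (Suc n)" using Rats_dense_in_real[of 0 "1 / real (Suc n)"] by auto
    then show ?thesis by blast
  qed
  have "lip_slope u x * indicator G x = (SUP n. INF q\<in>?Q n. ?S q x * indicator G x)" for x
  proof (cases "x \<in> G")
    case False
    have "(INF q\<in>?Q n. 0) = (0::ennreal)" for n using ne[of n] by (rule cINF_const)
    then show ?thesis using False by simp
  qed (simp only: lip_slope_eq_rational indicator_simps mult_1_right)
  moreover have "(\<lambda>x. SUP n. INF q\<in>?Q n. ?S q x * indicator G x) \<in> borel_measurable borel"
    by (intro borel_measurable_SUP borel_measurable_INF meas)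
       (auto intro: countable_subset[OF _ countable_rat])
  ultimately show ?thesis by simp
qed

section \<open>Locally Lipschitz functions\<close>

lemma Lip_loc_imp_continuous_on:
  assumes "open G" "u \<in> Lip_loc G" shows "continuous_on G u"
proof (rule continuous_at_imp_continuous_on, rule ballI)
  fix x assume x: "x \<in> G"
  then obtain r K where r: "r > 0" "K-lipschitz_on (ball x r \<inter> G) u" using assms(2) by (auto simp: Lip_loc_def)
  then have "continuous_on (ball x r \<inter> G) u" by (intro lipschitz_on_continuous_on)
  moreover have "open (ball x r \<inter> G)" "x \<in> ball x r \<inter> G" using assms x r by auto
  ultimately show "isCont u x" by (simp add: continuous_on_eq_continuous_at)
qed

lemma Lip_loc_subset: "u \<in> Lip_loc G \<Longrightarrow> H \<subseteq> G \<Longrightarrow> u \<in> Lip_loc H"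
  unfolding Lip_loc_def
proof safe
  fix x assume "\<forall>x\<in>G. \<exists>r>0. \<exists>L. L-lipschitz_on (ball x r \<inter> G) u" "H \<subseteq> G" "x \<in> H"
  then obtain r L where "r > 0" "L-lipschitz_on (ball x r \<inter> G) u" by blast
  then show "\<exists>r>0. \<exists>L. L-lipschitz_on (ball x r \<inter> H) u"
    using \<open>H \<subseteq> G\<close> lipschitz_on_subset[of L "ball x r \<inter> G" u "ball x r \<inter> H"] by blast
qed

text \<open>Counterpart of \<open>lip_slope_affine_le\<close> for membership: truncations, ramps and
  cut-off products all satisfy such an increment bound.\<close>

lemma Lip_loc_affine_le:
  assumes u: "u \<in> Lip_loc G" and "0 \<le> a" "0 \<le> b"
    and le: "\<And>x y. x \<in> G \<Longrightarrow> y \<in> G \<Longrightarrow> \<bar>v y - v x\<bar> \<le> a * \<bar>u y - u x\<bar> + b * dist x y"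
  shows "v \<in> Lip_loc G"
  unfolding Lip_loc_def
proof safe
  fix x assume "x \<in> G"
  then obtain r K where r: "r > 0" "K-lipschitz_on (ball x r \<inter> G) u" using u by (auto simp: Lip_loc_def)
  have "(a * K + b)-lipschitz_on (ball x r \<inter> G) v"
  proof (rule lipschitz_onI)
    fix y z assume yz: "y \<in> ball x r \<inter> G" "z \<in> ball x r \<inter> G"
    have "\<bar>v z - v y\<bar> \<le> a * \<bar>u z - u y\<bar> + b * dist y z" using yz by (intro le) auto
    also have "\<dots> \<le> a * (K * dist y z) + b * dist y z"
      using lipschitz_onD[OF r(2) yz] assms by (intro add_mono mult_left_mono) (auto simp: dist_real_def)
    finally show "dist (v y) (v z) \<le> (a * K + b) * dist y z"
      by (simp add: dist_real_def algebra_simps)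
  qed (use assms lipschitz_on_nonneg[OF r(2)] in auto)
  then show "\<exists>r>0. \<exists>L. L-lipschitz_on (ball x r \<inter> G) v" using r by blast
qed

text \<open>Serves to glue a cut-off product with the zero function on the open set where the
  cut-off vanishes.\<close>

lemma Lip_loc_Un:
  assumes "open G" "open H" "u \<in> Lip_loc G" "u \<in> Lip_loc H"
  shows "u \<in> Lip_loc (G \<union> H)"
proof -
  have *: "\<exists>r>0. \<exists>L. L-lipschitz_on (ball x r \<inter> (G \<union> H)) u" if U: "x \<in> U" "open U" "u \<in> Lip_loc U" for x U
  proof -
    obtain r K where r: "r > 0" "K-lipschitz_on (ball x r \<inter> U) u" using U unfolding Lip_loc_def by blast
    obtain s where s: "s > 0" "ball x s \<subseteq> U" using U(1,2) by (meson open_contains_ball)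
    have "K-lipschitz_on (ball x (min r s) \<inter> (G \<union> H)) u"
      using s by (intro lipschitz_on_subset[OF r(2)]) auto
    then show ?thesis using r s by (intro exI[of _ "min r s"]) auto
  qed
  show ?thesis unfolding Lip_loc_def using * assms by blast
qed

lemma Lip_loc_const: "(\<lambda>_. c) \<in> Lip_loc G"
  unfolding Lip_loc_def using lipschitz_on_constant zero_less_one by blast

lemma Lip_loc_cong: "(\<And>x. x \<in> G \<Longrightarrow> u x = v x) \<Longrightarrow> u \<in> Lip_loc G \<longleftrightarrow> v \<in> Lip_loc G"
  unfolding Lip_loc_def lipschitz_on_def by auto

section \<open>Total variation\<close>

abbreviation energy :: "'a::metric_space measure \<Rightarrow> 'a set \<Rightarrow> ('a \<Rightarrow> real) \<Rightarrow> ennreal" where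
  "energy M G w \<equiv> \<integral>\<^sup>+y\<in>G. lip_slope w y \<partial>M"

abbreviation L1_dist :: "'a measure \<Rightarrow> 'a set \<Rightarrow> ('a \<Rightarrow> real) \<Rightarrow> ('a \<Rightarrow> real) \<Rightarrow> ennreal" where
  "L1_dist M K f g \<equiv> \<integral>\<^sup>+y\<in>K. ennreal \<bar>f y - g y\<bar> \<partial>M"

lemma total_variation_le_liminf:
  assumes "\<And>i. w i \<in> Lip_loc G" "converges_L1_loc M G w f"
  shows "total_variation M f G \<le> liminf (\<lambda>i. energy M G (w i))"
  unfolding total_variation_def by (intro Inf_lower) (use assms in blast)

lemma total_variation_le:
  assumes "\<And>i. w i \<in> Lip_loc G" "converges_L1_loc M G w f"
    and "\<And>i. energy M G (w i) \<le> b"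
  shows "total_variation M f G \<le> b"
proof -
  have "liminf (\<lambda>i. energy M G (w i)) \<le> liminf (\<lambda>i. b)"
    using assms(3) by (intro Liminf_mono) auto
  also have "\<dots> = b" by (simp add: Liminf_const)
  finally show ?thesis using total_variation_le_liminf[of w G M f, OF assms(1,2)] by simp
qed

lemma converges_L1_loc_le:
  assumes "converges_L1_loc M G w f" "H \<subseteq> G"
    and "\<And>i y. y \<in> H \<Longrightarrow> \<bar>w' i y - f' y\<bar> \<le> \<bar>w i y - f y\<bar>"
  shows "converges_L1_loc M H w' f'"
  unfolding converges_L1_loc_def
proof safe
  fix K assume K: "compact K" "K \<subseteq> H"
  have "(\<lambda>i. L1_dist M K (w i) f) \<longlonglongrightarrow> 0"
    using assms(1,2) K by (auto simp: converges_L1_loc_def)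
  then show "(\<lambda>i. L1_dist M K (w' i) f') \<longlonglongrightarrow> 0"
  proof (rule tendsto_sandwich[OF always_eventually always_eventually tendsto_const, rotated 2])
    show "\<forall>i. L1_dist M K (w' i) f' \<le> L1_dist M K (w i) f"
      using assms(3) K by (intro allI nn_integral_mono) (auto intro!: ennreal_leI simp: indicator_def)
  qed (rule allI, rule zero_le)
qed

lemma converges_L1_loc_subseq:
  assumes "converges_L1_loc M G w f" "strict_mono (r :: nat \<Rightarrow> nat)"
  shows "converges_L1_loc M G (\<lambda>i. w (r i)) f"
  unfolding converges_L1_loc_def
proof safe
  fix K assume "compact K" "K \<subseteq> G"
  then have "(\<lambda>i. L1_dist M K (w i) f) \<longlonglongrightarrow> 0"
    using assms(1) by (auto simp: converges_L1_loc_def)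
  from LIMSEQ_subseq_LIMSEQ[OF this assms(2)]
  show "(\<lambda>i. \<integral>\<^sup>+y\<in>K. ennreal \<bar>w (r i) y - f y\<bar> \<partial>M) \<longlonglongrightarrow> 0" by (simp add: o_def)
qed

text \<open>The infimum controls only a limit inferior; a subsequence turns this into a bound on
  every single energy.\<close>

lemma total_variation_approx:
  assumes "total_variation M f G < b"
  obtains w where "\<And>i. w i \<in> Lip_loc G" "converges_L1_loc M G w f"
    "\<And>i. energy M G (w i) < b"
proof -
  obtain w where w: "\<And>i. w i \<in> Lip_loc G" "converges_L1_loc M G w f"
    "liminf (\<lambda>i. energy M G (w i)) < b"
    using assms unfolding total_variation_def Inf_less_iff by blast
  have nev: "\<not> eventually (\<lambda>i. b \<le> energy M G (w i)) sequentially"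
  proof
    assume "eventually (\<lambda>i. b \<le> energy M G (w i)) sequentially"
    then have "b \<le> liminf (\<lambda>i. energy M G (w i))" by (rule Liminf_bounded)
    then show False using w(3) by simp
  qed
  then obtain r :: "nat \<Rightarrow> nat" where r: "strict_mono r" "\<And>n. \<not> b \<le> energy M G (w (r n))"
    using not_eventually_sequentiallyD[OF nev] by blast
  show thesis
    by (rule that[of "\<lambda>i. w (r i)"]) (use w r converges_L1_loc_subseq[OF w(2) r(1)] in \<open>auto simp: not_le\<close>)
qed

text \<open>Truncation to [0, 1] increases neither slopes nor distances to a function with values in
  [0, 1]. Bounded competitors keep the extra term of the product rule under control.\<close>

lemma total_variation_approx_01:
  assumes "total_variation M f G < b" "\<And>x. x \<in> G \<Longrightarrow> 0 \<le> f x \<and> f x \<le> 1"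
  obtains w where "\<And>i. w i \<in> Lip_loc G" "converges_L1_loc M G w f"
    "\<And>i. energy M G (w i) < b" "\<And>i x. 0 \<le> w i x \<and> w i x \<le> 1"
proof -
  obtain w where w: "\<And>i. w i \<in> Lip_loc G" "converges_L1_loc M G w f"
    "\<And>i. energy M G (w i) < b" using total_variation_approx[OF assms(1)] by blast
  let ?w = "\<lambda>i x. max 0 (min 1 (w i x))"
  show thesis
  proof (rule that[of ?w])
    fix i
    show "?w i \<in> Lip_loc G" by (rule Lip_loc_affine_le[OF w(1)[of i], of 1 0]) auto
    have "lip_slope (?w i) y \<le> lip_slope (w i) y" for y by (rule lip_slope_le[of 1]) auto
    then have "energy M G (?w i) \<le> energy M G (w i)"
      by (intro nn_integral_mono mult_right_mono) auto
    then show "energy M G (?w i) < b" using w(3)[of i] by simp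
  next
    show "converges_L1_loc M G ?w f"
    proof (rule converges_L1_loc_le[OF w(2)])
      fix i y assume "y \<in> G"
      then show "\<bar>?w i y - f y\<bar> \<le> \<bar>w i y - f y\<bar>" using assms(2)[of y] by auto
    qed auto
  qed auto
qed

lemma total_variation_mono: "H \<subseteq> G \<Longrightarrow> total_variation M f H \<le> total_variation M f G"
  unfolding total_variation_def
proof (rule Inf_mono, safe)
  fix w assume HG: "H \<subseteq> G" and w: "\<forall>i. w i \<in> Lip_loc G" "converges_L1_loc M G w f"
  have "liminf (\<lambda>i. energy M H (w i)) \<le> liminf (\<lambda>i. energy M G (w i))"
    using HG by (intro Liminf_mono always_eventually allI nn_integral_mono mult_left_mono) (auto simp: indicator_def)
  moreover have "\<And>i. w i \<in> Lip_loc H" using w HG Lip_loc_subset by blast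
  moreover have "converges_L1_loc M H w f" using converges_L1_loc_le[OF w(2) HG] by auto
  ultimately show "\<exists>a\<in>{liminf (\<lambda>i. \<integral>\<^sup>+ x\<in>H. lip_slope (U i) x \<partial>M) |U. (\<forall>i. U i \<in> Lip_loc H) \<and> converges_L1_loc M H U f}.
      a \<le> liminf (\<lambda>i. \<integral>\<^sup>+ x\<in>G. lip_slope (w i) x \<partial>M)" by blast
qed

lemma total_variation_cong:
  assumes "\<And>x. x \<in> G \<Longrightarrow> f x = g x" shows "total_variation M f G = total_variation M g G"
proof -
  have "converges_L1_loc M G w f \<longleftrightarrow> converges_L1_loc M G w g" for w
    using assms by (auto intro: converges_L1_loc_le)
  then show ?thesis unfolding total_variation_def by simp
qed

lemma total_variation_one_minus_le: "total_variation M (\<lambda>x. 1 - f x) G \<le> total_variation M f G"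
proof (rule dense_ge)
  fix b assume "total_variation M f G < b"
  then obtain w where w: "\<And>i. w i \<in> Lip_loc G" "converges_L1_loc M G w f"
    "\<And>i. energy M G (w i) < b" using total_variation_approx by blast
  show "total_variation M (\<lambda>x. 1 - f x) G \<le> b"
  proof (rule total_variation_le[of "\<lambda>i x. 1 - w i x"])
    show "(\<lambda>x. 1 - w i x) \<in> Lip_loc G" for i by (rule Lip_loc_affine_le[OF w(1)[of i], of 1 0]) auto
    show "converges_L1_loc M G (\<lambda>i x. 1 - w i x) (\<lambda>x. 1 - f x)" by (rule converges_L1_loc_le[OF w(2)]) auto
    fix i
    have "lip_slope (\<lambda>x. 1 - w i x) y \<le> lip_slope (w i) y" for y by (rule lip_slope_le[of 1]) auto
    then have "energy M G (\<lambda>x. 1 - w i x) \<le> energy M G (w i)"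
      by (intro nn_integral_mono mult_right_mono) auto
    then show "energy M G (\<lambda>x. 1 - w i x) \<le> b" using w(3)[of i] by simp
  qed
qed

text \<open>The centre \<open>undefined\<close> is an arbitrary base point.\<close>

definition exhaust :: "'a::metric_space set \<Rightarrow> nat \<Rightarrow> 'a set" where
  "exhaust U n = cball undefined (real n) - (\<Union>z\<in>-U. ball z (1 / real (Suc n)))"

lemma exhaust_subset: "exhaust U n \<subseteq> U"
  unfolding exhaust_def by force

lemma closed_exhaust: "closed (exhaust U n)"
  unfolding exhaust_def by (intro closed_Diff open_UN) auto

text \<open>The gap between consecutive radii gives each stage a uniform neighbourhood inside the
  next one; the shells rely on this.\<close>

lemma exhaust_nbhd:
  assumes x: "x \<in> exhaust U n" and xy: "dist x y \<le> 1 / real (Suc n) - 1 / real (Suc (Suc n))"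
  shows "y \<in> exhaust U (Suc n)"
proof -
  have le1: "1 / real (Suc n) - 1 / real (Suc (Suc n)) \<le> 1"
  proof -
    have "1 / real (Suc n) \<le> 1" "0 \<le> 1 / real (Suc (Suc n))" by (auto simp: divide_le_eq_1)
    then show ?thesis by linarith
  qed
  have "dist undefined x \<le> real n" using x by (simp add: exhaust_def)
  then have "dist undefined y \<le> real (Suc n)" using dist_triangle[of undefined y x] xy le1 by simp
  moreover have "\<not> dist z y < 1 / real (Suc (Suc n))" if "z \<notin> U" for z
  proof -
    have "1 / real (Suc n) \<le> dist z x" using x that by (fastforce simp: exhaust_def not_less)
    then show ?thesis using dist_triangle2[of z x y] xy by (simp add: dist_commute)
  qed
  ultimately show ?thesis by (auto simp: exhaust_def)
qed

lemma exhaust_radius_pos: "0 < 1 / real (Suc n) - 1 / real (Suc (Suc n))"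
proof -
  have "1 / real (Suc (Suc n)) < 1 / real (Suc n)" by (rule divide_strict_left_mono) auto
  then show ?thesis by simp
qed

lemma exhaust_mono: "n \<le> m \<Longrightarrow> exhaust U n \<subseteq> exhaust U m"
proof (induction m rule: dec_induct)
  case (step m)
  have "exhaust U m \<subseteq> exhaust U (Suc m)"
    using exhaust_nbhd[of _ U m] exhaust_radius_pos[of m] by (intro subsetI) (metis dist_self less_imp_le)
  then show ?case using step by blast
qed auto

lemma compact_subset_exhaust:
  assumes "open U" "compact K" "K \<subseteq> U"
  shows "\<exists>N. \<forall>n\<ge>N. K \<subseteq> exhaust U n"
proof -
  obtain e where e: "e > 0" "(\<Union>x\<in>K. ball x e) \<subseteq> U"
    using compact_subset_open_imp_ball_epsilon_subset assms by metis
  obtain N1 where N1: "1 / real (Suc N1) < e" using e nat_approx_posE by blast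
  obtain R where R: "\<And>x. x \<in> K \<Longrightarrow> dist undefined x \<le> R"
    using compact_imp_bounded[OF assms(2)] bounded_any_center[of K undefined] by blast
  obtain N2 where N2: "R \<le> real N2" using real_arch_simple by blast
  have "K \<subseteq> exhaust U (max N1 N2)"
  proof
    fix x assume x: "x \<in> K"
    have "1 / real (Suc (max N1 N2)) \<le> 1 / real (Suc N1)" by (simp add: field_simps)
    then have small: "1 / real (Suc (max N1 N2)) < e" using N1 by linarith
    have "\<not> dist z x < 1 / real (Suc (max N1 N2))" if "z \<notin> U" for z
    proof -
      have "z \<notin> ball x e" using that e(2) x by blast
      then show ?thesis using small by (simp add: dist_commute)
    qed
    moreover have "dist undefined x \<le> real (max N1 N2)" using R[OF x] N2 by simp
    ultimately show "x \<in> exhaust U (max N1 N2)" by (auto simp: exhaust_def)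
  qed
  then show ?thesis using exhaust_mono by blast
qed

lemma eventually_in_exhaust: "open U \<Longrightarrow> x \<in> U \<Longrightarrow> eventually (\<lambda>n. x \<in> exhaust U n) sequentially"
  using compact_subset_exhaust[of U "{x}"] by (auto simp: eventually_sequentially)

lemma converges_L1_locD:
  "converges_L1_loc M G w f \<Longrightarrow> compact K \<Longrightarrow> K \<subseteq> G \<Longrightarrow>
     (\<lambda>i. L1_dist M K (w i) f) \<longlonglongrightarrow> 0"
  unfolding converges_L1_loc_def by blast

lemma ennreal_tendsto_0_le:
  fixes a b :: "nat \<Rightarrow> ennreal"
  assumes "eventually (\<lambda>k. a k \<le> b k) sequentially" "b \<longlonglongrightarrow> 0"
  shows "a \<longlonglongrightarrow> 0"
  by (rule tendsto_sandwich[of "\<lambda>_. 0" a sequentially b]) (use assms in simp_all)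

text \<open>A compact \<open>K\<close> in \<open>H\<close> may leave \<open>G\<close>, where nothing
  is known about \<open>w\<close>. Since \<open>h\<close> vanishes off \<open>T\<close>, the error
  lives on \<open>K \<inter> T\<close>, a compact subset of \<open>G\<close>.\<close>

lemma converges_L1_loc_cutoff:
  assumes conv: "converges_L1_loc M G w f" and h: "\<And>y. 0 \<le> h y \<and> h y \<le> (1::real)"
    and T: "closed T" "\<And>y. y \<notin> T \<Longrightarrow> h y = 0" "H \<inter> T \<subseteq> G"
  shows "converges_L1_loc M H (\<lambda>i y. h y * w i y) (\<lambda>y. h y * f y)"
  unfolding converges_L1_loc_def
proof safe
  fix K assume K: "compact K" "K \<subseteq> H"
  have lim: "(\<lambda>i. L1_dist M (K \<inter> T) (w i) f) \<longlonglongrightarrow> 0"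
    using K T by (intro converges_L1_locD[OF conv] compact_Int_closed) auto
  have le: "L1_dist M K (\<lambda>y. h y * w i y) (\<lambda>y. h y * f y) \<le> L1_dist M (K \<inter> T) (w i) f" for i
  proof (rule nn_integral_mono)
    fix y
    have "\<bar>h y * w i y - h y * f y\<bar> = h y * \<bar>w i y - f y\<bar>"
      using h[of y] by (simp add: abs_mult flip: right_diff_distrib)
    also have "\<dots> \<le> \<bar>w i y - f y\<bar>"
      using h[of y] mult_right_mono[of "h y" 1 "\<bar>w i y - f y\<bar>"] by simp
    finally show "ennreal \<bar>h y * w i y - h y * f y\<bar> * indicator K y
        \<le> ennreal \<bar>w i y - f y\<bar> * indicator (K \<inter> T) y"
      using T(2)[of y] by (cases "y \<in> T") (auto simp: indicator_def intro: ennreal_leI)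
  qed
  show "(\<lambda>i. L1_dist M K (\<lambda>y. h y * w i y) (\<lambda>y. h y * f y)) \<longlonglongrightarrow> 0"
    by (rule ennreal_tendsto_0_le[OF always_eventually[OF allI[OF le]] lim])
qed

text \<open>Fatou's lemma for the counting measure.\<close>

lemma sum_liminf_le:
  fixes a :: "'j \<Rightarrow> nat \<Rightarrow> ennreal"
  assumes "finite J"
  shows "(\<Sum>j\<in>J. liminf (a j)) \<le> liminf (\<lambda>i. \<Sum>j\<in>J. a j i)"
proof -
  have "(\<Sum>j\<in>J. liminf (a j)) = (\<integral>\<^sup>+j. liminf (\<lambda>i. a j i) \<partial>count_space J)"
    using assms by (simp add: nn_integral_count_space_finite)
  also have "\<dots> \<le> liminf (\<lambda>i. \<integral>\<^sup>+j. a j i \<partial>count_space J)"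
    by (intro nn_integral_liminf) auto
  finally show ?thesis using assms by (simp add: nn_integral_count_space_finite)
qed

section \<open>Superadditivity and lower semicontinuity of the variation\<close>

context doubling_poincare
begin

lemma compact_exhaust: "compact (exhaust (U::'a set) n)"
  by (intro closed_bounded_compact closed_exhaust bounded_subset[OF bounded_cball[of undefined "real n"]])
     (auto simp: exhaust_def)

lemma lip_slope_measurable:
  "open G \<Longrightarrow> w \<in> Lip_loc G \<Longrightarrow> (\<lambda>y. lip_slope w y * indicator G y) \<in> borel_measurable M"
  by (intro borel_measurable_M borel_measurable_lip_slope Lip_loc_imp_continuous_on)

lemma continuous_measurable:
  fixes w :: "'a \<Rightarrow> real"
  shows "open G \<Longrightarrow> continuous_on G w \<Longrightarrow> (\<lambda>y. w y * indicator G y) \<in> borel_measurable M"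
  using borel_measurable_continuous_on_indicator[of G w] by (intro borel_measurable_M) (simp add: mult.commute)

lemma Lip_loc_measurable:
  "open G \<Longrightarrow> w \<in> Lip_loc G \<Longrightarrow> (\<lambda>y. w y * indicator G y) \<in> borel_measurable M"
  by (intro continuous_measurable Lip_loc_imp_continuous_on)

lemma L1_loc_measurable:
  assumes "open G" "u \<in> L1_loc M G"
  shows "(\<lambda>y. u y * indicator G y) \<in> borel_measurable M"
proof (rule borel_measurable_LIMSEQ_real)
  fix n
  have "set_integrable M (exhaust G n) u"
    using assms compact_exhaust[of G n] exhaust_subset[of G n] by (auto simp: L1_loc_def)
  then show "(\<lambda>y. u y * indicator (exhaust G n) y) \<in> borel_measurable M"
    unfolding set_integrable_def by (auto simp: mult.commute dest: borel_measurable_integrable)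
next
  fix y
  show "(\<lambda>n. u y * indicator (exhaust G n) y) \<longlonglongrightarrow> u y * indicator G y"
  proof (cases "y \<in> G")
    case True
    have "eventually (\<lambda>n. u y * indicator (exhaust G n) y = u y * indicator G y) sequentially"
      using eventually_in_exhaust[OF assms(1) True] by eventually_elim (use True in auto)
    then show ?thesis by (rule tendsto_eventually)
  next
    case False
    then have "y \<notin> exhaust G n" for n using exhaust_subset[of G n] by auto
    then show ?thesis using False by simp
  qed
qed

text \<open>One competing sequence on \<open>U\<close> restricts to all the \<open>G j\<close> at
  once, its energies on disjoint sets add up to at most the energy on \<open>U\<close>, and the
  limit inferior is superadditive.\<close>

lemma total_variation_superadditive:
  assumes "finite J" "disjoint_family_on G J" and G: "\<And>j. j \<in> J \<Longrightarrow> open (G j)" "\<And>j. j \<in> J \<Longrightarrow> G j \<subseteq> U"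
  shows "(\<Sum>j\<in>J. total_variation M f (G j)) \<le> total_variation M f U"
  unfolding total_variation_def[of M f U]
proof (rule Inf_greatest, safe)
  fix w assume w: "\<forall>i. w i \<in> Lip_loc U" "converges_L1_loc M U w f"
  have "(\<Sum>j\<in>J. total_variation M f (G j)) \<le> (\<Sum>j\<in>J. liminf (\<lambda>i. energy M (G j) (w i)))"
  proof (intro sum_mono total_variation_le_liminf)
    fix j i assume j: "j \<in> J"
    show "w i \<in> Lip_loc (G j)" using w(1) G(2)[OF j] Lip_loc_subset by blast
    show "converges_L1_loc M (G j) w f" by (rule converges_L1_loc_le[OF w(2) G(2)[OF j]]) simp
  qed
  also have "\<dots> \<le> liminf (\<lambda>i. \<Sum>j\<in>J. energy M (G j) (w i))"
    using assms by (intro sum_liminf_le)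
  also have "\<dots> \<le> liminf (\<lambda>i. energy M U (w i))"
  proof (intro Liminf_mono always_eventually allI)
    fix i
    have "(\<Sum>j\<in>J. energy M (G j) (w i)) = (\<integral>\<^sup>+y. (\<Sum>j\<in>J. lip_slope (w i) y * indicator (G j) y) \<partial>M)"
      using w(1) G Lip_loc_subset by (intro nn_integral_sum[symmetric] lip_slope_measurable) blast+
    also have "\<dots> \<le> energy M U (w i)"
    proof (rule nn_integral_mono)
      fix y
      have "(\<Sum>j\<in>J. lip_slope (w i) y * indicator (G j) y) = lip_slope (w i) y * indicator (\<Union>j\<in>J. G j) y"
        using assms(1,2) by (simp add: indicator_UN_disjoint sum_distrib_left)
      also have "\<dots> \<le> lip_slope (w i) y * indicator U y"
        using G by (intro mult_left_mono) (auto simp: indicator_def)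
      finally show "(\<Sum>j\<in>J. lip_slope (w i) y * indicator (G j) y) \<le> lip_slope (w i) y * indicator U y" .
    qed
    finally show "(\<Sum>j\<in>J. energy M (G j) (w i)) \<le> energy M U (w i)" .
  qed
  finally show "(\<Sum>j\<in>J. total_variation M f (G j)) \<le> liminf (\<lambda>i. energy M U (w i))" .
qed

lemma nn_integral_abs_diff_triangle:
  fixes f g h :: "'a \<Rightarrow> real"
  assumes "K \<in> sets M" "K \<subseteq> U"
    and "(\<lambda>y. f y * indicator U y) \<in> borel_measurable M" "(\<lambda>y. g y * indicator U y) \<in> borel_measurable M"
      "(\<lambda>y. h y * indicator U y) \<in> borel_measurable M"
  shows "L1_dist M K f h \<le> L1_dist M K f g + L1_dist M K g h"
proof -
  have [measurable]: "(\<lambda>y. ennreal \<bar>a y - b y\<bar> * indicator K y) \<in> borel_measurable M"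
    if ab[measurable]: "(\<lambda>y. a y * indicator U y) \<in> borel_measurable M" "(\<lambda>y. b y * indicator U y) \<in> borel_measurable M"
    for a b :: "'a \<Rightarrow> real"
  proof -
    have [measurable]: "K \<in> sets M" by fact
    have "(\<lambda>y. ennreal \<bar>a y * indicator U y - b y * indicator U y\<bar> * indicator K y) \<in> borel_measurable M"
      by measurable
    moreover have "ennreal \<bar>a y * indicator U y - b y * indicator U y\<bar> * indicator K y = ennreal \<bar>a y - b y\<bar> * indicator K y" for y
      using assms(2) by (auto simp: indicator_def)
    ultimately show ?thesis by simp
  qed
  have "L1_dist M K f h \<le> (\<integral>\<^sup>+y. (ennreal \<bar>f y - g y\<bar> * indicator K y + ennreal \<bar>g y - h y\<bar> * indicator K y) \<partial>M)"
    by (intro nn_integral_mono) (auto simp: indicator_def simp flip: ennreal_plus intro!: ennreal_leI)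
  also have "\<dots> = L1_dist M K f g + L1_dist M K g h"
    using assms by (intro nn_integral_add) auto
  finally show ?thesis .
qed

text \<open>Diagonal argument: for each \<open>k\<close> a competitor of \<open>f k\<close> is
  chosen that is \<open>1 / real (Suc k)\<close>-close to it on the \<open>k\<close>-th exhausting
  compact set. Every compact subset of \<open>U\<close> eventually lies in these sets.\<close>

lemma total_variation_lsc:
  assumes U: "open U" and le: "\<And>k. total_variation M (f k) U \<le> B"
    and conv: "converges_L1_loc M U f g"
    and fm: "\<And>k. (\<lambda>y. f k y * indicator U y) \<in> borel_measurable M"
    and gm: "(\<lambda>y. g y * indicator U y) \<in> borel_measurable M"
  shows "total_variation M g U \<le> B"
proof (rule dense_ge)
  fix b assume b: "B < b"
  have "\<exists>w. w \<in> Lip_loc U \<and> energy M U w \<le> b \<and>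
      L1_dist M (exhaust U k) w (f k) \<le> ennreal (1 / real (Suc k))" for k
  proof -
    have "total_variation M (f k) U < b" using le[of k] b by simp
    then obtain w where w: "\<And>i. w i \<in> Lip_loc U" "converges_L1_loc M U w (f k)"
      "\<And>i. energy M U (w i) < b" using total_variation_approx by blast
    have "(\<lambda>i. L1_dist M (exhaust U k) (w i) (f k)) \<longlonglongrightarrow> 0"
      by (rule converges_L1_locD[OF w(2) compact_exhaust exhaust_subset])
    then have "eventually (\<lambda>i. L1_dist M (exhaust U k) (w i) (f k) < ennreal (1 / real (Suc k))) sequentially"
      by (rule order_tendstoD(2)) simp
    then obtain i where "L1_dist M (exhaust U k) (w i) (f k) < ennreal (1 / real (Suc k))"
      unfolding eventually_sequentially by blast
    then show ?thesis using w(1)[of i] w(3)[of i] by (intro exI[of _ "w i"] conjI less_imp_le)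
  qed
  then obtain w where w: "\<And>k. w k \<in> Lip_loc U" "\<And>k. energy M U (w k) \<le> b"
      "\<And>k. L1_dist M (exhaust U k) (w k) (f k) \<le> ennreal (1 / real (Suc k))" by metis
  show "total_variation M g U \<le> b"
  proof (rule total_variation_le[OF w(1) _ w(2)])
    show "converges_L1_loc M U w g"
      unfolding converges_L1_loc_def
    proof safe
      fix K assume K: "compact K" "K \<subseteq> U"
      obtain N where N: "\<And>n. n \<ge> N \<Longrightarrow> K \<subseteq> exhaust U n" using compact_subset_exhaust[OF U K] by blast
      have "eventually (\<lambda>k. L1_dist M K (w k) g
          \<le> ennreal (1 / real (Suc k)) + L1_dist M K (f k) g) sequentially"
        using eventually_ge_at_top[of N]
      proof eventually_elim
        case (elim k)
        have "L1_dist M K (w k) g \<le> L1_dist M K (w k) (f k) + L1_dist M K (f k) g"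
          using K by (intro nn_integral_abs_diff_triangle[of K U] fm gm Lip_loc_measurable U w(1) closed_sets compact_imp_closed)
        also have "L1_dist M K (w k) (f k) \<le> L1_dist M (exhaust U k) (w k) (f k)"
          using N[OF elim] by (intro nn_integral_mono mult_left_mono) (auto simp: indicator_def)
        also have "\<dots> \<le> ennreal (1 / real (Suc k))" by (rule w)
        finally show ?case by (simp add: add_right_mono)
      qed
      moreover have "(\<lambda>k. ennreal (1 / real (Suc k)) + L1_dist M K (f k) g) \<longlonglongrightarrow> 0"
        using tendsto_add[OF tendsto_ennrealI[OF LIMSEQ_Suc[OF lim_1_over_n]] converges_L1_locD[OF conv K]] by simp
      ultimately show "(\<lambda>k. L1_dist M K (w k) g) \<longlonglongrightarrow> 0"
        by (rule ennreal_tendsto_0_le)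
    qed
  qed
qed

end

section \<open>Isoperimetric and boxing inequalities\<close>

text \<open>The hypothesis bounds finite subsums because disjointness and superadditivity of the
  variation are exploited for finite families.\<close>

lemma emeasure_countable_UN_le:
  assumes "countable S" and A: "\<And>x. x \<in> S \<Longrightarrow> A x \<in> sets N"
    and le: "\<And>T. finite T \<Longrightarrow> T \<subseteq> S \<Longrightarrow> (\<Sum>x\<in>T. emeasure N (A x)) \<le> b"
  shows "emeasure N (\<Union>x\<in>S. A x) \<le> b"
proof (cases "S = {}")
  case False
  define f where "f = from_nat_into S"
  have f: "range f = S" unfolding f_def using False assms(1) by (rule range_from_nat_into)
  have fS: "f i \<in> S" for i using f by auto
  have "(\<Union>x\<in>S. A x) = (\<Union>n. \<Union>x\<in>f ` {..n}. A x)" using f by auto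
  also have "emeasure N \<dots> = (SUP n. emeasure N (\<Union>x\<in>f ` {..n}. A x))"
  proof (rule SUP_emeasure_incseq[symmetric])
    show "range (\<lambda>n. \<Union>x\<in>f ` {..n}. A x) \<subseteq> sets N"
      using fS A by (auto intro!: sets.finite_UN)
    show "incseq (\<lambda>n. \<Union>x\<in>f ` {..n}. A x)" by (intro monoI UN_mono image_mono) auto
  qed
  also have "\<dots> \<le> b"
  proof (rule SUP_least)
    fix n
    have "emeasure N (\<Union>x\<in>f ` {..n}. A x) \<le> (\<Sum>x\<in>f ` {..n}. emeasure N (A x))"
      using fS A by (intro emeasure_subadditive_finite) auto
    also have "\<dots> \<le> b" using fS by (intro le) auto
    finally show "emeasure N (\<Union>x\<in>f ` {..n}. A x) \<le> b" .
  qed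
  finally show ?thesis .
qed simp

text \<open>Product rule in which the slope of the cut-off is weighted by \<open>w\<close> at the
  base point. When \<open>w\<close> approximates an indicator, the weight makes cutting cost the
  mass of the set in the transition region, not the measure of that region.\<close>

lemma mult_cutoff_diff_le:
  fixes h w :: "'a::metric_space \<Rightarrow> real"
  assumes h: "0 \<le> h z" "h z \<le> 1" and w: "0 \<le> w y" and "\<bar>h z - h y\<bar> \<le> l * dist y z"
  shows "\<bar>h z * w z - h y * w y\<bar> \<le> \<bar>w z - w y\<bar> + l * w y * dist y z"
proof -
  have "h z * w z - h y * w y = h z * (w z - w y) + w y * (h z - h y)" by (simp add: algebra_simps)
  also have "\<bar>\<dots>\<bar> \<le> \<bar>h z * (w z - w y)\<bar> + \<bar>w y * (h z - h y)\<bar>" by (rule abs_triangle_ineq)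
  also have "\<bar>h z * (w z - w y)\<bar> \<le> \<bar>w z - w y\<bar>"
    using h mult_right_mono[of "h z" 1 "\<bar>w z - w y\<bar>"] by (simp add: abs_mult)
  also have "\<bar>w y * (h z - h y)\<bar> \<le> w y * (l * dist y z)"
    using w assms(4) by (simp add: abs_mult mult_left_mono)
  finally show ?thesis by (simp add: mult_ac)
qed

context doubling_poincare
begin

abbreviation perimeter :: "'a set \<Rightarrow> 'a set \<Rightarrow> ennreal" where
  "perimeter E \<equiv> total_variation M (indicator E)"

text \<open>Makes a set of finite perimeter in \<Omega> accessible to the Poincare inequality. The
  competitors \<open>h y * w i y\<close> extend by zero off \<open>K\<close>, and since
  \<open>w i\<close> has values in [0, 1] the product rule adds at most \<open>l\<close> times the
  measure of \<open>K\<close>.\<close>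

lemma cutoff_BV:
  assumes E: "E \<in> sets M" and \<Omega>: "open \<Omega>" and fin: "perimeter E \<Omega> < \<infinity>"
    and h: "\<And>y. 0 \<le> h y \<and> h y \<le> 1" "\<And>y z. \<bar>h z - h y\<bar> \<le> l * dist y z" "0 \<le> l"
    and K: "compact K" "K \<subseteq> \<Omega>" "\<And>y. y \<notin> K \<Longrightarrow> h y = 0"
  shows "(\<lambda>y. h y * indicator E y) \<in> BV M UNIV"
proof -
  have "continuous_on UNIV h"
  proof (rule lipschitz_on_continuous_on)
    show "l-lipschitz_on UNIV h" using h by (intro lipschitz_onI) (auto simp: dist_real_def dist_commute)
  qed
  then have hm[measurable]: "h \<in> borel_measurable M"
    by (intro borel_measurable_M borel_measurable_continuous_onI)
  have [measurable]: "E \<in> sets M" by fact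
  have "(\<lambda>y. h y * indicator E y) \<in> L1_loc M UNIV"
    unfolding L1_loc_def set_integrable_def
  proof safe
    fix K' :: "'a set" assume K': "compact K'"
    have [measurable]: "K' \<in> sets M" using K' by (intro closed_sets compact_imp_closed)
    show "integrable M (\<lambda>x. indicator K' x *\<^sub>R (h x * indicator E x))"
    proof (rule integrableI_bounded_set)
      show "emeasure M K' < \<infinity>" using K' by (intro bounded_emeasure_finite compact_imp_bounded)
      show "AE x\<in>K' in M. norm (indicator K' x *\<^sub>R (h x * indicator E x)) \<le> 1"
        using h(1) by (auto simp: indicator_def)
    qed (auto simp: indicator_def)
  qed
  moreover have "total_variation M (\<lambda>y. h y * indicator E y) UNIV < \<infinity>"
  proof -
    obtain b where b: "perimeter E \<Omega> < b" "b < \<infinity>"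
      using dense[OF fin] by blast
    obtain w where w: "\<And>i. w i \<in> Lip_loc \<Omega>" "converges_L1_loc M \<Omega> w (indicator E)"
      "\<And>i. energy M \<Omega> (w i) < b" "\<And>i x. 0 \<le> w i x \<and> w i x \<le> 1"
      using total_variation_approx_01[OF b(1)] by (auto simp: indicator_def)
    have diff: "\<bar>h z * w i z - h y * w i y\<bar> \<le> \<bar>w i z - w i y\<bar> + l * dist y z" for i y z
    proof -
      have "\<bar>h z * w i z - h y * w i y\<bar> \<le> \<bar>w i z - w i y\<bar> + l * w i y * dist y z"
        using h(1) w(4) by (intro mult_cutoff_diff_le h(2)) auto
      also have "l * w i y * dist y z \<le> l * 1 * dist y z"
        using w(4)[of i y] h(3) by (intro mult_right_mono mult_left_mono) auto
      finally show ?thesis by simp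
    qed
    have Km: "K \<in> sets M" using K by (intro closed_sets compact_imp_closed)
    have "total_variation M (\<lambda>y. h y * indicator E y) UNIV \<le> b + ennreal l * emeasure M K"
    proof (rule total_variation_le[of "\<lambda>i y. h y * w i y"])
      fix i
      have "(\<lambda>y. h y * w i y) \<in> Lip_loc \<Omega>"
        by (rule Lip_loc_affine_le[OF w(1)[of i] zero_le_one h(3)]) (use diff in simp)
      moreover have "(\<lambda>y. h y * w i y) \<in> Lip_loc (- K)"
        using Lip_loc_cong[of "-K" "\<lambda>y. h y * w i y" "\<lambda>_. 0"] K(3) Lip_loc_const by auto
      ultimately have "(\<lambda>y. h y * w i y) \<in> Lip_loc (\<Omega> \<union> - K)"
        using \<Omega> K by (intro Lip_loc_Un open_Compl compact_imp_closed)
      then show "(\<lambda>y. h y * w i y) \<in> Lip_loc UNIV" using K by (auto intro: Lip_loc_subset)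
      have "lip_slope (\<lambda>y. h y * w i y) y \<le> lip_slope (w i) y * indicator \<Omega> y + ennreal l * indicator K y" for y
      proof (cases "y \<in> K")
        case True
        have "lip_slope (\<lambda>y. h y * w i y) y \<le> ennreal 1 * lip_slope (w i) y + ennreal l"
          by (rule lip_slope_affine_le[of 1]) (use diff h in auto)
        then show ?thesis using True K by auto
      next
        case False
        then obtain e where e: "e > 0" "ball y e \<subseteq> - K"
          using K open_contains_ball[of "-K"] by (metis ComplI compact_imp_closed open_Compl)
        have "lip_slope (\<lambda>y. h y * w i y) y = 0"
        proof (rule lip_slope_locally_const[OF e(1)])
          fix z assume "z \<in> ball y e"
          then have "z \<notin> K" using e by auto
          then show "h z * w i z = h y * w i y" using K(3)[of z] K(3)[of y] False by simp
        qed
        then show ?thesis by simp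
      qed
      then have "energy M UNIV (\<lambda>y. h y * w i y) \<le> (\<integral>\<^sup>+y. (lip_slope (w i) y * indicator \<Omega> y + ennreal l * indicator K y) \<partial>M)"
        by (intro nn_integral_mono) simp
      also have "\<dots> = energy M \<Omega> (w i) + ennreal l * emeasure M K"
        using lip_slope_measurable[OF \<Omega> w(1)] Km
        by (subst nn_integral_add) (auto simp: nn_integral_cmult_indicator)
      also have "\<dots> \<le> b + ennreal l * emeasure M K" using w(3)[of i] by (intro add_right_mono less_imp_le)
      finally show "energy M UNIV (\<lambda>y. h y * w i y) \<le> b + ennreal l * emeasure M K" .
    next
      show "converges_L1_loc M UNIV (\<lambda>i y. h y * w i y) (\<lambda>y. h y * indicator E y)"
        by (rule converges_L1_loc_cutoff[OF w(2) h(1) compact_imp_closed[OF K(1)] K(3)]) (use K(2) in auto)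
    qed
    also have "\<dots> < \<infinity>"
      using b(2) bounded_emeasure_finite[OF compact_imp_bounded[OF K(1)]]
      by (auto simp: ennreal_mult_less_top)
    finally show ?thesis .
  qed
  ultimately show ?thesis by (simp add: BV_def)
qed

text \<open>Poincare inequality for \<open>E\<close> cut off outside the dilated ball. If
  \<open>a\<close> is the mean of the indicator over the ball, its mean deviation is
  \<open>2 * a * (1 - a)\<close>, and this is at least \<open>\<theta>\<close>.\<close>

lemma relative_isoperimetric:
  assumes E: "E \<in> sets M" and \<Omega>: "open \<Omega>" and fin: "perimeter E \<Omega> < \<infinity>"
    and r: "0 < r" and sub: "cball x (2 * L * r) \<subseteq> \<Omega>" and \<theta>: "0 \<le> \<theta>"
    and lo: "\<theta> * measure M (ball x r) \<le> measure M (E \<inter> ball x r)"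
    and hi: "measure M (E \<inter> ball x r) \<le> (1 - \<theta>) * measure M (ball x r)"
  shows "ennreal (\<theta> * measure M (ball x r)) \<le> ennreal (P * r) * perimeter E (ball x (L * r))"
proof -
  have [measurable]: "E \<in> sets M" by fact
  \<comment> \<open>Equal to 1 on \<open>ball x (L * r)\<close>, so the cut-off is invisible to both
    sides of the Poincare inequality, and 0 outside \<open>cball x (2 * L * r)\<close>.\<close>
  define h where "h = (\<lambda>y. max 0 (min 1 (2 - dist x y / (L * r))))"
  have Lr: "0 < L * r" using L_ge_1 r by simp
  have hlip: "\<bar>h z - h y\<bar> \<le> 1 / (L * r) * dist y z" for y z
  proof -
    have "\<bar>dist x z - dist x y\<bar> \<le> dist y z" using abs_dist_diff_le[of z x y] by (simp add: dist_commute)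
    then have "\<bar>dist x z / (L * r) - dist x y / (L * r)\<bar> \<le> dist y z / (L * r)"
      using Lr by (simp add: divide_right_mono flip: diff_divide_distrib)
    then show ?thesis unfolding h_def by auto
  qed
  have h0: "h y = 0" if "y \<notin> cball x (2 * L * r)" for y
  proof -
    have "2 \<le> dist x y / (L * r)" using that Lr by (simp add: pos_le_divide_eq)
    then show ?thesis by (simp add: h_def)
  qed
  have h1: "h y = 1" if "y \<in> ball x (L * r)" for y
  proof -
    have "dist x y / (L * r) \<le> 1" using that Lr by (simp add: pos_divide_le_eq)
    then show ?thesis by (simp add: h_def)
  qed
  define v where "v = (\<lambda>y. h y * indicator E y :: real)"
  have v: "v \<in> BV M UNIV" unfolding v_def
    by (rule cutoff_BV[OF E \<Omega> fin _ hlip _ compact_cball sub h0]) (use Lr in \<open>auto simp: h_def\<close>)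
  let ?B = "ball x r"
  have "ball x r \<subseteq> ball x (L * r)" using L_ge_1 r by (intro subset_ball) simp
  then have vB: "v y = indicator E y" if "y \<in> ?B" for y using h1 that by (auto simp: v_def)
  define m where "m = measure M ?B"
  define g where "g = measure M (E \<inter> ?B)"
  have m: "0 < m" unfolding m_def by (rule measure_ball_pos[OF r])
  define a where "a = g / m"
  have a: "\<theta> \<le> a" "a \<le> 1 - \<theta>" using lo hi m by (auto simp: a_def g_def m_def field_simps)
  have EB: "E \<inter> ?B \<in> fmeasurable M" "?B - E \<in> fmeasurable M"
    using E by (auto simp: Int_ball_fmeasurable intro: fmeasurable_Diff)
  have "(LINT y:?B|M. v y) = (LINT y|M. indicator (E \<inter> ?B) y)"
    unfolding set_lebesgue_integral_def using vB by (intro Bochner_Integration.integral_cong) (auto simp: indicator_def)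
  then have mean: "mean_value M ?B v = a" by (simp add: mean_value_def a_def g_def m_def)
  have diff: "measure M (?B - E) = m - g"
  proof -
    have "measure M ((E \<inter> ?B) \<union> (?B - E)) = measure M (E \<inter> ?B) + measure M (?B - E)"
      using EB by (intro measure_Union) (auto simp: fmeasurableD2)
    moreover have "(E \<inter> ?B) \<union> (?B - E) = ?B" by auto
    ultimately show ?thesis by (simp add: m_def g_def)
  qed
  \<comment> \<open>Since \<open>a\<close> lies between \<open>\<theta>\<close> and
    \<open>1 - \<theta>\<close>, \<open>a * (1 - a)\<close> is at least
    \<open>\<theta> * (1 - \<theta>)\<close>, and \<open>\<theta> \<le> 1/2\<close> makes
    \<open>2 * (1 - \<theta>)\<close> at least 1.\<close>
  have "\<theta> \<le> 2 * a * (1 - a)"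
  proof -
    have "0 \<le> (a - \<theta>) * (1 - \<theta> - a)" using a by simp
    then have "\<theta> * (1 - \<theta>) \<le> a * (1 - a)" by (simp add: algebra_simps)
    moreover have "\<theta> * 1 \<le> \<theta> * (2 * (1 - \<theta>))" using a \<theta> by (intro mult_left_mono) auto
    ultimately show ?thesis by (simp add: algebra_simps)
  qed
  then have "\<theta> * m \<le> 2 * a * (1 - a) * m" using m by (simp add: mult_right_mono)
  also have "2 * a * (1 - a) * m = (1 - a) * g + a * (m - g)" using m by (simp add: a_def field_simps)
  finally have "ennreal (\<theta> * m) \<le> ennreal ((1 - a) * g + a * (m - g))" by (rule ennreal_leI)
  also have "\<dots> = ennreal (1 - a) * emeasure M (E \<inter> ?B) + ennreal a * emeasure M (?B - E)"
    using EB a \<theta> measure_nonneg[of M "?B - E"] unfolding diff[symmetric]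
    by (simp add: emeasure_eq_measure2 g_def ennreal_mult ennreal_plus)
  also have "\<dots> = (\<integral>\<^sup>+y. (ennreal (1 - a) * indicator (E \<inter> ?B) y + ennreal a * indicator (?B - E) y) \<partial>M)"
    using EB by (subst nn_integral_add) (auto simp: nn_integral_cmult_indicator)
  also have "\<dots> = (\<integral>\<^sup>+y\<in>?B. ennreal \<bar>v y - mean_value M ?B v\<bar> \<partial>M)"
    unfolding mean using vB a \<theta> by (intro nn_integral_cong) (auto simp: indicator_def)
  also have "\<dots> \<le> ennreal (P * r) * total_variation M v (ball x (L * r))"
    by (rule poincare[OF r v])
  also have "total_variation M v (ball x (L * r)) = perimeter E (ball x (L * r))"
    by (rule total_variation_cong) (simp add: v_def h1)
  finally show ?thesis by (simp add: m_def)
qed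

text \<open>Take the first dyadic radius \<open>R / 2 ^ i\<close> at which the density reaches
  \<open>\<sigma>\<close>. One step earlier it was below \<open>\<sigma>\<close>, and halving the
  radius raises a density by at most the factor \<open>C\<close>, so it is at most
  \<open>C * \<sigma> \<le> \<beta>\<close>. For \<open>i = 0\<close> the upper bound is
  \<open>top\<close>.\<close>

lemma density_crossing:
  assumes E: "E \<in> sets M" and R: "0 < R" and \<sigma>: "0 \<le> \<sigma>" "C * \<sigma> \<le> \<beta>"
    and top: "measure M (E \<inter> ball x R) \<le> \<beta> * measure M (ball x R)"
    and \<rho>: "0 < \<rho>" "\<rho> \<le> R" "C * \<sigma> * measure M (ball x \<rho>) \<le> measure M (E \<inter> ball x \<rho>)"
  obtains r where "0 < r" "r \<le> R" "\<sigma> * measure M (ball x r) \<le> measure M (E \<inter> ball x r)"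
    "measure M (E \<inter> ball x r) \<le> \<beta> * measure M (ball x r)"
proof -
  define m where "m = (\<lambda>j::nat. measure M (ball x (R / 2 ^ j)))"
  define g where "g = (\<lambda>j::nat. measure M (E \<inter> ball x (R / 2 ^ j)))"
  have mono: "measure M (E \<inter> ball x s) \<le> measure M (E \<inter> ball x t)" if "s \<le> t" for s t
    using E that by (intro measure_mono_fmeasurable Int_ball_fmeasurable) auto
  have "\<exists>j. \<sigma> * m j \<le> g j"
  proof -
    obtain j0 where j0: "R / \<rho> < 2 ^ j0" using real_arch_pow[of 2] by auto
    \<comment> \<open>The dyadic radius just above \<open>\<rho>\<close>: enlarging the ball from
      \<open>\<rho>\<close> to it costs at most the factor \<open>C\<close>, which the density
      \<open>C * \<sigma>\<close> at \<open>\<rho>\<close> can afford.\<close>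
    define j where "j = (LEAST j. R / 2 ^ Suc j < \<rho>)"
    have ex: "R / 2 ^ Suc j0 < \<rho>" using j0 \<rho> R by (simp add: field_simps)
    have j1: "R / 2 ^ Suc j < \<rho>" unfolding j_def using ex by (rule LeastI)
    have j2: "\<rho> \<le> R / 2 ^ j"
    proof (cases j)
      case (Suc i)
      then have "\<not> R / 2 ^ Suc i < \<rho>" unfolding j_def using not_less_Least by (metis lessI)
      then show ?thesis using Suc by simp
    qed (use \<rho> in simp)
    have "m j \<le> measure M (ball x (2 * \<rho>))" unfolding m_def
      using j1 by (intro measure_ball_mono subset_ball) (simp add: field_simps)
    also have "\<dots> \<le> C * measure M (ball x \<rho>)" by (rule measure_doubling[OF \<rho>(1)])
    finally have "\<sigma> * m j \<le> \<sigma> * (C * measure M (ball x \<rho>))" using \<sigma> by (intro mult_left_mono)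
    also have "\<dots> \<le> g j" using \<rho>(3) mono[OF j2] by (simp add: g_def mult_ac)
    finally show ?thesis by blast
  qed
  define i where "i = (LEAST j. \<sigma> * m j \<le> g j)"
  have i1: "\<sigma> * m i \<le> g i" unfolding i_def using \<open>\<exists>j. \<sigma> * m j \<le> g j\<close> by (rule LeastI_ex)
  have i2: "g i \<le> \<beta> * m i"
  proof (cases i)
    case 0
    then show ?thesis using top by (simp add: g_def m_def)
  next
    case (Suc j)
    then have "\<not> \<sigma> * m j \<le> g j" unfolding i_def using not_less_Least by (metis lessI)
    then have "g j \<le> \<sigma> * m j" by simp
    have "g i \<le> g j" unfolding g_def using R Suc by (intro mono) (simp add: field_simps)
    also have "\<dots> \<le> \<sigma> * m j" by fact
    also have "m j \<le> C * m i"
      using measure_doubling[of "R / 2 ^ i" x] R Suc by (simp add: m_def)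
    also have "\<sigma> * (C * m i) = C * \<sigma> * m i" by simp
    also have "\<dots> \<le> \<beta> * m i" using \<sigma>(2) by (intro mult_right_mono) (auto simp: m_def)
    finally show ?thesis using \<sigma> by (simp add: mult_left_mono)
  qed
  show thesis
    by (rule that[of "R / 2 ^ i"]) (use R i1 i2 in \<open>auto simp: g_def m_def field_simps\<close>)
qed


text \<open>
  A substitute for Lebesgue's density theorem: the continuous functions that approximate the
  indicator of \<open>E\<close> take the place of outer regularity.
\<close>

lemma null_low_density:
  assumes E: "E \<in> sets M" and \<Omega>: "open \<Omega>" and fin: "perimeter E \<Omega> < \<infinity>"
    and K: "compact K" "K \<subseteq> \<Omega>" and \<rho>: "0 < \<rho>" and Q: "\<And>y. y \<in> Q \<Longrightarrow> ball y \<rho> \<subseteq> K"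
  obtains Z where "Z \<in> null_sets M"
    "\<And>y. y \<in> E \<inter> Q - Z \<Longrightarrow> \<exists>r. 0 < r \<and> r < \<rho> \<and> measure M (ball y r) / 2 < measure M (E \<inter> ball y r)"
proof -
  have [measurable]: "E \<in> sets M" by fact
  have [measurable]: "K \<in> sets M" using K by (intro closed_sets compact_imp_closed)
  define Y where "Y = {y \<in> E \<inter> Q. \<forall>r. 0 < r \<and> r < \<rho> \<longrightarrow> measure M (E \<inter> ball y r) \<le> measure M (ball y r) / 2}"
  obtain b where b: "perimeter E \<Omega> < b" "b < \<infinity>"
    using dense[OF fin] by blast
  obtain w where w: "\<And>i. w i \<in> Lip_loc \<Omega>" "converges_L1_loc M \<Omega> w (indicator E)"
      "\<And>i. energy M \<Omega> (w i) < b"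
    using total_variation_approx[OF b(1)] by blast
  define a where "a = (\<lambda>i. L1_dist M K (w i) (indicator E))"
  have a: "a \<longlonglongrightarrow> 0" unfolding a_def by (rule converges_L1_locD[OF w(2) K])
  \<comment> \<open>Measurability of \<open>Y\<close> is not at hand, so measurable covers of
    vanishing measure are constructed, one for each approximating function.\<close>
  have "\<exists>Z\<in>sets M. Y \<subseteq> Z \<and> emeasure M Z \<le> ennreal (4 + 8 * C ^ 3) * a i" for i
  proof -
    have wc: "continuous_on \<Omega> (w i)" by (rule Lip_loc_imp_continuous_on[OF \<Omega> w(1)])
    have wm[measurable]: "(\<lambda>y. w i y * indicator \<Omega> y) \<in> borel_measurable M"
      by (rule continuous_measurable[OF \<Omega> wc])
    define f where "f = (\<lambda>y. ennreal \<bar>w i y * indicator \<Omega> y - indicator E y\<bar>)"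
    have fm[measurable]: "f \<in> borel_measurable M" unfolding f_def by measurable
    have af: "a i = (\<integral>\<^sup>+y\<in>K. f y \<partial>M)"
      unfolding a_def f_def using K by (intro nn_integral_cong) (auto simp: indicator_def)
    \<comment> \<open>Outside \<open>Z1\<close> the approximation errs by less than 1/4, so at a
      point of \<open>E\<close> it exceeds 3/4 and, by continuity, stays above 1/4 on a ball. The
      part of that ball outside \<open>E\<close>, at least half of it, then contributes an error
      above 1/4. Markov's inequality bounds \<open>Z1\<close> itself.\<close>
    define Z1 where "Z1 = {y\<in>K. 1 \<le> ennreal 4 * f y}"
    have Z1[measurable]: "Z1 \<in> sets M"
    proof -
      have "Z1 = {y\<in>space M. 1 \<le> ennreal 4 * f y} \<inter> K" by (auto simp: Z1_def)
      then show ?thesis by simp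
    qed
    have eZ1: "emeasure M Z1 \<le> ennreal 4 * a i"
      unfolding Z1_def af by (rule nn_integral_Markov_inequality) auto
    define Y' where "Y' = Y - Z1"
    have "\<exists>r. 0 < r \<and> r < \<rho> \<and> ball y r \<subseteq> K \<and> (\<forall>z\<in>ball y r. 1/4 < w i z)" if y: "y \<in> Y'" for y
    proof -
      have yQ: "y \<in> E" "ball y \<rho> \<subseteq> K" using y Q by (auto simp: Y'_def Y_def)
      then have yK: "y \<in> K" using \<rho> by auto
      then have "\<not> 1 \<le> ennreal 4 * f y" using y by (auto simp: Y'_def Z1_def)
      then have "ennreal (4 * \<bar>w i y - 1\<bar>) < ennreal 1"
        using yK K yQ by (auto simp: f_def ennreal_mult not_le)
      then have "4 * \<bar>w i y - 1\<bar> < 1" by (simp add: ennreal_less_iff)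
      then have "1/4 < w i y" by (auto simp: abs_if split: if_splits)
      moreover have "open (w i -` {1/4<..} \<inter> \<Omega>)"
        using continuous_on_open_vimage[OF \<Omega>] wc open_greaterThan by metis
      ultimately obtain e where e: "e > 0" "ball y e \<subseteq> w i -` {1/4<..} \<inter> \<Omega>"
        using yK K by (metis IntI greaterThan_iff open_contains_ball subsetD vimageI)
      have "ball y (min e (\<rho> / 2)) \<subseteq> ball y e" "ball y (min e (\<rho> / 2)) \<subseteq> ball y \<rho>"
        using \<rho> by (auto intro!: subset_ball)
      then show ?thesis using e yQ \<rho> by (intro exI[of _ "min e (\<rho>/2)"]) auto
    qed
    then obtain r where r: "\<And>y. y \<in> Y' \<Longrightarrow> 0 < r y" "\<And>y. y \<in> Y' \<Longrightarrow> r y < \<rho>"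
      "\<And>y. y \<in> Y' \<Longrightarrow> ball y (r y) \<subseteq> K" "\<And>y z. y \<in> Y' \<Longrightarrow> z \<in> ball y (r y) \<Longrightarrow> 1/4 < w i z" by metis
    have "Y' \<subseteq> K"
    proof
      fix y assume "y \<in> Y'"
      then show "y \<in> K" using r(1,3)[of y] by auto
    qed
    then have "bounded Y'" using K compact_imp_bounded bounded_subset by blast
    then obtain S where S: "countable S" "S \<subseteq> Y'" "disjoint_family_on (\<lambda>x. ball x (r x)) S"
      "Y' \<subseteq> (\<Union>x\<in>S. ball x (5 * r x))"
      using vitali_covering[of Y' r \<rho>] r(1,2) less_imp_le by metis
    define Z2 where "Z2 = (\<Union>x\<in>S. ball x (5 * r x))"
    \<comment> \<open>The factor \<open>C ^ 3\<close> comes from 5 \<le> 2^3, and 8 = 2 * 4 from the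
      half ball outside \<open>E\<close> and the error 1/4 on it.\<close>
    have one: "emeasure M (ball x (5 * r x)) \<le> ennreal (8 * C ^ 3) * (\<integral>\<^sup>+y\<in>ball x (r x). f y \<partial>M)" if x: "x \<in> S" for x
    proof -
      have xY: "x \<in> Y'" using x S by auto
      have rx: "0 < r x" "r x < \<rho>" using r xY by auto
      let ?B = "ball x (r x)"
      have EB: "E \<inter> ?B \<in> fmeasurable M" "?B - E \<in> fmeasurable M"
        using E by (auto simp: Int_ball_fmeasurable intro: fmeasurable_Diff)
      have "measure M (E \<inter> ?B) \<le> measure M ?B / 2" using xY rx by (auto simp: Y'_def Y_def)
      moreover have "measure M ((E \<inter> ?B) \<union> (?B - E)) = measure M (E \<inter> ?B) + measure M (?B - E)"
        using EB by (intro measure_Union) (auto simp: fmeasurableD2)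
      moreover have "(E \<inter> ?B) \<union> (?B - E) = ?B" by auto
      ultimately have half: "measure M ?B \<le> 2 * measure M (?B - E)" by simp
      have "measure M (ball x (5 * r x)) \<le> C ^ 3 * measure M ?B"
        using rx by (intro measure_doubling_le) auto
      also have "\<dots> \<le> C ^ 3 * (2 * measure M (?B - E))" using half C_ge_1 by (intro mult_left_mono) auto
      finally have "emeasure M (ball x (5 * r x)) \<le> ennreal (8 * C ^ 3 * (1/4 * measure M (?B - E)))"
        unfolding emeasure_ball by (intro ennreal_leI) simp
      also have "\<dots> = ennreal (8 * C ^ 3) * (ennreal (1/4) * emeasure M (?B - E))"
        using EB C_ge_1 by (simp add: emeasure_eq_measure2 flip: ennreal_mult)
      also have "ennreal (1/4) * emeasure M (?B - E) = (\<integral>\<^sup>+y. ennreal (1/4) * indicator (?B - E) y \<partial>M)"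
        using EB by (simp add: nn_integral_cmult_indicator)
      also have "\<dots> \<le> (\<integral>\<^sup>+y\<in>?B. f y \<partial>M)"
      proof (rule nn_integral_mono)
        fix y
        show "ennreal (1/4) * indicator (?B - E) y \<le> f y * indicator ?B y"
        proof (cases "y \<in> ?B - E")
          case True
          then have "1/4 < w i y" "y \<in> \<Omega>" using r(3,4)[OF xY] K by auto
          then show ?thesis using True by (auto simp: f_def intro!: ennreal_leI)
        qed auto
      qed
      finally show ?thesis by (simp add: mult_left_mono)
    qed
    have "emeasure M Z2 \<le> ennreal (8 * C ^ 3) * a i"
      unfolding Z2_def
    proof (rule emeasure_countable_UN_le[OF S(1)])
      fix T assume T: "finite T" "T \<subseteq> S"
      have "(\<Sum>x\<in>T. emeasure M (ball x (5 * r x))) \<le> (\<Sum>x\<in>T. ennreal (8 * C ^ 3) * (\<integral>\<^sup>+y\<in>ball x (r x). f y \<partial>M))"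
        using one T by (intro sum_mono) auto
      also have "\<dots> = ennreal (8 * C ^ 3) * (\<integral>\<^sup>+y. (\<Sum>x\<in>T. f y * indicator (ball x (r x)) y) \<partial>M)"
        by (subst nn_integral_sum) (auto simp: sum_distrib_left)
      also have "(\<integral>\<^sup>+y. (\<Sum>x\<in>T. f y * indicator (ball x (r x)) y) \<partial>M) \<le> (\<integral>\<^sup>+y\<in>K. f y \<partial>M)"
      proof (rule nn_integral_mono)
        fix y
        have "disjoint_family_on (\<lambda>x. ball x (r x)) T" by (rule disjoint_family_on_mono[OF T(2) S(3)])
        then have "(\<Sum>x\<in>T. f y * indicator (ball x (r x)) y) = f y * indicator (\<Union>x\<in>T. ball x (r x)) y"
          using T by (simp add: indicator_UN_disjoint sum_distrib_left)
        also have "\<dots> \<le> f y * indicator K y"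
        proof (rule mult_left_mono)
          have "(\<Union>x\<in>T. ball x (r x)) \<subseteq> K" using T S(2) r(3) by blast
          then show "indicator (\<Union>x\<in>T. ball x (r x)) y \<le> (indicator K y :: ennreal)"
            by (simp add: indicator_def subset_iff)
        qed simp
        finally show "(\<Sum>x\<in>T. f y * indicator (ball x (r x)) y) \<le> f y * indicator K y" .
      qed
      finally show "(\<Sum>x\<in>T. emeasure M (ball x (5 * r x))) \<le> ennreal (8 * C ^ 3) * a i"
        unfolding af by (simp add: mult_left_mono)
    qed auto
    moreover have "Z2 \<in> sets M" unfolding Z2_def by (intro open_sets open_UN) auto
    ultimately have "emeasure M (Z1 \<union> Z2) \<le> ennreal 4 * a i + ennreal (8 * C ^ 3) * a i"
      using eZ1 by (intro order_trans[OF emeasure_subadditive] add_mono) auto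
    also have "\<dots> = ennreal (4 + 8 * C ^ 3) * a i"
      using C_ge_1 by (simp add: ennreal_plus distrib_right)
    finally have "emeasure M (Z1 \<union> Z2) \<le> ennreal (4 + 8 * C ^ 3) * a i" .
    moreover have "Y \<subseteq> Z1 \<union> Z2" using S(4) by (auto simp: Y'_def Z2_def)
    ultimately show ?thesis using Z1 \<open>Z2 \<in> sets M\<close> by (intro bexI[of _ "Z1 \<union> Z2"]) auto
  qed
  then obtain Z where Z: "\<And>i. Z i \<in> sets M" "\<And>i. Y \<subseteq> Z i" "\<And>i. emeasure M (Z i) \<le> ennreal (4 + 8 * C ^ 3) * a i"
    by metis
  have "emeasure M (\<Inter>i. Z i) \<le> 0"
  proof (rule LIMSEQ_le_const)
    have "(\<lambda>i. ennreal (4 + 8 * C ^ 3) * a i) \<longlonglongrightarrow> ennreal (4 + 8 * C ^ 3) * 0"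
      using a by (intro ennreal_tendsto_cmult) auto
    then show "(\<lambda>i. ennreal (4 + 8 * C ^ 3) * a i) \<longlonglongrightarrow> 0" by simp
    have "emeasure M (\<Inter>i. Z i) \<le> emeasure M (Z i)" for i using Z by (intro emeasure_mono) auto
    then show "\<exists>N. \<forall>n\<ge>N. emeasure M (\<Inter>i. Z i) \<le> ennreal (4 + 8 * C ^ 3) * a n"
      using Z(3) order_trans by blast
  qed
  then have "(\<Inter>i. Z i) \<in> null_sets M" using Z by auto
  moreover have "Y \<subseteq> (\<Inter>i. Z i)" using Z by auto
  ultimately show thesis
  proof (intro that[of "\<Inter>i. Z i"])
    fix y assume "y \<in> E \<inter> Q - (\<Inter>i. Z i)" "Y \<subseteq> (\<Inter>i. Z i)"
    then have "y \<in> E \<inter> Q" "y \<notin> Y" by blast+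
    then show "\<exists>r. 0 < r \<and> r < \<rho> \<and> measure M (ball y r) / 2 < measure M (E \<inter> ball y r)"
      unfolding Y_def by force
  qed
qed

section \<open>Boxing inequality at a reduced scale\<close>

text \<open>The first factor is the cost of dilating a ball by \<open>5 * L\<close> in Vitali's
  lemma. The factor \<open>2 * C * P\<close> comes from the isoperimetric inequality at density
  \<open>1 / (2 * C)\<close>, and \<open>2 ^ k\<close> from the radii, which are at most
  \<open>r / 2 ^ k\<close>.\<close>

definition boxing_const :: "nat \<Rightarrow> real" where
  "boxing_const k = C ^ (LEAST n. 5 * L \<le> 2 ^ n) * (2 * C * P) / 2 ^ k"

lemma measure_dilate:
  assumes "0 < r"
  shows "measure M (ball x (5 * (L * r))) \<le> C ^ (LEAST n. 5 * L \<le> 2 ^ n) * measure M (ball x r)"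
proof (rule measure_doubling_le[OF assms])
  have "\<exists>n. 5 * L \<le> 2 ^ n" using real_arch_pow[of 2 "5 * L"] less_imp_le by auto
  then have "5 * L \<le> 2 ^ (LEAST n. 5 * L \<le> 2 ^ n)" by (rule LeastI_ex)
  then have "(5 * L) * r \<le> 2 ^ (LEAST n. 5 * L \<le> 2 ^ n) * r" using assms by (intro mult_right_mono) auto
  then show "dist x x + 5 * (L * r) \<le> 2 ^ (LEAST n. 5 * L \<le> 2 ^ n) * r" by (simp add: mult_ac)
qed

text \<open>At radius \<open>r / 2 ^ k\<close> about a point near \<open>A\<close> the density of
  \<open>E\<close> is still at most 1/2, by \<open>\<gamma>\<close>; at almost every point of
  \<open>E\<close> it exceeds 1/2 at some smaller radius. In between lies a ball to which the
  isoperimetric inequality applies, and Vitali's lemma sums over such balls. A smaller density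
  allows a larger \<open>k\<close> and hence a smaller constant.\<close>

lemma boxing:
  assumes E: "E \<in> sets M" and \<Omega>: "open \<Omega>" and fin: "perimeter E \<Omega> < \<infinity>"
    and A: "bounded A" and r: "0 < r" and sub: "\<And>x. x \<in> A \<Longrightarrow> ball x (8 * L * r) \<subseteq> \<Omega>"
    and dens: "\<And>x. x \<in> A \<Longrightarrow> measure M (E \<inter> ball x (4 * r)) \<le> \<gamma> * measure M (ball x (4 * r))"
    and \<gamma>: "0 \<le> \<gamma>" "\<gamma> * C ^ (k + 3) \<le> 1 / 2"
  shows "emeasure M (E \<inter> (\<Union>x\<in>A. ball x (3 * r)))
    \<le> ennreal (boxing_const k * r) * perimeter E (\<Union>x\<in>A. ball x ((3 + L) * r))"
proof -
  define R where "R = r / 2 ^ k"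
  have R: "0 < R" "R \<le> r" using r by (auto simp: R_def divide_le_eq_1 field_simps)
  have Lr: "r \<le> L * r" using L_ge_1 r by simp
  let ?N = "\<lambda>s. \<Union>x\<in>A. ball x s"
  define U where "U = ?N ((3 + L) * r)"
  define K where "K = closure (?N (4 * r))"
  obtain c D where D: "A \<subseteq> cball c D" using A bounded_subset_cball by blast
  have "bounded (?N (4 * r))"
  proof (rule bounded_subset[OF bounded_cball[of c "D + 4 * r"]], safe)
    fix x y assume "x \<in> A" "y \<in> ball x (4 * r)"
    then show "y \<in> cball c (D + 4 * r)" using D dist_triangle[of c y x] by fastforce
  qed
  then have "compact K" unfolding K_def by (intro closed_bounded_compact) auto
  have K5: "K \<subseteq> ?N (5 * r)"
  proof
    fix y assume "y \<in> K"
    then obtain z where z: "z \<in> ?N (4 * r)" "dist z y < r" unfolding K_def using r closure_approachable by blast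
    then obtain x where "x \<in> A" "dist x z < 4 * r" by auto
    then show "y \<in> ?N (5 * r)" using z dist_triangle[of x y z] by (intro UN_I[of x]) auto
  qed
  have "?N (5 * r) \<subseteq> \<Omega>"
  proof safe
    fix x y assume "x \<in> A" "y \<in> ball x (5 * r)"
    moreover have "5 * r \<le> 8 * L * r" using Lr r unfolding mult.assoc by linarith
    ultimately show "y \<in> \<Omega>" using sub[of x] subset_ball[of "5 * r" "8 * L * r" x] by blast
  qed
  with K5 have K\<Omega>: "K \<subseteq> \<Omega>" by blast
  have NK: "ball y R \<subseteq> K" if y: "y \<in> ?N (3 * r)" for y
  proof -
    obtain x where x: "x \<in> A" "dist x y < 3 * r" using y by auto
    have "ball y R \<subseteq> ball x (4 * r)"
    proof
      fix z assume "z \<in> ball y R"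
      then show "z \<in> ball x (4 * r)" using x R dist_triangle[of x z y] by auto
    qed
    then have "ball y R \<subseteq> ?N (4 * r)" using x by blast
    then show ?thesis unfolding K_def using closure_subset by blast
  qed
  obtain Z where Z: "Z \<in> null_sets M"
    "\<And>y. y \<in> E \<inter> ?N (3 * r) - Z \<Longrightarrow> \<exists>\<rho>. 0 < \<rho> \<and> \<rho> < R \<and> measure M (ball y \<rho>) / 2 < measure M (E \<inter> ball y \<rho>)"
    using null_low_density[OF E \<Omega> fin \<open>compact K\<close> K\<Omega> R(1), of "?N (3 * r)"] NK by blast
  define Y where "Y = E \<inter> ?N (3 * r) - Z"
  have "\<exists>\<rho>. 0 < \<rho> \<and> \<rho> \<le> R \<and> ball y (L * \<rho>) \<subseteq> U \<and>
      ennreal (measure M (ball y \<rho>)) \<le> ennreal (2 * C * P * \<rho>) * perimeter E (ball y (L * \<rho>))"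
    if y: "y \<in> Y" for y
  proof -
    obtain x where x: "x \<in> A" "dist x y < 3 * r" using y by (auto simp: Y_def)
    obtain \<rho> where \<rho>: "0 < \<rho>" "\<rho> < R" "measure M (ball y \<rho>) / 2 < measure M (E \<inter> ball y \<rho>)"
      using Z(2) y unfolding Y_def by blast
    have "measure M (E \<inter> ball y R) \<le> measure M (E \<inter> ball x (4 * r))"
    proof (intro measure_mono_fmeasurable)
      show "E \<inter> ball y R \<subseteq> E \<inter> ball x (4 * r)"
      proof safe
        fix z assume "z \<in> ball y R"
        then show "z \<in> ball x (4 * r)" using x R dist_triangle[of x z y] by auto
      qed
      show "E \<inter> ball x (4 * r) \<in> fmeasurable M" "E \<inter> ball y R \<in> sets M"
        using E by (auto simp: Int_ball_fmeasurable intro: fmeasurable_Diff)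
    qed
    also have "\<dots> \<le> \<gamma> * measure M (ball x (4 * r))" by (rule dens[OF x(1)])
    also have "\<dots> \<le> \<gamma> * (C ^ (k + 3) * measure M (ball y R))"
    proof (intro mult_left_mono measure_doubling_le R \<gamma>)
      \<comment> \<open>The ball of radius \<open>4 * r\<close> about \<open>x\<close> lies in the
        ball of radius \<open>8 * r\<close> about \<open>y\<close>; this is the source of the
        exponent \<open>k + 3\<close>.\<close>
      have "2 ^ (k + 3) * R = 8 * r" by (simp add: R_def power_add)
      then show "dist y x + 4 * r \<le> 2 ^ (k + 3) * R" using x r by (simp add: dist_commute)
    qed
    also have "\<dots> \<le> 1 / 2 * measure M (ball y R)"
      using \<gamma>(2) by (simp only: mult.assoc[symmetric] mult_right_mono measure_nonneg)
    finally have top: "measure M (E \<inter> ball y R) \<le> 1 / 2 * measure M (ball y R)" .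
    have C2: "1 / (2 * C) \<le> 1 / 2" using C_ge_1 by (simp add: field_simps)
    \<comment> \<open>With \<open>\<sigma> = 1 / (2 * C)\<close> the required density
      \<open>C * \<sigma>\<close> is the 1/2 that \<open>null_low_density\<close> provides at
      \<open>\<rho>\<close>.\<close>
    obtain s where s: "0 < s" "s \<le> R" "1 / (2 * C) * measure M (ball y s) \<le> measure M (E \<inter> ball y s)"
      "measure M (E \<inter> ball y s) \<le> 1 / 2 * measure M (ball y s)"
      by (rule density_crossing[OF E R(1) _ _ top, of "1 / (2 * C)" \<rho>]) (use \<rho> C_ge_1 in auto)
    have "(1/2) * measure M (ball y s) \<le> (1 - 1 / (2 * C)) * measure M (ball y s)"
      using C2 by (intro mult_right_mono) auto
    then have hi: "measure M (E \<inter> ball y s) \<le> (1 - 1 / (2 * C)) * measure M (ball y s)" using s(4) by linarith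
    have Ls: "L * s \<le> L * r" using s R L_ge_1 by (intro mult_left_mono) auto
    have "cball y (2 * L * s) \<subseteq> ball x (8 * L * r)"
    proof
      fix z assume "z \<in> cball y (2 * L * s)"
      then have "dist y z \<le> 2 * (L * s)" by (simp add: mult.assoc)
      then have "dist x z < 8 * (L * r)" using x Ls Lr r dist_triangle[of x z y] by linarith
      then show "z \<in> ball x (8 * L * r)" by (simp add: mult.assoc)
    qed
    then have sub': "cball y (2 * L * s) \<subseteq> \<Omega>" using sub[OF x(1)] by blast
    have iso: "ennreal (1 / (2 * C) * measure M (ball y s)) \<le> ennreal (P * s) * perimeter E (ball y (L * s))"
      by (rule relative_isoperimetric[OF E \<Omega> fin s(1) sub' _ s(3) hi]) (use C_ge_1 in auto)
    have "ennreal (measure M (ball y s)) = ennreal (2 * C) * ennreal (1 / (2 * C) * measure M (ball y s))"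
      using C_ge_1 by (simp flip: ennreal_mult)
    also have "\<dots> \<le> ennreal (2 * C) * (ennreal (P * s) * perimeter E (ball y (L * s)))"
      using iso by (intro mult_left_mono) auto
    also have "\<dots> = ennreal (2 * C * P * s) * perimeter E (ball y (L * s))"
      using C_ge_1 P_ge_1 s(1) by (simp add: ennreal_mult mult_ac)
    finally have "ennreal (measure M (ball y s)) \<le> ennreal (2 * C * P * s) * perimeter E (ball y (L * s))" .
    moreover have "ball y (L * s) \<subseteq> U"
    proof
      fix z assume "z \<in> ball y (L * s)"
      then show "z \<in> U" unfolding U_def using x Ls dist_triangle[of x z y]
        by (intro UN_I[of x]) (auto simp: algebra_simps)
    qed
    ultimately show ?thesis using s by blast
  qed
  then obtain \<rho> where \<rho>: "\<And>y. y \<in> Y \<Longrightarrow> 0 < \<rho> y" "\<And>y. y \<in> Y \<Longrightarrow> \<rho> y \<le> R"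
    "\<And>y. y \<in> Y \<Longrightarrow> ball y (L * \<rho> y) \<subseteq> U"
    "\<And>y. y \<in> Y \<Longrightarrow> ennreal (measure M (ball y (\<rho> y))) \<le> ennreal (2 * C * P * \<rho> y) * perimeter E (ball y (L * \<rho> y))"
    by metis
  have "Y \<subseteq> ?N (4 * r)"
  proof
    fix y assume "y \<in> Y"
    then obtain x where "x \<in> A" "y \<in> ball x (3 * r)" by (auto simp: Y_def)
    then show "y \<in> ?N (4 * r)" using r by (intro UN_I[of x]) auto
  qed
  then have "bounded Y" using \<open>bounded (?N (4 * r))\<close> bounded_subset by blast
  moreover have "0 < L * \<rho> y" "L * \<rho> y \<le> L * R" if "y \<in> Y" for y
    using \<rho>(1,2)[OF that] L_ge_1 by (auto intro: mult_left_mono)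
  ultimately obtain S where S: "countable S" "S \<subseteq> Y" "disjoint_family_on (\<lambda>x. ball x (L * \<rho> x)) S"
    "Y \<subseteq> (\<Union>x\<in>S. ball x (5 * (L * \<rho> x)))"
    by (rule vitali_covering[of Y "\<lambda>y. L * \<rho> y" "L * R"])
  define c where "c = C ^ (LEAST n. 5 * L \<le> 2 ^ n)"
  have c: "0 \<le> c" using C_ge_1 by (simp add: c_def)
  have one: "emeasure M (ball y (5 * (L * \<rho> y))) \<le> ennreal (boxing_const k * r) * perimeter E (ball y (L * \<rho> y))"
    if "y \<in> S" for y
  proof -
    have y: "y \<in> Y" using that S by auto
    have "emeasure M (ball y (5 * (L * \<rho> y))) \<le> ennreal (c * measure M (ball y (\<rho> y)))"
      unfolding emeasure_ball c_def by (intro ennreal_leI measure_dilate \<rho>(1) y)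
    also have "\<dots> = ennreal c * ennreal (measure M (ball y (\<rho> y)))" using c by (simp add: ennreal_mult)
    also have "\<dots> \<le> ennreal c * (ennreal (2 * C * P * \<rho> y) * perimeter E (ball y (L * \<rho> y)))"
      by (intro mult_left_mono \<rho>(4) y) simp
    also have "\<dots> = ennreal (c * (2 * C * P * \<rho> y)) * perimeter E (ball y (L * \<rho> y))"
      using c C_ge_1 P_ge_1 \<rho>(1)[OF y] by (simp add: ennreal_mult mult_ac)
    also have "\<dots> \<le> ennreal (boxing_const k * r) * perimeter E (ball y (L * \<rho> y))"
    proof (intro mult_right_mono ennreal_leI)
      have "c * (2 * C * P * \<rho> y) \<le> c * (2 * C * P * R)"
        using c C_ge_1 P_ge_1 \<rho>(2)[OF y] by (intro mult_left_mono) auto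
      then show "c * (2 * C * P * \<rho> y) \<le> boxing_const k * r" by (simp add: boxing_const_def R_def c_def)
    qed simp
    finally show ?thesis .
  qed
  have "emeasure M (\<Union>x\<in>S. ball x (5 * (L * \<rho> x))) \<le> ennreal (boxing_const k * r) * perimeter E U"
  proof (rule emeasure_countable_UN_le[OF S(1)])
    fix T assume T: "finite T" "T \<subseteq> S"
    have "(\<Sum>x\<in>T. emeasure M (ball x (5 * (L * \<rho> x)))) \<le> (\<Sum>x\<in>T. ennreal (boxing_const k * r) * perimeter E (ball x (L * \<rho> x)))"
      using one T by (intro sum_mono) auto
    also have "\<dots> = ennreal (boxing_const k * r) * (\<Sum>x\<in>T. perimeter E (ball x (L * \<rho> x)))"
      by (simp add: sum_distrib_left)
    also have "\<dots> \<le> ennreal (boxing_const k * r) * perimeter E U"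
    proof (intro mult_left_mono total_variation_superadditive disjoint_family_on_mono[OF T(2) S(3)] T)
      fix x assume "x \<in> T"
      then show "ball x (L * \<rho> x) \<subseteq> U" using T S by (intro \<rho>(3)) auto
    qed auto
    finally show "(\<Sum>x\<in>T. emeasure M (ball x (5 * (L * \<rho> x)))) \<le> ennreal (boxing_const k * r) * perimeter E U" .
  qed auto
  moreover have "emeasure M (E \<inter> ?N (3 * r)) \<le> emeasure M (Z \<union> (\<Union>x\<in>S. ball x (5 * (L * \<rho> x))))"
  proof (rule emeasure_mono)
    show "E \<inter> ?N (3 * r) \<subseteq> Z \<union> (\<Union>x\<in>S. ball x (5 * (L * \<rho> x)))" using S(4) by (auto simp: Y_def)
    show "Z \<union> (\<Union>x\<in>S. ball x (5 * (L * \<rho> x))) \<in> sets M"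
      using null_setsD2[OF Z(1)] by (intro sets.Un[OF _ open_sets] open_UN) auto
  qed
  moreover have "emeasure M (Z \<union> (\<Union>x\<in>S. ball x (5 * (L * \<rho> x)))) \<le> emeasure M Z + emeasure M (\<Union>x\<in>S. ball x (5 * (L * \<rho> x)))"
    using null_setsD2[OF Z(1)] by (intro emeasure_subadditive) (simp_all add: open_sets open_UN)
  moreover have "emeasure M Z = 0" using Z(1) by auto
  ultimately show ?thesis unfolding U_def by simp
qed

end

section \<open>Cutting a set off near a set of low density\<close>

lemma infdist_less_iff: "A \<noteq> {} \<Longrightarrow> infdist y A < s \<longleftrightarrow> y \<in> (\<Union>x\<in>A. ball x s)"
  using cINF_less_iff[OF _ bdd_below_image_dist, of A y s] by (auto simp: infdist_notempty dist_commute)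

context doubling_poincare
begin

text \<open>The cut-off vanishes within distance \<open>r\<close> of \<open>A\<close> and equals 1
  beyond \<open>2 * r\<close>. So only energy away from \<open>A\<close> is spent, and the product
  rule adds \<open>1 / r\<close> times the integral of \<open>w i\<close> over the transition
  region, which tends to the mass of \<open>E\<close> there.\<close>

lemma total_variation_cutoff_le:
  fixes A :: "'a set" and r :: real
  defines "h \<equiv> \<lambda>y. max 0 (min 1 (infdist y A / r - 1))"
  assumes E: "E \<in> sets M" and U: "open U" and A: "A \<noteq> {}" "bounded A" and r: "0 < r"
    and sub: "(\<Union>x\<in>A. ball x (3 * r)) \<subseteq> U"
    and fin: "perimeter E U < \<infinity>"
  shows "total_variation M (\<lambda>y. h y * indicator E y) U
    \<le> perimeter E {y\<in>U. r / 2 < infdist y A}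
       + ennreal (1 / r) * emeasure M (E \<inter> (\<Union>x\<in>A. ball x (3 * r)))"
proof -
  have [measurable]: "E \<in> sets M" by fact
  let ?d = "\<lambda>y. infdist y A"
  have N: "?d y < s \<longleftrightarrow> y \<in> (\<Union>x\<in>A. ball x s)" for y s by (rule infdist_less_iff[OF A(1)])
  \<comment> \<open>Competitors are taken on \<open>U'\<close> only and glued with zero. The
    threshold \<open>r / 2\<close> lets \<open>U'\<close> overlap the open set of points closer than
    \<open>r\<close> to \<open>A\<close>, so that the two cover \<open>U\<close>.\<close>
  define U' where "U' = {y\<in>U. r / 2 < ?d y}"
  define D where "D = {y. r \<le> ?d y \<and> ?d y \<le> 2 * r}"
  have dc: "continuous_on UNIV ?d" by (intro continuous_intros)
  have "U' = U \<inter> (?d -` {r/2<..} \<inter> UNIV)" by (auto simp: U'_def)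
  moreover have "open (?d -` {r/2<..} \<inter> UNIV)"
    using continuous_on_open_vimage[OF open_UNIV] dc open_greaterThan by metis
  ultimately have oU': "open U'" using U by auto
  have oN: "open (\<Union>x\<in>A. ball x r)" by auto
  have DU: "D \<subseteq> U'"
  proof
    fix y assume "y \<in> D"
    then have y: "r \<le> ?d y" "?d y \<le> 2 * r" by (auto simp: D_def)
    then have "?d y < 3 * r" using r by linarith
    then have "y \<in> U" using sub N by blast
    then show "y \<in> U'" using y r by (simp add: U'_def)
  qed
  have closed_D': "closed {y. r \<le> ?d y}" by (intro closed_Collect_le continuous_intros)
  have "D = {y. r \<le> ?d y} \<inter> {y. ?d y \<le> 2 * r}" by (auto simp: D_def)
  moreover have "closed {y. ?d y \<le> 2 * r}" by (intro closed_Collect_le continuous_intros)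
  ultimately have cD: "closed D" using closed_D' by auto
  have "bounded D"
  proof -
    obtain c e where ce: "A \<subseteq> cball c e" using A bounded_subset_cball by blast
    have "D \<subseteq> cball c (e + 3 * r)"
    proof
      fix y assume "y \<in> D"
      then have "?d y < 3 * r" using r by (simp add: D_def)
      then obtain x where "x \<in> A" "dist x y < 3 * r" using N by auto
      then show "y \<in> cball c (e + 3 * r)" using ce dist_triangle[of c y x] by fastforce
    qed
    then show ?thesis using bounded_cball bounded_subset by blast
  qed
  then have D: "compact D" using cD by (intro closed_bounded_compact)
  have [measurable]: "D \<in> sets M" using cD by (rule closed_sets)
  have h01: "0 \<le> h y" "h y \<le> 1" for y by (auto simp: h_def)
  have hlip: "\<bar>h z - h y\<bar> \<le> 1 / r * dist y z" for y z
  proof -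
    have "\<bar>?d z - ?d y\<bar> \<le> dist y z" using infdist_triangle_abs[of z A y] by (simp add: dist_commute)
    then have "\<bar>?d z / r - ?d y / r\<bar> \<le> dist y z / r"
      using r by (simp add: divide_right_mono flip: diff_divide_distrib)
    then show ?thesis unfolding h_def by auto
  qed
  have h0: "h y = 0" if "?d y < r" for y using that r by (simp add: h_def field_simps)
  have h1: "h y = 1" if "2 * r \<le> ?d y" for y using that r by (simp add: h_def field_simps)
  define m where "m = emeasure M (E \<inter> D)"
  have "total_variation M (\<lambda>y. h y * indicator E y) U \<le> b + ennreal (1 / r) * m"
    if b: "perimeter E U' < b" for b
  proof -
    obtain w where w: "\<And>i. w i \<in> Lip_loc U'" "converges_L1_loc M U' w (indicator E)"
      "\<And>i. energy M U' (w i) < b" "\<And>i x. 0 \<le> w i x \<and> w i x \<le> 1"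
      using total_variation_approx_01[OF b] by (auto simp: indicator_def)
    define a where "a = (\<lambda>i. L1_dist M D (w i) (indicator E))"
    have a: "a \<longlonglongrightarrow> 0" unfolding a_def by (rule converges_L1_locD[OF w(2) D DU])
    have diff: "\<bar>h z * w i z - h y * w i y\<bar> \<le> \<bar>w i z - w i y\<bar> + (1 / r * w i y) * dist y z" for i y z
      using w(4) by (intro mult_cutoff_diff_le h01 hlip) auto
    have "total_variation M (\<lambda>y. h y * indicator E y) U
        \<le> liminf (\<lambda>i. energy M U (\<lambda>y. h y * w i y))"
    proof (rule total_variation_le_liminf)
      fix i
      have 1: "(\<lambda>y. h y * w i y) \<in> Lip_loc U'"
      proof (rule Lip_loc_affine_le[OF w(1)[of i], of 1 "1/r"])
        fix x y
        have "1 / r * w i x * dist x y \<le> 1 / r * 1 * dist x y"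
          using w(4)[of i x] r by (intro mult_right_mono mult_left_mono) auto
        then show "\<bar>h y * w i y - h x * w i x\<bar> \<le> 1 * \<bar>w i y - w i x\<bar> + 1 / r * dist x y"
          using diff[of y i x] by simp
      qed (use r in auto)
      have "h y * w i y = 0" if "y \<in> (\<Union>x\<in>A. ball x r)" for y
        using h0[of y] N[of y r] that by simp
      then have 2: "(\<lambda>y. h y * w i y) \<in> Lip_loc (\<Union>x\<in>A. ball x r)"
        using Lip_loc_cong[of "\<Union>x\<in>A. ball x r" "\<lambda>y. h y * w i y" "\<lambda>_. 0"] Lip_loc_const by blast
      have "U \<subseteq> U' \<union> (\<Union>x\<in>A. ball x r)"
      proof
        fix y assume y: "y \<in> U"
        show "y \<in> U' \<union> (\<Union>x\<in>A. ball x r)"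
        proof (cases "?d y < r")
          case False
          then show ?thesis using y r by (simp add: U'_def)
        qed (use N in blast)
      qed
      then show "(\<lambda>y. h y * w i y) \<in> Lip_loc U"
        by (rule Lip_loc_subset[OF Lip_loc_Un[OF oU' oN 1 2]])
    next
      show "converges_L1_loc M U (\<lambda>i y. h y * w i y) (\<lambda>y. h y * indicator E y)"
        by (rule converges_L1_loc_cutoff[OF w(2) _ closed_D']) (use h01 h0 r in \<open>auto simp: U'_def\<close>)
    qed
    also have "\<dots> \<le> liminf (\<lambda>i. b + ennreal (1 / r) * (a i + m))"
    proof (intro Liminf_mono always_eventually allI)
      fix i
      have wm: "(\<lambda>y. w i y * indicator U' y) \<in> borel_measurable M" by (rule Lip_loc_measurable[OF oU' w(1)])
      have wD[measurable]: "(\<lambda>y. ennreal (w i y) * indicator D y) \<in> borel_measurable M"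
      proof -
        have "(\<lambda>y. ennreal (w i y * indicator U' y) * indicator D y) \<in> borel_measurable M" using wm by measurable
        moreover have "ennreal (w i y * indicator U' y) * indicator D y = ennreal (w i y) * indicator D y" for y
          using DU by (auto simp: indicator_def)
        ultimately show ?thesis by simp
      qed
      have slope: "lip_slope (\<lambda>y. h y * w i y) y * indicator U y
          \<le> lip_slope (w i) y * indicator U' y + ennreal (1 / r) * (ennreal (w i y) * indicator D y)" for y
      proof -
        have gen: "lip_slope (\<lambda>y. h y * w i y) y \<le> lip_slope (w i) y + ennreal (1 / r) * ennreal (w i y)"
          using lip_slope_affine_le[of 1 1 "1 / r * w i y" y "\<lambda>y. h y * w i y" "w i"] diff r w(4)[of i y]
          by (simp flip: ennreal_mult)
        consider "?d y < r" | "y \<in> D" | "2 * r < ?d y" unfolding D_def by fastforce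
        then show ?thesis
        proof cases
          case 1
          obtain e where e: "e > 0" "ball y e \<subseteq> (\<Union>x\<in>A. ball x r)" using oN 1 N open_contains_ball by metis
          have "lip_slope (\<lambda>y. h y * w i y) y = 0"
          proof (rule lip_slope_locally_const[OF e(1)])
            fix z assume "z \<in> ball y e"
            then have "?d z < r" using e(2) N by blast
            then show "h z * w i z = h y * w i y" using h0 1 by simp
          qed
          then show ?thesis by simp
        next
          case 2
          then have "y \<in> U'" "y \<in> U" using DU by (auto simp: U'_def)
          then show ?thesis using 2 gen by simp
        next
          case 3
          have "open (?d -` {2*r<..} \<inter> UNIV)"
            using continuous_on_open_vimage[OF open_UNIV] dc open_greaterThan by metis
          then obtain e where e: "e > 0" "ball y e \<subseteq> ?d -` {2*r<..} \<inter> UNIV"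
            using 3 open_contains_ball by (metis IntI UNIV_I greaterThan_iff vimageI)
          have "lip_slope (\<lambda>y. h y * w i y) y \<le> lip_slope (w i) y"
          proof (rule lip_slope_le[OF e(1)])
            fix z assume "z \<in> ball y e"
            then have "h z = 1" using e(2) h1 by force
            then show "\<bar>h z * w i z - h y * w i y\<bar> \<le> \<bar>w i z - w i y\<bar>" using 3 h1[of y] by simp
          qed
          moreover have "y \<in> U \<Longrightarrow> y \<in> U'" using 3 r by (simp add: U'_def)
          ultimately show ?thesis by (cases "y \<in> U") (auto intro: add_increasing2)
        qed
      qed
      have "energy M U (\<lambda>y. h y * w i y)
          \<le> (\<integral>\<^sup>+y. (lip_slope (w i) y * indicator U' y + ennreal (1 / r) * (ennreal (w i y) * indicator D y)) \<partial>M)"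
        by (intro nn_integral_mono slope)
      also have "\<dots> = energy M U' (w i) + ennreal (1 / r) * (\<integral>\<^sup>+y. ennreal (w i y) * indicator D y \<partial>M)"
        using lip_slope_measurable[OF oU' w(1)] by (simp add: nn_integral_add nn_integral_cmult)
      also have "(\<integral>\<^sup>+y. ennreal (w i y) * indicator D y \<partial>M) \<le> a i + m"
      proof -
        have "(\<integral>\<^sup>+y. ennreal (w i y) * indicator D y \<partial>M)
            \<le> (\<integral>\<^sup>+y. (ennreal \<bar>w i y - indicator E y\<bar> * indicator D y + indicator (E \<inter> D) y) \<partial>M)"
        proof (rule nn_integral_mono)
          fix y
          have "ennreal (w i y) \<le> ennreal (\<bar>w i y - 1\<bar> + 1)" by (intro ennreal_leI) simp
          then have "ennreal (w i y) \<le> ennreal \<bar>w i y - 1\<bar> + 1" by simp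
          then show "ennreal (w i y) * indicator D y \<le> ennreal \<bar>w i y - indicator E y\<bar> * indicator D y + indicator (E \<inter> D) y"
            using w(4)[of i y] by (cases "y \<in> D"; cases "y \<in> E") simp_all
        qed
        also have "\<dots> = a i + m"
        proof -
          have "(\<lambda>y. ennreal \<bar>w i y * indicator U' y - indicator E y\<bar> * indicator D y) \<in> borel_measurable M"
            using wm by measurable
          moreover have "ennreal \<bar>w i y * indicator U' y - indicator E y\<bar> * indicator D y = ennreal \<bar>w i y - indicator E y\<bar> * indicator D y" for y
            using DU by (auto simp: indicator_def)
          ultimately have "(\<lambda>y. ennreal \<bar>w i y - indicator E y\<bar> * indicator D y) \<in> borel_measurable M" by simp
          then show ?thesis unfolding a_def m_def by (subst nn_integral_add) auto
        qed
        finally show ?thesis .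
      qed
      finally have "energy M U (\<lambda>y. h y * w i y)
          \<le> energy M U' (w i) + ennreal (1 / r) * (a i + m)"
        by (simp add: mult_left_mono)
      also have "\<dots> \<le> b + ennreal (1 / r) * (a i + m)" by (intro add_right_mono less_imp_le w(3))
      finally show "energy M U (\<lambda>y. h y * w i y) \<le> b + ennreal (1 / r) * (a i + m)" .
    qed
    also have "\<dots> = b + ennreal (1 / r) * (0 + m)"
    proof (rule lim_imp_Liminf)
      show "(\<lambda>i. b + ennreal (1 / r) * (a i + m)) \<longlonglongrightarrow> b + ennreal (1 / r) * (0 + m)"
        by (intro tendsto_add tendsto_const ennreal_tendsto_cmult a) auto
    qed auto
    finally show ?thesis by simp
  qed
  note key = this
  have "total_variation M (\<lambda>y. h y * indicator E y) U \<le> perimeter E U' + ennreal (1 / r) * m"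
  proof (rule ennreal_le_epsilon)
    fix e :: real assume e: "0 < e" "perimeter E U' + ennreal (1 / r) * m < top"
    then have "perimeter E U' + 0 < perimeter E U' + ennreal e"
      by (subst ennreal_add_left_cancel_less) auto
    then show "total_variation M (\<lambda>y. h y * indicator E y) U
        \<le> perimeter E U' + ennreal (1 / r) * m + ennreal e"
      using key[of "perimeter E U' + ennreal e"] by (simp add: ac_simps)
  qed
  also have "\<dots> \<le> perimeter E U' + ennreal (1 / r) * emeasure M (E \<inter> (\<Union>x\<in>A. ball x (3 * r)))"
  proof (intro add_left_mono mult_left_mono)
    have "D \<subseteq> (\<Union>x\<in>A. ball x (3 * r))"
    proof
      fix y assume "y \<in> D"
      then have "?d y < 3 * r" using r by (simp add: D_def)
      then show "y \<in> (\<Union>x\<in>A. ball x (3 * r))" using N by blast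
    qed
    then show "m \<le> emeasure M (E \<inter> (\<Union>x\<in>A. ball x (3 * r)))"
      unfolding m_def by (intro emeasure_mono sets.Int E open_sets open_UN) auto
  qed auto
  finally show ?thesis unfolding U'_def .
qed

text \<open>
  Where the density of \<open>E\<close> is small near \<open>A\<close>, cutting \<open>E\<close> off near \<open>A\<close> at scale \<open>r\<close> costs, by the
  boxing inequality, at most half of the perimeter of \<open>E\<close> near \<open>A\<close>. By lower semicontinuity as
  \<open>r \<rightarrow> 0\<close>, the perimeter of \<open>E\<close> concentrates nothing on \<open>A\<close>.
\<close>

lemma perimeter_vanishes_at_low_density:
  assumes E: "E \<in> sets M" and \<Omega>: "open \<Omega>" and fin: "perimeter E \<Omega> < \<infinity>"
    and A: "bounded A" and \<rho>0: "0 < \<rho>0" and sub: "\<And>x. x \<in> A \<Longrightarrow> ball x \<rho>0 \<subseteq> \<Omega>"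
    and dens: "\<And>x r. x \<in> A \<Longrightarrow> 0 < r \<Longrightarrow> r < \<rho>0 \<Longrightarrow> measure M (E \<inter> ball x r) \<le> \<gamma> * measure M (ball x r)"
    and \<gamma>: "0 \<le> \<gamma>" "\<gamma> * C ^ (k + 3) \<le> 1 / 2" and k: "boxing_const k \<le> 1 / 2"
    and \<epsilon>: "0 < (\<epsilon> :: real)"
  shows "\<exists>\<rho>. 0 < \<rho> \<and> \<rho> < \<rho>0 \<and> perimeter E (\<Union>x\<in>A. ball x \<rho>) \<le> ennreal \<epsilon>"
proof (cases "A = {}")
  case True
  have "perimeter E {} \<le> 0"
    by (rule total_variation_le[of "\<lambda>_ _. 0"]) (auto simp: Lip_loc_const converges_L1_loc_def)
  then show ?thesis using True \<rho>0 by (intro exI[of _ "\<rho>0/2"]) auto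
next
  case A0: False
  have [measurable]: "E \<in> sets M" by fact
  define N where "N = (\<lambda>s. \<Union>x\<in>A. ball x s)"
  have Niff: "infdist y A < s \<longleftrightarrow> y \<in> N s" for y s unfolding N_def by (rule infdist_less_iff[OF A0])
  have Nmono: "N s \<subseteq> N t" if "s \<le> t" for s t unfolding N_def using that by (intro UN_mono subset_ball) auto
  have N\<Omega>: "N s \<subseteq> \<Omega>" if "s \<le> \<rho>0" for s
    unfolding N_def using sub subset_ball[OF that] by blast
  define V where "V = (\<lambda>s. perimeter E (N s))"
  \<comment> \<open>The perimeter carried by all small neighbourhoods of \<open>A\<close>. Once
    \<open>V \<rho>1\<close> is within \<open>e\<close> of it, at most \<open>e\<close> of the
    perimeter in \<open>N \<rho>1\<close> can lie off a smaller neighbourhood.\<close>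
  define \<kappa> where "\<kappa> = (INF s\<in>{0<..<\<rho>0}. V s)"
  have \<kappa>le: "\<kappa> \<le> V s" if "0 < s" "s < \<rho>0" for s unfolding \<kappa>_def using that by (intro INF_lower) auto
  have Vfin: "V s < \<infinity>" if "s \<le> \<rho>0" for s
    unfolding V_def using total_variation_mono[OF N\<Omega>[OF that], of M "indicator E"] fin by simp
  have "\<kappa> < \<infinity>" using \<kappa>le[of "\<rho>0/2"] Vfin[of "\<rho>0/2"] \<rho>0 by auto
  define e where "e = \<epsilon> / 2"
  have e: "0 < e" using \<epsilon> by (simp add: e_def)
  have "\<kappa> + 0 < \<kappa> + ennreal e" using \<open>\<kappa> < \<infinity>\<close> e by (subst ennreal_add_left_cancel_less) auto
  then have "(INF s\<in>{0<..<\<rho>0}. V s) < \<kappa> + ennreal e" by (simp add: \<kappa>_def)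
  then obtain \<rho>1 where \<rho>1: "0 < \<rho>1" "\<rho>1 < \<rho>0" "V \<rho>1 < \<kappa> + ennreal e"
    unfolding INF_less_iff by auto
  define U where "U = N \<rho>1"
  have oU: "open U" by (auto simp: U_def N_def)
  have U\<Omega>: "U \<subseteq> \<Omega>" unfolding U_def using \<rho>1 by (intro N\<Omega>) simp
  have VU: "perimeter E U = V \<rho>1" by (simp add: U_def V_def)
  \<comment> \<open>Keeps every enlarged ball of the boxing inequality at scale
    \<open>r \<le> r0\<close> inside the neighbourhood of radius \<open>\<rho>1\<close>.\<close>
  define r0 where "r0 = \<rho>1 / (8 * L)"
  have r0: "0 < r0" using \<rho>1 L_ge_1 by (simp add: r0_def)
  have small: "8 * L * r \<le> \<rho>1" "8 * r \<le> \<rho>1" "(3 + L) * r \<le> \<rho>1" if "0 < r" "r \<le> r0" for r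
  proof -
    show 1: "8 * L * r \<le> \<rho>1" using that L_ge_1 by (simp add: r0_def field_simps)
    have "8 * 1 * r \<le> 8 * L * r" using that L_ge_1 by (intro mult_right_mono mult_left_mono) auto
    then show 2: "8 * r \<le> \<rho>1" using 1 by simp
    have "(3 + L) * r = 3 * r + L * r" by (simp add: algebra_simps)
    moreover have "8 * L * r = 8 * (L * r)" by simp
    ultimately show "(3 + L) * r \<le> \<rho>1" using 1 2 \<rho>1(1) by linarith
  qed
  have box: "emeasure M (E \<inter> N (3 * r)) \<le> ennreal (r / 2) * V \<rho>1" if r: "0 < r" "r \<le> r0" for r
  proof -
    have "emeasure M (E \<inter> N (3 * r)) \<le> ennreal (boxing_const k * r) * perimeter E (\<Union>x\<in>A. ball x ((3 + L) * r))"
      unfolding N_def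
    proof (rule boxing[OF E \<Omega> fin A r(1) _ _ \<gamma>])
      fix x assume x: "x \<in> A"
      have "ball x (8 * L * r) \<subseteq> ball x \<rho>0" using small(1)[OF r] \<rho>1 by (intro subset_ball) linarith
      then show "ball x (8 * L * r) \<subseteq> \<Omega>" using sub[OF x] by blast
      show "measure M (E \<inter> ball x (4 * r)) \<le> \<gamma> * measure M (ball x (4 * r))"
        using small(2)[OF r] r \<rho>1 by (intro dens[OF x]) auto
    qed
    also have "\<dots> \<le> ennreal (r / 2) * V \<rho>1"
    proof (intro mult_mono ennreal_leI)
      show "boxing_const k * r \<le> r / 2" using mult_right_mono[OF k, of r] r by simp
      show "perimeter E (\<Union>x\<in>A. ball x ((3 + L) * r)) \<le> V \<rho>1"
        unfolding V_def using Nmono[OF small(3)[OF r]] by (intro total_variation_mono) (simp add: N_def)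
    qed auto
    finally show ?thesis .
  qed
  define h where "h = (\<lambda>r y. max 0 (min 1 (infdist y A / r - 1)))"
  have cut: "total_variation M (\<lambda>y. h r y * indicator E y) U \<le> ennreal e + ennreal (1/2) * V \<rho>1"
    if r: "0 < r" "r \<le> r0" for r
  proof -
    define U' where "U' = {y\<in>U. r / 2 < infdist y A}"
    have "total_variation M (\<lambda>y. h r y * indicator E y) U
        \<le> perimeter E U' + ennreal (1 / r) * emeasure M (E \<inter> N (3 * r))"
      unfolding h_def U'_def N_def
    proof (rule total_variation_cutoff_le[OF E oU A0 A r(1)])
      show "(\<Union>x\<in>A. ball x (3 * r)) \<subseteq> U" unfolding U_def using Nmono[of "3 * r" \<rho>1] small(2)[OF r] r
        by (simp add: N_def)
      show "perimeter E U < \<infinity>" unfolding VU using \<rho>1 by (intro Vfin) simp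
    qed
    also have "perimeter E U' \<le> ennreal e"
    proof -
      have oU': "open U'"
      proof -
        have "open {y. r / 2 < infdist y A}" by (intro open_Collect_less continuous_intros)
        moreover have "U' = U \<inter> {y. r / 2 < infdist y A}" by (auto simp: U'_def)
        ultimately show ?thesis using oU by auto
      qed
      have r2: "0 < r / 2" "r / 2 < \<rho>0" "r / 2 \<le> \<rho>1" using small(2)[OF r] r \<rho>1 by auto
      have "(\<Sum>b\<in>UNIV. perimeter E (if b then U' else N (r / 2))) \<le> perimeter E U"
      proof (rule total_variation_superadditive)
        show "disjoint_family_on (\<lambda>b. if b then U' else N (r / 2)) UNIV"
        proof -
          have "y \<notin> N (r / 2)" if "y \<in> U'" for y
            using that Niff[of y "r / 2"] by (simp add: U'_def)
          then have "U' \<inter> N (r / 2) = {}" by blast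
          then show ?thesis by (auto simp: disjoint_family_on_def)
        qed
        show "open (if b then U' else N (r / 2))" for b using oU' by (auto simp: N_def)
        show "(if b then U' else N (r / 2)) \<subseteq> U" for b
          using Nmono[OF r2(3)] by (auto simp: U'_def U_def)
      qed simp
      \<comment> \<open>\<open>U'\<close> and \<open>N (r / 2)\<close> are disjoint, and the latter
        already carries at least \<open>\<kappa>\<close>; cancelling the finite
        \<open>V (r / 2)\<close> leaves at most \<open>e\<close> for \<open>U'\<close>.\<close>
      then have "V (r / 2) + perimeter E U' \<le> V \<rho>1"
        unfolding VU by (simp add: UNIV_bool V_def add.commute)
      also have "\<dots> \<le> \<kappa> + ennreal e" using \<rho>1 by simp
      also have "\<dots> \<le> V (r / 2) + ennreal e" by (intro add_right_mono \<kappa>le r2)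
      finally show ?thesis using Vfin[of "r / 2"] r2 by (auto simp: ennreal_add_left_cancel_le)
    qed
    also have "ennreal (1 / r) * emeasure M (E \<inter> N (3 * r)) \<le> ennreal (1 / r) * (ennreal (r / 2) * V \<rho>1)"
      by (intro mult_left_mono box r) simp
    also have "\<dots> = ennreal (1 / 2) * V \<rho>1"
      using r by (simp flip: mult.assoc ennreal_mult)
    finally show ?thesis by (simp add: add_mono)
  qed
  have "perimeter E U \<le> ennreal e + ennreal (1/2) * V \<rho>1"
  proof (rule total_variation_lsc[OF oU])
    define rr where "rr = (\<lambda>n. r0 / real (Suc n))"
    have rr: "0 < rr n" "rr n \<le> r0" for n using r0 by (auto simp: rr_def field_simps)
    show "total_variation M (\<lambda>y. h (rr n) y * indicator E y) U \<le> ennreal e + ennreal (1/2) * V \<rho>1" for n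
      by (intro cut rr)
    have Um: "U \<in> sets M" using oU by (rule open_sets)
    have hm: "(\<lambda>y. h (rr n) y) \<in> borel_measurable M" for n
    proof (intro borel_measurable_M borel_measurable_continuous_onI)
      show "continuous_on UNIV (h (rr n))" unfolding h_def using rr(1)[of n] by (intro continuous_intros) auto
    qed
    show "(\<lambda>y. h (rr n) y * indicator E y * indicator U y) \<in> borel_measurable M" for n
      using hm[of n] Um by measurable
    show "(\<lambda>y. indicator E y * indicator U y :: real) \<in> borel_measurable M" using Um by measurable
    show "converges_L1_loc M U (\<lambda>n y. h (rr n) y * indicator E y) (indicator E)"
      unfolding converges_L1_loc_def
    proof safe
      fix K assume "compact K" "K \<subseteq> U"
      \<comment> \<open>Second use of boxing: the cut-off changes \<open>E\<close> only inside
        \<open>N (3 * rr n)\<close>, where its mass is proportional to the radius. This gives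
        convergence even if \<open>A\<close> is not a null set.\<close>
      have le: "L1_dist M K (\<lambda>y. h (rr n) y * indicator E y) (indicator E) \<le> V \<rho>1 * ennreal (rr n / 2)" for n
      proof -
        have "L1_dist M K (\<lambda>y. h (rr n) y * indicator E y) (indicator E) \<le> (\<integral>\<^sup>+y. indicator (E \<inter> N (3 * rr n)) y \<partial>M)"
        proof (rule nn_integral_mono)
          fix y
          show "ennreal \<bar>h (rr n) y * indicator E y - indicator E y\<bar> * indicator K y \<le> indicator (E \<inter> N (3 * rr n)) y"
          proof (cases "y \<in> E \<inter> N (3 * rr n)")
            case True
            have "\<bar>h (rr n) y - 1\<bar> \<le> 1" by (auto simp: h_def)
            then have "ennreal \<bar>h (rr n) y - 1\<bar> \<le> 1" using ennreal_leI[of _ 1] by simp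
            then show ?thesis using True by (cases "y \<in> K") simp_all
          next
            case False
            have "h (rr n) y = 1" if "y \<in> E"
            proof -
              have "3 * rr n \<le> infdist y A" using False that Niff[of y "3 * rr n"] by auto
              then have "3 \<le> infdist y A / rr n" using rr(1)[of n] by (simp add: field_simps)
              then show ?thesis by (simp add: h_def)
            qed
            then show ?thesis using False by (auto simp: indicator_def)
          qed
        qed
        also have "\<dots> = emeasure M (E \<inter> N (3 * rr n))"
          unfolding N_def by (intro nn_integral_indicator sets.Int E open_sets[OF open_UN]) auto
        also have "\<dots> \<le> V \<rho>1 * ennreal (rr n / 2)" using box[OF rr] by (simp add: mult.commute)
        finally show ?thesis .
      qed
      have "(\<lambda>n. V \<rho>1 * ennreal (rr n / 2)) \<longlonglongrightarrow> V \<rho>1 * ennreal 0"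
      proof (intro ennreal_tendsto_cmult tendsto_ennrealI)
        have "(\<lambda>n. r0 / 2 * (1 / real (Suc n))) \<longlonglongrightarrow> r0 / 2 * 0"
          by (intro tendsto_intros LIMSEQ_Suc[OF lim_1_over_n])
        then show "(\<lambda>n. rr n / 2) \<longlonglongrightarrow> 0" by (simp add: rr_def field_simps)
      qed (use Vfin[of \<rho>1] \<rho>1 in simp)
      then have "(\<lambda>n. V \<rho>1 * ennreal (rr n / 2)) \<longlonglongrightarrow> 0" by simp
      then show "(\<lambda>n. L1_dist M K (\<lambda>y. h (rr n) y * indicator E y) (indicator E)) \<longlonglongrightarrow> 0"
        by (rule ennreal_tendsto_0_le[OF always_eventually[OF allI[OF le]]])
    qed
  qed
  \<comment> \<open>Absorption: half of the finite \<open>V \<rho>1\<close> is moved to the left,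
    which leaves \<open>2 * e = \<epsilon>\<close>.\<close>
  then have "V \<rho>1 \<le> ennreal e + ennreal (1/2) * V \<rho>1" unfolding VU .
  moreover obtain v where v: "V \<rho>1 = ennreal v" "0 \<le> v"
    using Vfin[of \<rho>1] \<rho>1 by (cases "V \<rho>1") auto
  ultimately have "v \<le> e + 1/2 * v"
    using e by (simp flip: ennreal_mult ennreal_plus del: ennreal_half)
  then have "V \<rho>1 \<le> ennreal \<epsilon>" unfolding v e_def by (intro ennreal_leI) simp
  then show ?thesis using \<rho>1 unfolding V_def N_def by blast
qed

end

section \<open>Codimension-one Hausdorff measure\<close>

lemma coH1_delta_le:
  fixes c :: "'i \<Rightarrow> 'a::metric_space" and r :: "'i \<Rightarrow> real"
  assumes S: "countable S" and r: "\<And>x. x \<in> S \<Longrightarrow> 0 < r x" "\<And>x. x \<in> S \<Longrightarrow> r x \<le> R" and R: "R < \<delta>" "0 < \<delta>"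
    and A: "A \<subseteq> (\<Union>x\<in>S. ball (c x) (r x))"
    and le: "\<And>T. finite T \<Longrightarrow> T \<subseteq> S \<Longrightarrow> (\<Sum>x\<in>T. emeasure M (ball (c x) (r x)) / ennreal (r x)) \<le> b"
  shows "coH1_delta M \<delta> A \<le> b"
proof -
  define I where "I = to_nat_on S ` S"
  define f where "f = from_nat_into S"
  have fI: "f j \<in> S" if "j \<in> I" for j using that S by (auto simp: I_def f_def from_nat_into_to_nat_on)
  have fS: "\<exists>j\<in>I. f j = x" if "x \<in> S" for x using that S by (auto simp: I_def f_def)
  have inj: "inj_on f I"
    using S by (auto simp: inj_on_def I_def f_def)
  let ?g = "\<lambda>j. emeasure M (ball (c (f j)) (r (f j))) / ennreal (r (f j))"
  have "coH1_delta M \<delta> A \<le> (\<Sum>j. ?g j * indicator I j)"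
    unfolding coH1_delta_def
  proof (rule Inf_lower, rule CollectI, rule exI[of _ "\<lambda>j. c (f j)"], rule exI[of _ "\<lambda>j. r (f j)"], rule exI[of _ I], intro conjI refl)
    show "\<forall>j\<in>I. 0 < r (f j)" using r(1) fI by blast
    show "A \<subseteq> (\<Union>j\<in>I. ball (c (f j)) (r (f j)))"
    proof
      fix y assume "y \<in> A"
      then obtain x where x: "x \<in> S" "y \<in> ball (c x) (r x)" using A by blast
      then show "y \<in> (\<Union>j\<in>I. ball (c (f j)) (r (f j)))" using fS[OF x(1)] by force
    qed
    have "(SUP j\<in>I. ennreal (r (f j))) \<le> ennreal R" by (intro SUP_least ennreal_leI r(2) fI)
    also have "\<dots> < ennreal \<delta>" using R by (simp add: ennreal_lessI)
    finally show "(SUP j\<in>I. ennreal (r (f j))) < ennreal \<delta>" .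
  qed
  also have "\<dots> \<le> b"
    unfolding suminf_eq_SUP
  proof (rule SUP_least)
    fix n
    have "(\<Sum>j<n. ?g j * indicator I j) = (\<Sum>j\<in>{..<n} \<inter> I. ?g j)"
      by (simp add: sum.inter_restrict indicator_def if_distrib cong: if_cong)
    also have "\<dots> = (\<Sum>x\<in>f ` ({..<n} \<inter> I). emeasure M (ball (c x) (r x)) / ennreal (r x))"
      using inj_on_subset[OF inj, of "{..<n} \<inter> I"] by (subst sum.reindex) auto
    also have "\<dots> \<le> b" using fI by (intro le) auto
    finally show "(\<Sum>j<n. ?g j * indicator I j) \<le> b" .
  qed
  finally show ?thesis .
qed

lemma coH1_delta_mono:
  assumes "A \<subseteq> B" shows "coH1_delta M \<delta> A \<le> coH1_delta M \<delta> B"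
  unfolding coH1_delta_def by (rule Inf_superset_mono) (use assms in blast)

text \<open>
  The strict inequality \<open>\<delta>' < \<delta>\<close> is needed since the supremum over all radii must stay below \<open>\<delta>\<close>.
\<close>

lemma coH1_delta_UN_le:
  fixes A :: "nat \<Rightarrow> 'a::metric_space set"
  assumes \<delta>: "0 < \<delta>'" "\<delta>' < \<delta>"
  shows "coH1_delta M \<delta> (\<Union>n. A n) \<le> (\<Sum>n. coH1_delta M \<delta>' (A n))"
proof (rule ennreal_le_epsilon)
  fix e :: real assume e: "0 < e" and fin: "(\<Sum>n. coH1_delta M \<delta>' (A n)) < top"
  define Q where "Q = (\<lambda>n (c, r, I). (\<forall>j\<in>I. 0 < r j) \<and> A n \<subseteq> (\<Union>j\<in>I. ball (c j) (r j)) \<and> (SUP j\<in>I. ennreal (r j)) < ennreal \<delta>' \<and>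
      (\<Sum>j. emeasure M (ball (c j) (r j)) / ennreal (r j) * indicator I j) \<le> coH1_delta M \<delta>' (A n) + ennreal (e * (1/2)^Suc n))"
  have "\<exists>p. Q n p" for n
  proof -
    have "coH1_delta M \<delta>' (A n) < top"
      using fin ennreal_suminf_lessD by blast
    moreover have "0 < ennreal (e * (1/2)^Suc n)" using e by (simp del: power_Suc)
    ultimately have "coH1_delta M \<delta>' (A n) + 0 < coH1_delta M \<delta>' (A n) + ennreal (e * (1/2)^Suc n)"
      by (subst ennreal_add_left_cancel_less) auto
    then have "coH1_delta M \<delta>' (A n) < coH1_delta M \<delta>' (A n) + ennreal (e * (1/2)^Suc n)" by simp
    then obtain z where z: "z \<in> {(\<Sum>j. emeasure M (ball (c j) (r j)) / ennreal (r j) * indicator I j) | c r (I::nat set).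
            (\<forall>j\<in>I. 0 < r j) \<and> A n \<subseteq> (\<Union>j\<in>I. ball (c j) (r j)) \<and>
            (SUP j\<in>I. ennreal (r j)) < ennreal \<delta>'}" "z < coH1_delta M \<delta>' (A n) + ennreal (e * (1/2)^Suc n)"
      unfolding coH1_delta_def[of M \<delta>' "A n"] Inf_less_iff by blast
    obtain c r I where cri: "z = (\<Sum>j. emeasure M (ball (c j) (r j)) / ennreal (r j) * indicator I j)"
      "\<forall>j\<in>I. 0 < r j" "A n \<subseteq> (\<Union>j\<in>I. ball (c j) (r j))" "(SUP j\<in>I. ennreal (r j)) < ennreal \<delta>'"
      using z(1) unfolding mem_Collect_eq by (elim exE conjE)
    have "Q n (c, r, I)" unfolding Q_def prod.case using cri(2-4) less_imp_le[OF z(2)] unfolding cri(1) by (intro conjI)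
    then show ?thesis by blast
  qed
  then obtain p where p: "\<And>n. Q n (p n)" by metis
  define c r I where "c n = fst (p n)" and "r n = fst (snd (p n))" and "I n = snd (snd (p n))" for n
  have "Q n (c n, r n, I n)" for n using p[of n] by (simp add: c_def r_def I_def)
  then have cov: "\<And>n j. j \<in> I n \<Longrightarrow> 0 < r n j" "\<And>n. A n \<subseteq> (\<Union>j\<in>I n. ball (c n j) (r n j))"
    "\<And>n. (SUP j\<in>I n. ennreal (r n j)) < ennreal \<delta>'"
    "\<And>n. (\<Sum>j. emeasure M (ball (c n j) (r n j)) / ennreal (r n j) * indicator (I n) j) \<le> coH1_delta M \<delta>' (A n) + ennreal (e * (1/2)^Suc n)"
    unfolding Q_def by auto
  let ?g = "\<lambda>n j. emeasure M (ball (c n j) (r n j)) / ennreal (r n j)"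
  let ?b = "\<lambda>n. coH1_delta M \<delta>' (A n) + ennreal (e * (1/2)^Suc n)"
  have "coH1_delta M \<delta> (\<Union>n. A n) \<le> (\<Sum>n. ?b n)"
  proof (rule coH1_delta_le[of "Sigma UNIV I" "\<lambda>(n, j). r n j" \<delta>' _ _ "\<lambda>(n, j). c n j"])
    show "countable (Sigma UNIV I)" by simp
    show "0 < (case x of (n, j) \<Rightarrow> r n j)" if "x \<in> Sigma UNIV I" for x using that cov(1) by auto
    show "(case x of (n, j) \<Rightarrow> r n j) \<le> \<delta>'" if x: "x \<in> Sigma UNIV I" for x
    proof -
      obtain n j where nj: "x = (n, j)" "j \<in> I n" using x by auto
      have "ennreal (r n j) \<le> (SUP j\<in>I n. ennreal (r n j))" using nj by (intro SUP_upper)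
      also have "\<dots> < ennreal \<delta>'" by (rule cov(3))
      finally have "r n j < \<delta>'" using cov(1)[OF nj(2)] by (simp add: ennreal_less_iff)
      then show ?thesis using nj by simp
    qed
    show "(\<Union>n. A n) \<subseteq> (\<Union>x\<in>Sigma UNIV I. ball (case x of (n, j) \<Rightarrow> c n j) (case x of (n, j) \<Rightarrow> r n j))"
      using cov(2) by fastforce
    fix T assume T: "finite T" "T \<subseteq> Sigma UNIV I"
    have TT: "T = Sigma (fst ` T) (\<lambda>n. {j. (n, j) \<in> T})" by force
    have fin: "finite {j. (n, j) \<in> T}" for n
      using finite_imageI[OF T(1), of snd] by (rule finite_subset[rotated]) force
    have "(\<Sum>x\<in>T. emeasure M (ball (case x of (n, j) \<Rightarrow> c n j) (case x of (n, j) \<Rightarrow> r n j)) / ennreal (case x of (n, j) \<Rightarrow> r n j))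
        = (\<Sum>(n, j)\<in>T. ?g n j)" by (intro sum.cong) auto
    also have "\<dots> = (\<Sum>n\<in>fst ` T. \<Sum>j\<in>{j. (n, j) \<in> T}. ?g n j)"
      using T(1) fin by (subst TT, subst sum.Sigma) auto
    also have "\<dots> \<le> (\<Sum>n\<in>fst ` T. ?b n)"
    proof (rule sum_mono)
      fix n
      have "(\<Sum>j\<in>{j. (n, j) \<in> T}. ?g n j) = (\<Sum>j\<in>{j. (n, j) \<in> T}. ?g n j * indicator (I n) j)"
        using T(2) by (intro sum.cong) auto
      also have "\<dots> \<le> (\<Sum>j. ?g n j * indicator (I n) j)" using fin by (intro sum_le_suminf) auto
      also have "\<dots> \<le> ?b n" by (rule cov(4))
      finally show "(\<Sum>j\<in>{j. (n, j) \<in> T}. ?g n j) \<le> ?b n" .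
    qed
    also have "\<dots> \<le> (\<Sum>n. ?b n)" using T(1) by (intro sum_le_suminf) auto
    finally show "(\<Sum>x\<in>T. emeasure M (ball (case x of (n, j) \<Rightarrow> c n j) (case x of (n, j) \<Rightarrow> r n j)) / ennreal (case x of (n, j) \<Rightarrow> r n j)) \<le> (\<Sum>n. ?b n)" .
  qed (use \<delta> in auto)
  also have "\<dots> = (\<Sum>n. coH1_delta M \<delta>' (A n)) + (\<Sum>n. ennreal (e * (1/2)^Suc n))"
    by (intro suminf_add[symmetric]) auto
  also have "(\<Sum>n. ennreal (e * (1/2)^Suc n)) = ennreal e"
  proof (rule suminf_ennreal_eq)
    show "(\<lambda>n. e * (1/2)^Suc n) sums e" using sums_mult[OF power_half_series, of e] by simp
  qed (use e in simp)
  finally show "coH1_delta M \<delta> (\<Union>n. A n) \<le> (\<Sum>n. coH1_delta M \<delta>' (A n)) + ennreal e" .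
qed

lemma coH1_delta_le_coH1: "0 < \<delta> \<Longrightarrow> coH1_delta M \<delta> A \<le> coH1 M A"
  unfolding coH1_def by (intro SUP_upper) auto

lemma coH1_mono: "A \<subseteq> B \<Longrightarrow> coH1 M A \<le> coH1 M B"
  unfolding coH1_def by (intro SUP_mono) (auto intro: coH1_delta_mono)

lemma coH1_UN_null:
  assumes "\<And>n::nat. coH1 M (A n) = 0" shows "coH1 M (\<Union>n. A n) = 0"
proof -
  have "coH1_delta M \<delta> (\<Union>n. A n) \<le> 0" if "\<delta> > 0" for \<delta>
  proof -
    have "coH1_delta M \<delta> (\<Union>n. A n) \<le> (\<Sum>n. coH1_delta M (\<delta>/2) (A n))"
      using that by (intro coH1_delta_UN_le) auto
    also have "\<dots> \<le> (\<Sum>n. coH1 M (A n))"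
      using that by (intro suminf_le coH1_delta_le_coH1) auto
    finally show ?thesis using assms by simp
  qed
  then have "coH1 M (\<Union>n. A n) \<le> 0" unfolding coH1_def by (intro SUP_least) auto
  then show ?thesis by simp
qed

lemma coH1_delta_Un_le:
  assumes "0 < \<delta>'" "\<delta>' < \<delta>"
  shows "coH1_delta M \<delta> (A \<union> B) \<le> coH1_delta M \<delta>' A + coH1_delta M \<delta>' B"
proof -
  let ?A = "\<lambda>n::nat. if n = 0 then A else if n = 1 then B else {}"
  have "coH1_delta M \<delta>' {} \<le> 0"
    by (rule coH1_delta_le[of "{}" "\<lambda>_::nat. 1" "0" \<delta>' "{}" "\<lambda>_. undefined"]) (use assms in auto)
  then have "(\<Sum>n. coH1_delta M \<delta>' (?A n)) = (\<Sum>n\<in>{0,1}. coH1_delta M \<delta>' (?A n))"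
    by (intro suminf_finite) auto
  moreover have "(\<Union>n. ?A n) = A \<union> B"
    by (auto split: if_splits)
  ultimately show ?thesis using coH1_delta_UN_le[OF assms, of M ?A] by simp
qed

section \<open>Hausdorff content bounded by perimeter\<close>

context doubling_poincare
begin

text \<open>Dilation cost of Vitali's lemma times the Poincare constant; the isoperimetric density
  \<open>\<theta>\<close> enters separately as a divisor.\<close>

definition cover_const :: real where
  "cover_const = C ^ (LEAST n. 5 * L \<le> 2 ^ n) * P"

lemma cover_const_nonneg: "0 \<le> cover_const"
  using C_ge_1 P_ge_1 by (simp add: cover_const_def)

text \<open>The hypothesis bounds measure over radius of each ball by the variation in its
  \<open>L\<close>-dilation. Vitali's lemma is applied to these dilated balls, so that their
  variations add up inside \<open>U\<close>.\<close>

lemma coH1_delta_le_perimeter: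
  assumes U: "open U" and B: "bounded B" and \<theta>: "0 < \<theta>" and R: "5 * L * R < \<delta>" "0 < R"
    and balls: "\<And>x. x \<in> B \<Longrightarrow> \<exists>r. 0 < r \<and> r \<le> R \<and> ball x (L * r) \<subseteq> U \<and>
      ennreal (\<theta> * measure M (ball x r)) \<le> ennreal (P * r) * total_variation M f (ball x (L * r))"
  shows "coH1_delta M \<delta> B \<le> ennreal (cover_const / \<theta>) * total_variation M f U"
proof -
  obtain r where r: "\<And>x. x \<in> B \<Longrightarrow> 0 < r x" "\<And>x. x \<in> B \<Longrightarrow> r x \<le> R" "\<And>x. x \<in> B \<Longrightarrow> ball x (L * r x) \<subseteq> U"
    "\<And>x. x \<in> B \<Longrightarrow> ennreal (\<theta> * measure M (ball x (r x))) \<le> ennreal (P * r x) * total_variation M f (ball x (L * r x))"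
    using balls by metis
  have Lr: "0 < L * r x" "L * r x \<le> L * R" if "x \<in> B" for x
    using r(1,2)[OF that] L_ge_1 by (auto intro: mult_left_mono)
  obtain S where S: "countable S" "S \<subseteq> B" "disjoint_family_on (\<lambda>x. ball x (L * r x)) S"
    "B \<subseteq> (\<Union>x\<in>S. ball x (5 * (L * r x)))"
    using Lr by (rule vitali_covering[OF B, of "\<lambda>x. L * r x" "L * R"])
  have one: "emeasure M (ball x (5 * (L * r x))) / ennreal (5 * (L * r x)) \<le> ennreal (cover_const / \<theta>) * total_variation M f (ball x (L * r x))"
    if "x \<in> S" for x
  proof -
    have x: "x \<in> B" using that S by auto
    have rx: "0 < r x" by (rule r(1)[OF x])
    define c where "c = C ^ (LEAST n. 5 * L \<le> 2 ^ n)"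
    have c: "0 \<le> c" using C_ge_1 by (simp add: c_def)
    let ?V = "total_variation M f (ball x (L * r x))"
    have "emeasure M (ball x (5 * (L * r x))) / ennreal (5 * (L * r x))
        = ennreal (measure M (ball x (5 * (L * r x))) / (5 * (L * r x)))"
      unfolding emeasure_ball using Lr[OF x] by (intro divide_ennreal) auto
    also have "\<dots> \<le> ennreal (c / (\<theta> * r x) * (\<theta> * measure M (ball x (r x))))"
    proof (rule ennreal_leI)
      have "1 * r x \<le> L * r x" using L_ge_1 rx by (intro mult_right_mono) auto
      then have "r x \<le> 5 * (L * r x)" using rx by linarith
      then have "measure M (ball x (5 * (L * r x))) / (5 * (L * r x)) \<le> measure M (ball x (5 * (L * r x))) / r x"
        using rx by (intro divide_left_mono) auto
      also have "\<dots> \<le> c * measure M (ball x (r x)) / r x"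
        unfolding c_def using rx by (intro divide_right_mono measure_dilate) auto
      finally show "measure M (ball x (5 * (L * r x))) / (5 * (L * r x)) \<le> c / (\<theta> * r x) * (\<theta> * measure M (ball x (r x)))"
        using \<theta> by simp
    qed
    also have "\<dots> = ennreal (c / (\<theta> * r x)) * ennreal (\<theta> * measure M (ball x (r x)))"
      using \<theta> rx c by (intro ennreal_mult) auto
    also have "\<dots> \<le> ennreal (c / (\<theta> * r x)) * (ennreal (P * r x) * ?V)"
      by (intro mult_left_mono r(4) x) simp
    also have "\<dots> = ennreal (c / (\<theta> * r x) * (P * r x)) * ?V"
      using \<theta> rx c P_ge_1 by (subst ennreal_mult) (auto simp: mult.assoc)
    also have "c / (\<theta> * r x) * (P * r x) = cover_const / \<theta>" using \<theta> rx by (simp add: cover_const_def c_def)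
    finally show ?thesis .
  qed
  show ?thesis
  proof (rule coH1_delta_le[of S "\<lambda>x. 5 * (L * r x)" "5 * L * R" _ _ "\<lambda>x. x"])
    show "0 < 5 * (L * r x)" "5 * (L * r x) \<le> 5 * L * R" if "x \<in> S" for x
      using Lr[of x] that S(2) by auto
    show "0 < \<delta>" using R L_ge_1 mult_pos_pos[of "5 * L" R] by linarith
    fix T assume T: "finite T" "T \<subseteq> S"
    have "(\<Sum>x\<in>T. emeasure M (ball x (5 * (L * r x))) / ennreal (5 * (L * r x)))
        \<le> (\<Sum>x\<in>T. ennreal (cover_const / \<theta>) * total_variation M f (ball x (L * r x)))"
      using one T by (intro sum_mono) auto
    also have "\<dots> = ennreal (cover_const / \<theta>) * (\<Sum>x\<in>T. total_variation M f (ball x (L * r x)))"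
      by (simp add: sum_distrib_left)
    also have "\<dots> \<le> ennreal (cover_const / \<theta>) * total_variation M f U"
    proof (intro mult_left_mono total_variation_superadditive disjoint_family_on_mono[OF T(2) S(3)] T)
      fix x assume "x \<in> T"
      then show "ball x (L * r x) \<subseteq> U" using T S by (intro r(3)) auto
    qed auto
    finally show "(\<Sum>x\<in>T. emeasure M (ball x (5 * (L * r x))) / ennreal (5 * (L * r x))) \<le> ennreal (cover_const / \<theta>) * total_variation M f U" .
  qed (use S R in auto)
qed

lemma boxing_const_small: "\<exists>k. boxing_const k \<le> 1 / 2"
proof -
  define c where "c = C ^ (LEAST n. 5 * L \<le> 2 ^ n) * (2 * C * P)"
  obtain k :: nat where "2 * c < 2 ^ k" using real_arch_pow[of 2] by auto
  then have "c / 2 ^ k \<le> 1 / 2" by (simp add: field_simps)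
  then show ?thesis by (auto simp: boxing_const_def c_def)
qed

definition boxing_scale :: nat where "boxing_scale = (LEAST k. boxing_const k \<le> 1 / 2)"

text \<open>Chosen so that \<open>low_density * C ^ (boxing_scale + 3)\<close> is 1/4, below the 1/2
  that boxing demands at a scale whose constant is at most 1/2.\<close>

definition low_density :: real where "low_density = 1 / (4 * C ^ (boxing_scale + 3))"

lemma boxing_scale: "boxing_const boxing_scale \<le> 1 / 2"
  unfolding boxing_scale_def using boxing_const_small by (rule LeastI_ex)

lemma low_density: "0 < low_density" "low_density * C ^ (boxing_scale + 3) \<le> 1 / 2" "low_density \<le> 1 / 4"
proof -
  have "0 < C ^ (boxing_scale + 3)" "1 \<le> C ^ (boxing_scale + 3)" using C_ge_1 by (auto intro: one_le_power)
  then show "0 < low_density" "low_density * C ^ (boxing_scale + 3) \<le> 1 / 2" "low_density \<le> 1 / 4"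
    by (auto simp: low_density_def field_simps)
qed

text \<open>Makes the failure quantitative with a countable parameter, so that such points split
  into countably many sets with a uniform lower bound.\<close>

lemma not_has_density_0D:
  assumes "\<not> has_density M E x 0"
  obtains n where "\<And>\<rho>. 0 < \<rho> \<Longrightarrow> \<exists>r. 0 < r \<and> r < \<rho> \<and> 1 / real (Suc n) * measure M (ball x r) \<le> measure M (E \<inter> ball x r)"
proof -
  let ?q = "\<lambda>r. measure M (E \<inter> ball x r) / measure M (ball x r)"
  have "\<not> (\<forall>e>0. eventually (\<lambda>r. dist (?q r) 0 < e) (at_right 0))"
    using assms unfolding has_density_def tendsto_iff by simp
  then obtain e where e: "e > 0" "\<not> eventually (\<lambda>r. dist (?q r) 0 < e) (at_right 0)" by blast
  obtain n where n: "1 / real (Suc n) < e" using e(1) nat_approx_posE by blast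
  show thesis
  proof (rule that[of n])
    fix \<rho> :: real assume \<rho>: "0 < \<rho>"
    have "\<exists>r. 0 < r \<and> r < \<rho> \<and> \<not> dist (?q r) 0 < e"
    proof (rule ccontr)
      assume "\<not> ?thesis"
      then have "\<forall>y>0. y < \<rho> \<longrightarrow> dist (?q y) 0 < e" by blast
      then show False using e(2) \<rho> unfolding eventually_at_right_field by blast
    qed
    then obtain r where r: "0 < r" "r < \<rho>" "e \<le> ?q r" by (auto simp: not_less)
    have "1 / real (Suc n) \<le> ?q r" using n r by linarith
    then have "1 / real (Suc n) * measure M (ball x r) \<le> measure M (E \<inter> ball x r)"
      using measure_ball_pos[OF r(1), of x] by (simp only: pos_le_divide_eq)
    then show "\<exists>r. 0 < r \<and> r < \<rho> \<and> 1 / real (Suc n) * measure M (ball x r) \<le> measure M (E \<inter> ball x r)"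
      using r by blast
  qed
qed

text \<open>On each piece \<open>B m\<close> the radius and the lower density bound
  \<open>1 / real (Suc m)\<close> are uniform. The resulting covering constant grows with
  \<open>m\<close>, but for fixed \<open>m\<close> the perimeter of a neighbourhood of
  \<open>B m\<close> can be made arbitrarily small, so each piece has content 0.\<close>

lemma coH1_low_density_null:
  assumes E: "E \<in> sets M" and \<Omega>: "open \<Omega>" and fin: "perimeter E \<Omega> < \<infinity>"
  shows "coH1 M {x\<in>\<Omega>. (\<exists>\<rho>>0. \<forall>r. 0 < r \<and> r < \<rho> \<longrightarrow> measure M (E \<inter> ball x r) \<le> low_density * measure M (ball x r))
     \<and> \<not> has_density M E x 0} = 0"
proof -
  define B where "B = (\<lambda>m. {x \<in> exhaust \<Omega> m.
      (\<forall>r. 0 < r \<and> r < 1 / real (Suc m) \<longrightarrow> measure M (E \<inter> ball x r) \<le> low_density * measure M (ball x r)) \<and>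
      (\<forall>\<rho>>0. \<exists>r. 0 < r \<and> r < \<rho> \<and> 1 / real (Suc m) * measure M (ball x r) \<le> measure M (E \<inter> ball x r))})"
  have null: "coH1 M (B m) = 0" for m
  proof -
    define \<rho>0 where "\<rho>0 = 1 / real (Suc m) - 1 / real (Suc (Suc m))"
    have \<rho>0: "0 < \<rho>0" "\<rho>0 \<le> 1 / real (Suc m)" using exhaust_radius_pos[of m] by (auto simp: \<rho>0_def)
    have Bb: "bounded (B m)"
      using compact_imp_bounded[OF compact_exhaust[of \<Omega> m]] by (rule bounded_subset) (auto simp: B_def)
    have sub: "ball x \<rho>0 \<subseteq> \<Omega>" if "x \<in> B m" for x
    proof
      fix y assume y: "y \<in> ball x \<rho>0"
      have "x \<in> exhaust \<Omega> m" using that by (simp add: B_def)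
      then have "y \<in> exhaust \<Omega> (Suc m)" by (rule exhaust_nbhd) (use y in \<open>simp add: \<rho>0_def\<close>)
      then show "y \<in> \<Omega>" using exhaust_subset by blast
    qed
    have dens: "measure M (E \<inter> ball x r) \<le> low_density * measure M (ball x r)" if "x \<in> B m" "0 < r" "r < \<rho>0" for x r
      using that \<rho>0(2) by (simp add: B_def)
    \<comment> \<open>The cap 1/2 matters for \<open>m = 0\<close>: it ensures
      \<open>low_density \<le> 1 - \<theta>\<close>, the upper density bound of the isoperimetric
      inequality.\<close>
    define \<theta> where "\<theta> = min (1 / real (Suc m)) (1/2)"
    have \<theta>: "0 < \<theta>" "\<theta> \<le> 1 / real (Suc m)" "\<theta> \<le> 1/2" by (auto simp: \<theta>_def)
    have "coH1_delta M \<delta> (B m) \<le> ennreal (cover_const / \<theta>) * ennreal \<epsilon>" if \<delta>: "0 < \<delta>" and \<epsilon>: "0 < \<epsilon>" for \<delta> \<epsilon>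
    proof -
      obtain \<rho> where \<rho>: "0 < \<rho>" "\<rho> < \<rho>0" "perimeter E (\<Union>x\<in>B m. ball x \<rho>) \<le> ennreal \<epsilon>"
        using perimeter_vanishes_at_low_density[OF E \<Omega> fin Bb \<rho>0(1) sub dens less_imp_le[OF low_density(1)] low_density(2) boxing_scale \<epsilon>]
        by blast
      define R where "R = min (\<rho> / (4 * L)) (\<delta> / (10 * L))"
      have R: "0 < R" "R \<le> \<rho> / (4 * L)" "R \<le> \<delta> / (10 * L)" using \<rho> \<delta> L_ge_1 by (auto simp: R_def)
      have "coH1_delta M \<delta> (B m) \<le> ennreal (cover_const / \<theta>) * perimeter E (\<Union>x\<in>B m. ball x \<rho>)"
      proof (rule coH1_delta_le_perimeter[OF _ Bb \<theta>(1) _ R(1)])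
        show "open (\<Union>x\<in>B m. ball x \<rho>)" by auto
        have "10 * L * R \<le> \<delta>" using R(3) L_ge_1 by (simp add: field_simps)
        moreover have "0 < 5 * L * R" using L_ge_1 R(1) by simp
        ultimately show "5 * L * R < \<delta>" by linarith
        fix x assume x: "x \<in> B m"
        have "0 < min R \<rho>0" using R \<rho>0 by simp
        then obtain r where r: "0 < r" "r < min R \<rho>0" "1 / real (Suc m) * measure M (ball x r) \<le> measure M (E \<inter> ball x r)"
          using x unfolding B_def by blast
        have hi: "measure M (E \<inter> ball x r) \<le> low_density * measure M (ball x r)"
          using r by (intro dens x) auto
        have "4 * L * r \<le> 4 * L * R" using r L_ge_1 by (intro mult_left_mono) auto
        also have "\<dots> \<le> \<rho>" using R(2) L_ge_1 by (simp add: field_simps)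
        finally have Lr: "4 * (L * r) \<le> \<rho>" by simp
        have Lrp: "0 < L * r" using L_ge_1 r by simp
        have "cball x (2 * L * r) \<subseteq> ball x \<rho>0"
        proof
          fix y assume "y \<in> cball x (2 * L * r)"
          then have "dist x y \<le> 2 * (L * r)" by simp
          then show "y \<in> ball x \<rho>0" using Lr Lrp \<rho> by simp
        qed
        then have sub': "cball x (2 * L * r) \<subseteq> \<Omega>" using sub[OF x] by blast
        have lo: "\<theta> * measure M (ball x r) \<le> measure M (E \<inter> ball x r)"
          using r(3) mult_right_mono[OF \<theta>(2), of "measure M (ball x r)"] by simp
        have "low_density \<le> 1 - \<theta>" using low_density(3) \<theta> by linarith
        then have hi': "measure M (E \<inter> ball x r) \<le> (1 - \<theta>) * measure M (ball x r)"
          using hi mult_right_mono[of low_density "1 - \<theta>" "measure M (ball x r)"] by simp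
        have "ball x (L * r) \<subseteq> (\<Union>x\<in>B m. ball x \<rho>)"
        proof -
          have "ball x (L * r) \<subseteq> ball x \<rho>" using Lr Lrp by (intro subset_ball) linarith
          then show ?thesis using x by blast
        qed
        then show "\<exists>r>0. r \<le> R \<and> ball x (L * r) \<subseteq> (\<Union>x\<in>B m. ball x \<rho>) \<and>
          ennreal (\<theta> * measure M (ball x r)) \<le> ennreal (P * r) * perimeter E (ball x (L * r))"
          using relative_isoperimetric[OF E \<Omega> fin r(1) sub' less_imp_le[OF \<theta>(1)] lo hi'] r by (intro exI[of _ r]) auto
      qed
      also have "\<dots> \<le> ennreal (cover_const / \<theta>) * ennreal \<epsilon>" by (intro mult_left_mono \<rho>(3)) simp
      finally show ?thesis .
    qed
    note key = this
    have "coH1_delta M \<delta> (B m) \<le> 0" if \<delta>: "0 < \<delta>" for \<delta>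
    proof (rule ennreal_le_epsilon)
      fix e :: real assume e: "0 < e"
      define \<epsilon> where "\<epsilon> = e / (cover_const / \<theta> + 1)"
      have c0: "0 \<le> cover_const / \<theta>" using cover_const_nonneg \<theta> by simp
      then have "0 < \<epsilon>" using e by (simp add: \<epsilon>_def)
      from key[OF \<delta> this] have "coH1_delta M \<delta> (B m) \<le> ennreal (cover_const / \<theta> * \<epsilon>)"
        using ennreal_mult[OF c0 less_imp_le[OF \<open>0 < \<epsilon>\<close>]] by (simp only:)
      also have "\<dots> \<le> ennreal e"
      proof (rule ennreal_leI)
        have "cover_const / \<theta> * \<epsilon> \<le> (cover_const / \<theta> + 1) * \<epsilon>" using \<open>0 < \<epsilon>\<close> by (intro mult_right_mono) auto
        also have "\<dots> = e" unfolding \<epsilon>_def times_divide_eq_right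
          by (rule nonzero_mult_div_cancel_left) (use c0 in linarith)
        finally show "cover_const / \<theta> * \<epsilon> \<le> e" .
      qed
      finally show "coH1_delta M \<delta> (B m) \<le> 0 + ennreal e" by simp
    qed
    then have "coH1 M (B m) \<le> 0" unfolding coH1_def by (intro SUP_least) auto
    then show ?thesis by simp
  qed
  have "{x\<in>\<Omega>. (\<exists>\<rho>>0. \<forall>r. 0 < r \<and> r < \<rho> \<longrightarrow> measure M (E \<inter> ball x r) \<le> low_density * measure M (ball x r))
     \<and> \<not> has_density M E x 0} \<subseteq> (\<Union>m. B m)"
  proof safe
    fix x \<rho> assume x: "x \<in> \<Omega>" "\<not> has_density M E x 0" and \<rho>: "0 < \<rho>"
      "\<forall>r. 0 < r \<and> r < \<rho> \<longrightarrow> measure M (E \<inter> ball x r) \<le> low_density * measure M (ball x r)"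
    obtain n1 where n1: "\<And>\<rho>. 0 < \<rho> \<Longrightarrow> \<exists>r. 0 < r \<and> r < \<rho> \<and> 1 / real (Suc n1) * measure M (ball x r) \<le> measure M (E \<inter> ball x r)"
      using not_has_density_0D[OF x(2)] by blast
    obtain n2 where n2: "1 / real (Suc n2) < \<rho>" using \<rho>(1) nat_approx_posE by blast
    obtain n3 where n3: "\<And>n. n \<ge> n3 \<Longrightarrow> x \<in> exhaust \<Omega> n"
      using eventually_in_exhaust[OF \<Omega> x(1)] by (auto simp: eventually_sequentially)
    define m where "m = max n1 (max n2 n3)"
    have m: "n1 \<le> m" "n2 \<le> m" "n3 \<le> m" by (auto simp: m_def)
    have "x \<in> B m" unfolding B_def
    proof (intro CollectI conjI allI impI)
      show "x \<in> exhaust \<Omega> m" using n3 m by blast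
      fix r assume "0 < r \<and> r < 1 / real (Suc m)"
      moreover have "1 / real (Suc m) \<le> 1 / real (Suc n2)" using m by (intro divide_left_mono) auto
      ultimately show "measure M (E \<inter> ball x r) \<le> low_density * measure M (ball x r)" using \<rho>(2) n2 by auto
    next
      fix \<rho> :: real assume "0 < \<rho>"
      then obtain r where r: "0 < r" "r < \<rho>" "1 / real (Suc n1) * measure M (ball x r) \<le> measure M (E \<inter> ball x r)" using n1 by blast
      have "1 / real (Suc m) \<le> 1 / real (Suc n1)" using m by (intro divide_left_mono) auto
      then have "1 / real (Suc m) * measure M (ball x r) \<le> 1 / real (Suc n1) * measure M (ball x r)" by (intro mult_right_mono) auto
      then show "\<exists>r. 0 < r \<and> r < \<rho> \<and> 1 / real (Suc m) * measure M (ball x r) \<le> measure M (E \<inter> ball x r)" using r by force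
    qed
    then show "x \<in> (\<Union>m. B m)" by blast
  qed
  then have "coH1 M {x\<in>\<Omega>. (\<exists>\<rho>>0. \<forall>r. 0 < r \<and> r < \<rho> \<longrightarrow> measure M (E \<inter> ball x r) \<le> low_density * measure M (ball x r))
     \<and> \<not> has_density M E x 0} \<le> coH1 M (\<Union>m. B m)" by (rule coH1_mono)
  also have "\<dots> = 0" by (rule coH1_UN_null) (rule null)
  finally show ?thesis by simp
qed

end

section \<open>Coarea inequality\<close>

lemma suminf_ennreal_tendsto_0:
  fixes f :: "nat \<Rightarrow> ennreal"
  assumes "suminf f \<noteq> top" shows "f \<longlonglongrightarrow> 0"
proof -
  have "f n < top" for n using assms ennreal_suminf_lessD[of f top n] by (simp add: less_top)
  then have f: "f = (\<lambda>n. ennreal (enn2real (f n)))" by auto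
  then have "(\<Sum>n. ennreal (enn2real (f n))) \<noteq> top" using assms by simp
  then have "summable (\<lambda>n. enn2real (f n))" by (intro summable_suminf_not_top) auto
  then have "(\<lambda>n. enn2real (f n)) \<longlonglongrightarrow> 0" by (rule summable_LIMSEQ_zero)
  then have "(\<lambda>n. ennreal (enn2real (f n))) \<longlonglongrightarrow> ennreal 0" by (rule tendsto_ennrealI)
  then show ?thesis using f by simp
qed

text \<open>Lipschitz substitute for the indicator of the positive reals; composed with
  \<open>v - s\<close> it yields competitors for the superlevel set at level
  \<open>s\<close>.\<close>

definition ramp :: "real \<Rightarrow> real \<Rightarrow> real" where
  "ramp \<epsilon> x = max 0 (min 1 (x / \<epsilon>))"

lemma ramp_bounds: "0 \<le> ramp \<epsilon> x" "ramp \<epsilon> x \<le> 1"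
  by (auto simp: ramp_def)

lemma ramp_eq_0: "0 < \<epsilon> \<Longrightarrow> x \<le> 0 \<Longrightarrow> ramp \<epsilon> x = 0"
  by (simp add: ramp_def divide_nonpos_pos)

lemma ramp_eq_1: "0 < \<epsilon> \<Longrightarrow> \<epsilon> \<le> x \<Longrightarrow> ramp \<epsilon> x = 1"
  by (simp add: ramp_def)

lemma ramp_lipschitz:
  assumes "0 < \<epsilon>" shows "\<bar>ramp \<epsilon> x - ramp \<epsilon> y\<bar> \<le> 1 / \<epsilon> * \<bar>x - y\<bar>"
proof -
  have "\<bar>ramp \<epsilon> x - ramp \<epsilon> y\<bar> \<le> \<bar>x / \<epsilon> - y / \<epsilon>\<bar>" by (auto simp: ramp_def)
  also have "\<dots> = 1 / \<epsilon> * \<bar>x - y\<bar>" using assms by (simp add: abs_divide flip: diff_divide_distrib)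
  finally show ?thesis .
qed

lemma ramp_measurable [measurable]: "ramp \<epsilon> \<in> borel_measurable borel"
  unfolding ramp_def[abs_def] by measurable

text \<open>As functions of the level \<open>s\<close>, both terms are 1 far to the left and 0 far
  to the right. They differ, by at most 1, only on an interval of length at most
  \<open>\<epsilon> + \<bar>v - u\<bar>\<close>.\<close>

lemma nn_integral_ramp_diff_le:
  assumes \<epsilon>: "0 < \<epsilon>"
  shows "(\<integral>\<^sup>+s. ennreal \<bar>ramp \<epsilon> (v - s) - of_bool (s < u)\<bar> \<partial>lborel) \<le> ennreal (\<epsilon> + \<bar>v - u\<bar>)"
proof -
  let ?a = "min (v - \<epsilon>) u" and ?b = "max v u"
  have "(\<integral>\<^sup>+s. ennreal \<bar>ramp \<epsilon> (v - s) - of_bool (s < u)\<bar> \<partial>lborel) \<le> (\<integral>\<^sup>+s. indicator {?a..?b} s \<partial>lborel)"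
  proof (rule nn_integral_mono)
    fix s
    show "ennreal \<bar>ramp \<epsilon> (v - s) - of_bool (s < u)\<bar> \<le> indicator {?a..?b} s"
    proof (cases "s \<in> {?a..?b}")
      case True
      have "\<bar>ramp \<epsilon> (v - s) - of_bool (s < u)\<bar> \<le> 1" using ramp_bounds[of \<epsilon> "v - s"] by auto
      then show ?thesis using True ennreal_leI[of _ 1] by simp
    next
      case False
      then consider "s < v - \<epsilon>" "s < u" | "v < s" "u < s" by fastforce
      then have "ramp \<epsilon> (v - s) - of_bool (s < u) = 0"
        by cases (use \<epsilon> in \<open>auto simp: ramp_eq_0 ramp_eq_1\<close>)
      then show ?thesis by simp
    qed
  qed
  also have "\<dots> = ennreal (?b - ?a)" using \<epsilon> by simp
  also have "\<dots> \<le> ennreal (\<epsilon> + \<bar>v - u\<bar>)" using \<epsilon> by (intro ennreal_leI) auto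
  finally show ?thesis .
qed

context doubling_poincare
begin

text \<open>Outside the closed band the composition is locally constant, by continuity of
  \<open>v\<close>; on the band the Lipschitz constant \<open>1 / \<epsilon>\<close> of the ramp
  applies.\<close>

lemma lip_slope_ramp_le:
  assumes \<Omega>: "open \<Omega>" and v: "continuous_on \<Omega> v" and y: "y \<in> \<Omega>" and \<epsilon>: "0 < \<epsilon>"
  shows "lip_slope (\<lambda>y. ramp \<epsilon> (v y - s)) y \<le> ennreal (1 / \<epsilon>) * lip_slope v y * indicator {s..s + \<epsilon>} (v y)"
proof -
  have nbhd: "\<exists>e>0. \<forall>z\<in>ball y e. v z \<in> W" if W: "open W" "v y \<in> W" for W
  proof -
    have "open (v -` W \<inter> \<Omega>)" using continuous_on_open_vimage[OF \<Omega>] v W(1) by metis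
    then obtain e where "e > 0" "ball y e \<subseteq> v -` W \<inter> \<Omega>" using y W(2) by (metis IntI open_contains_ball vimageI)
    then show ?thesis by blast
  qed
  consider "v y < s" | "s + \<epsilon> < v y" | "v y \<in> {s..s + \<epsilon>}" by fastforce
  then show ?thesis
  proof cases
    case 1
    then obtain e where e: "e > 0" "\<And>z. z \<in> ball y e \<Longrightarrow> v z \<in> {..<s}" using nbhd[of "{..<s}"] by auto
    have "lip_slope (\<lambda>y. ramp \<epsilon> (v y - s)) y = 0"
    proof (rule lip_slope_locally_const[OF e(1)])
      fix z assume "z \<in> ball y e"
      then have "v z < s" using e(2) by blast
      then show "ramp \<epsilon> (v z - s) = ramp \<epsilon> (v y - s)" using 1 \<epsilon> by (simp add: ramp_eq_0)
    qed
    then show ?thesis by simp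
  next
    case 2
    then obtain e where e: "e > 0" "\<And>z. z \<in> ball y e \<Longrightarrow> v z \<in> {s + \<epsilon><..}" using nbhd[of "{s + \<epsilon><..}"] by auto
    have "lip_slope (\<lambda>y. ramp \<epsilon> (v y - s)) y = 0"
    proof (rule lip_slope_locally_const[OF e(1)])
      fix z assume "z \<in> ball y e"
      then have "s + \<epsilon> < v z" using e(2) by blast
      then show "ramp \<epsilon> (v z - s) = ramp \<epsilon> (v y - s)" using 2 \<epsilon> by (simp add: ramp_eq_1)
    qed
    then show ?thesis by simp
  next
    case 3
    have "lip_slope (\<lambda>y. ramp \<epsilon> (v y - s)) y \<le> ennreal (1 / \<epsilon>) * lip_slope v y + ennreal 0"
    proof (rule lip_slope_affine_le[of 1])
      fix z
      show "\<bar>ramp \<epsilon> (v z - s) - ramp \<epsilon> (v y - s)\<bar> \<le> 1 / \<epsilon> * \<bar>v z - v y\<bar> + 0 * dist y z"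
        using ramp_lipschitz[OF \<epsilon>, of "v z - s" "v y - s"] by simp
    qed (use \<epsilon> in auto)
    then show ?thesis using 3 by simp
  qed
qed

text \<open>Ramps of a near-optimal sequence for \<open>u\<close> compete for the superlevel sets.
  By Fubini in the level \<open>s\<close>, their distances to the indicators have a finite sum for
  almost every \<open>s\<close>, and their energies integrate to at most \<open>b\<close>, so
  Fatou's lemma makes the limit inferior finite for almost every \<open>s\<close>.\<close>

lemma AE_finite_perimeter:
  assumes \<Omega>: "open \<Omega>" and u: "u \<in> BV M \<Omega>"
  shows "AE s in lborel. perimeter {y\<in>\<Omega>. s < u y} \<Omega> < \<infinity>"
proof -
  interpret M: sigma_finite_measure M by (rule sigma_finite_M)
  interpret pair_sigma_finite lborel M ..
  have u1: "u \<in> L1_loc M \<Omega>" and u2: "total_variation M u \<Omega> < \<infinity>" using u by (auto simp: BV_def)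
  have [measurable]: "\<Omega> \<in> sets M" using \<Omega> by (rule open_sets)
  define um where "um = (\<lambda>y. u y * indicator \<Omega> y)"
  have [measurable]: "um \<in> borel_measurable M" unfolding um_def by (rule L1_loc_measurable[OF \<Omega> u1])
  obtain b where b: "total_variation M u \<Omega> < b" "b < \<infinity>" using dense[OF u2] by blast
  obtain w where w: "\<And>i. w i \<in> Lip_loc \<Omega>" "converges_L1_loc M \<Omega> w u"
      "\<And>i. energy M \<Omega> (w i) < b"
    using total_variation_approx[OF b(1)] by blast
  define K where "K = exhaust \<Omega>"
  have K: "compact (K k)" "K k \<subseteq> \<Omega>" for k
    unfolding K_def by (rule compact_exhaust, rule exhaust_subset)
  have Km[measurable]: "K k \<in> sets M" for k using K(1) by (intro closed_sets compact_imp_closed)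
  \<comment> \<open>The geometric rate makes the distances summable, hence convergent to 0 at almost
    every level for one and the same sequence.\<close>
  have "\<exists>i. L1_dist M (K k) (w i) u < ennreal ((1/2)^k)" for k
  proof -
    have "(\<lambda>i. L1_dist M (K k) (w i) u) \<longlonglongrightarrow> 0" by (rule converges_L1_locD[OF w(2) K])
    then have "eventually (\<lambda>i. L1_dist M (K k) (w i) u < ennreal ((1/2)^k)) sequentially"
      by (rule order_tendstoD(2)) simp
    then show ?thesis unfolding eventually_sequentially by blast
  qed
  then obtain i where i: "\<And>k. L1_dist M (K k) (w (i k)) u < ennreal ((1/2)^k)" by metis
  define v where "v = (\<lambda>k. w (i k))"
  have v: "\<And>k. v k \<in> Lip_loc \<Omega>" "\<And>k. energy M \<Omega> (v k) < b"
    "\<And>k. L1_dist M (K k) (v k) u < ennreal ((1/2)^k)"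
    using w i by (auto simp: v_def)
  have vc: "continuous_on \<Omega> (v k)" for k by (rule Lip_loc_imp_continuous_on[OF \<Omega> v(1)])
  define vm where "vm = (\<lambda>k y. v k y * indicator \<Omega> y)"
  have [measurable]: "vm k \<in> borel_measurable M" for k unfolding vm_def by (rule Lip_loc_measurable[OF \<Omega> v(1)])
  \<comment> \<open>The ramp width contributes \<open>\<epsilon> k\<close> times the measure of
    \<open>K k\<close>, which must be summable too; the added 1 keeps the denominator
    positive.\<close>
  define \<epsilon> where "\<epsilon> = (\<lambda>k. (1/2)^k / (1 + measure M (K k)))"
  have \<epsilon>: "0 < \<epsilon> k" for k unfolding \<epsilon>_def by (intro divide_pos_pos) (auto simp: add_pos_nonneg)
  have \<epsilon>K: "ennreal (\<epsilon> k) * emeasure M (K k) \<le> ennreal ((1/2)^k)" for k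
  proof -
    have "K k \<in> fmeasurable M" using K by (intro bounded_fmeasurable compact_imp_bounded Km)
    then have "ennreal (\<epsilon> k) * emeasure M (K k) = ennreal (\<epsilon> k * measure M (K k))"
      using \<epsilon>[of k] by (simp add: emeasure_eq_measure2 ennreal_mult less_imp_le)
    also have "\<dots> \<le> ennreal (\<epsilon> k * (1 + measure M (K k)))"
      using \<epsilon>[of k] by (intro ennreal_leI mult_left_mono) auto
    also have "\<epsilon> k * (1 + measure M (K k)) = (1/2)^k"
      unfolding \<epsilon>_def using measure_nonneg[of M "K k"] by (intro nonzero_eq_divide_eq[THEN iffD1, OF _ refl]) linarith
    finally show ?thesis .
  qed
  define F where "F = (\<lambda>k s y. ennreal \<bar>ramp (\<epsilon> k) (vm k y - s) - of_bool (s < um y)\<bar> * indicator (K k) y)"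
  define D where "D = (\<lambda>k s. \<integral>\<^sup>+y. F k s y \<partial>M)"
  have Fm[measurable]: "case_prod (F k) \<in> borel_measurable (lborel \<Otimes>\<^sub>M M)" for k
    unfolding F_def by measurable
  have Dm[measurable]: "D k \<in> borel_measurable lborel" for k
    unfolding D_def by measurable
  have Dint: "(\<integral>\<^sup>+s. D k s \<partial>lborel) \<le> ennreal (2 * (1/2)^k)" for k
  proof -
    have "(\<integral>\<^sup>+s. D k s \<partial>lborel) = (\<integral>\<^sup>+y. (\<integral>\<^sup>+s. F k s y \<partial>lborel) \<partial>M)"
      unfolding D_def by (rule Fubini'[symmetric]) (rule Fm)
    also have "\<dots> \<le> (\<integral>\<^sup>+y. (ennreal (\<epsilon> k) * indicator (K k) y + ennreal \<bar>vm k y - um y\<bar> * indicator (K k) y) \<partial>M)"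
    proof (rule nn_integral_mono)
      fix y
      have "(\<integral>\<^sup>+s. F k s y \<partial>lborel) = (\<integral>\<^sup>+s. ennreal \<bar>ramp (\<epsilon> k) (vm k y - s) - of_bool (s < um y)\<bar> \<partial>lborel) * indicator (K k) y"
        unfolding F_def by (rule nn_integral_multc) measurable
      also have "\<dots> \<le> ennreal (\<epsilon> k + \<bar>vm k y - um y\<bar>) * indicator (K k) y"
        by (intro mult_right_mono nn_integral_ramp_diff_le \<epsilon>) simp
      also have "\<dots> = ennreal (\<epsilon> k) * indicator (K k) y + ennreal \<bar>vm k y - um y\<bar> * indicator (K k) y"
        using \<epsilon>[of k] by (simp add: ennreal_plus distrib_right)
      finally show "(\<integral>\<^sup>+s. F k s y \<partial>lborel) \<le> ennreal (\<epsilon> k) * indicator (K k) y + ennreal \<bar>vm k y - um y\<bar> * indicator (K k) y" .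
    qed
    also have "\<dots> = ennreal (\<epsilon> k) * emeasure M (K k) + (\<integral>\<^sup>+y. ennreal \<bar>vm k y - um y\<bar> * indicator (K k) y \<partial>M)"
      by (subst nn_integral_add) (auto simp: nn_integral_cmult_indicator)
    also have "(\<integral>\<^sup>+y. ennreal \<bar>vm k y - um y\<bar> * indicator (K k) y \<partial>M) = L1_dist M (K k) (v k) u"
      using K(2)[of k] by (intro nn_integral_cong) (auto simp: vm_def um_def indicator_def)
    also have "ennreal (\<epsilon> k) * emeasure M (K k) + \<dots> \<le> ennreal ((1/2)^k) + ennreal ((1/2)^k)"
      by (intro add_mono \<epsilon>K less_imp_le v(3))
    also have "\<dots> = ennreal (2 * (1/2)^k)" by (subst ennreal_plus[symmetric]) auto
    finally show ?thesis .
  qed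
  have "(\<integral>\<^sup>+s. (\<Sum>k. D k s) \<partial>lborel) = (\<Sum>k. \<integral>\<^sup>+s. D k s \<partial>lborel)"
    by (rule nn_integral_suminf) measurable
  also have "\<dots> \<le> (\<Sum>k. ennreal (2 * (1/2)^k))" by (intro suminf_le Dint) auto
  also have "\<dots> = ennreal (2 * (1 / (1 - 1/2)))"
    by (intro suminf_ennreal_eq sums_mult geometric_sums) auto
  finally have "(\<integral>\<^sup>+s. (\<Sum>k. D k s) \<partial>lborel) < \<infinity>" by (simp add: le_less_trans)
  then have AE1: "AE s in lborel. (\<Sum>k. D k s) \<noteq> \<infinity>"
    by (intro nn_integral_PInf_AE) auto
  define l where "l = (\<lambda>k y. lip_slope (v k) y * indicator \<Omega> y)"
  \<comment> \<open>A majorant of the slope of the ramp that is measurable in \<open>s\<close> and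
    \<open>y\<close> jointly, as Fubini requires.\<close>
  define G where "G = (\<lambda>k s y. ennreal (1 / \<epsilon> k) * l k y * (of_bool (s \<le> vm k y) * of_bool (vm k y \<le> s + \<epsilon> k)))"
  define H where "H = (\<lambda>k s. \<integral>\<^sup>+y. G k s y \<partial>M)"
  have lm[measurable]: "l k \<in> borel_measurable M" for k
    unfolding l_def by (rule lip_slope_measurable[OF \<Omega> v(1)])
  have Gm[measurable]: "case_prod (G k) \<in> borel_measurable (lborel \<Otimes>\<^sub>M M)" for k
    unfolding G_def by measurable
  have Hm[measurable]: "H k \<in> borel_measurable lborel" for k
    unfolding H_def by measurable
  have Hint: "(\<integral>\<^sup>+s. H k s \<partial>lborel) \<le> b" for k
  proof -
    have "(\<integral>\<^sup>+s. H k s \<partial>lborel) = (\<integral>\<^sup>+y. (\<integral>\<^sup>+s. G k s y \<partial>lborel) \<partial>M)"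
      unfolding H_def by (rule Fubini'[symmetric]) (rule Gm)
    \<comment> \<open>For fixed \<open>y\<close> the levels whose band contains
      \<open>vm k y\<close> form an interval of length \<open>\<epsilon> k\<close>, which cancels
      the factor \<open>1 / \<epsilon> k\<close>.\<close>
    also have "\<dots> = (\<integral>\<^sup>+y. l k y \<partial>M)"
    proof (rule nn_integral_cong)
      fix y
      have "(\<integral>\<^sup>+s. G k s y \<partial>lborel) = (\<integral>\<^sup>+s. ennreal (1 / \<epsilon> k) * l k y * indicator {vm k y - \<epsilon> k..vm k y} s \<partial>lborel)"
        unfolding G_def by (intro nn_integral_cong) (auto simp: indicator_def)
      also have "\<dots> = ennreal (1 / \<epsilon> k) * l k y * ennreal (\<epsilon> k)"
        using \<epsilon>[of k] by (subst nn_integral_cmult_indicator) auto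
      also have "\<dots> = ennreal (1 / \<epsilon> k * \<epsilon> k) * l k y"
        using \<epsilon>[of k] by (subst ennreal_mult) (auto simp: mult_ac)
      also have "\<dots> = l k y" using \<epsilon>[of k] by simp
      finally show "(\<integral>\<^sup>+s. G k s y \<partial>lborel) = l k y" .
    qed
    also have "\<dots> \<le> b" using v(2)[of k] by (simp add: l_def)
    finally show ?thesis .
  qed
  have "(\<integral>\<^sup>+s. liminf (\<lambda>k. H k s) \<partial>lborel) \<le> liminf (\<lambda>k. \<integral>\<^sup>+s. H k s \<partial>lborel)"
    by (rule nn_integral_liminf) measurable
  also have "\<dots> \<le> liminf (\<lambda>k. b)" by (intro Liminf_mono always_eventually allI Hint)
  also have "\<dots> < \<infinity>" using b by (simp add: Liminf_const)
  finally have AE2: "AE s in lborel. liminf (\<lambda>k. H k s) \<noteq> \<infinity>"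
    by (intro nn_integral_PInf_AE) auto
  show ?thesis
    using AE1 AE2
  proof eventually_elim
    case (elim s)
    define z where "z = (\<lambda>k y. ramp (\<epsilon> k) (v k y - s))"
    have "perimeter {y\<in>\<Omega>. s < u y} \<Omega> \<le> liminf (\<lambda>k. energy M \<Omega> (z k))"
    proof (rule total_variation_le_liminf)
      fix k
      show "z k \<in> Lip_loc \<Omega>"
      proof (rule Lip_loc_affine_le[OF v(1)[of k], of "1 / \<epsilon> k" 0])
        fix x y
        show "\<bar>z k y - z k x\<bar> \<le> 1 / \<epsilon> k * \<bar>v k y - v k x\<bar> + 0 * dist x y"
          unfolding z_def using ramp_lipschitz[OF \<epsilon>, of k "v k y - s" "v k x - s"] by simp
      qed (use \<epsilon>[of k] in auto)
    next
      show "converges_L1_loc M \<Omega> z (indicator {y\<in>\<Omega>. s < u y})"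
        unfolding converges_L1_loc_def
      proof safe
        fix K' assume K': "compact K'" "K' \<subseteq> \<Omega>"
        obtain N where N: "\<And>n. n \<ge> N \<Longrightarrow> K' \<subseteq> K n" using compact_subset_exhaust[OF \<Omega> K'] unfolding K_def by blast
        have D0: "(\<lambda>k. D k s) \<longlonglongrightarrow> 0" using suminf_ennreal_tendsto_0[of "\<lambda>k. D k s"] elim(1) by simp
        have "eventually (\<lambda>k. L1_dist M K' (z k) (indicator {y\<in>\<Omega>. s < u y}) \<le> D k s) sequentially"
          using eventually_ge_at_top[of N]
        proof eventually_elim
          case (elim k)
          show ?case unfolding D_def
          proof (rule nn_integral_mono)
            fix y
            show "ennreal \<bar>z k y - indicator {y\<in>\<Omega>. s < u y} y\<bar> * indicator K' y \<le> F k s y"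
            proof (cases "y \<in> K'")
              case True
              then have "y \<in> K k" "y \<in> \<Omega>" using N[OF elim] K' by auto
              then show ?thesis using True by (simp add: F_def z_def vm_def um_def indicator_def)
            qed simp
          qed
        qed
        then show "(\<lambda>k. L1_dist M K' (z k) (indicator {y\<in>\<Omega>. s < u y})) \<longlonglongrightarrow> 0"
          using D0 by (rule ennreal_tendsto_0_le)
      qed
    qed
    also have "\<dots> \<le> liminf (\<lambda>k. H k s)"
    proof (intro Liminf_mono always_eventually allI)
      fix k
      show "energy M \<Omega> (z k) \<le> H k s"
        unfolding H_def
      proof (rule nn_integral_mono)
        fix y
        show "lip_slope (z k) y * indicator \<Omega> y \<le> G k s y"
        proof (cases "y \<in> \<Omega>")
          case True
          then show ?thesis unfolding z_def G_def
            using lip_slope_ramp_le[OF \<Omega> vc True \<epsilon>[of k], of k s]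
            by (simp add: vm_def l_def indicator_def of_bool_conj)
        qed simp
      qed
    qed
    also have "\<dots> < \<infinity>" using elim(2) by (simp add: less_top)
    finally show ?case .
  qed
qed

end

section \<open>Level sets\<close>

text \<open>Each such \<open>t\<close> gets a rational \<open>q t\<close> with no point of
  \<open>N\<close> in \<open>{t<..q t}\<close>, and distinct points cannot share one. Applied to the
  levels of perimeter at most n, it makes all but countably many of them accumulation points from
  the right.\<close>

lemma countable_right_isolated:
  fixes N :: "real set"
  shows "countable {t\<in>N. \<exists>e>0. N \<inter> {t<..<t + e} = {}}"
proof -
  let ?I = "{t\<in>N. \<exists>e>0. N \<inter> {t<..<t + e} = {}}"
  have "\<exists>q\<in>\<rat>. t < q \<and> N \<inter> {t<..q} = {}" if t: "t \<in> ?I" for t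
  proof -
    obtain e where e: "e > 0" "N \<inter> {t<..<t + e} = {}" using t by blast
    obtain q where q: "q \<in> \<rat>" "t < q" "q < t + e" using Rats_dense_in_real[of t "t + e"] e(1) by auto
    have "{t<..q} \<subseteq> {t<..<t + e}" using q by auto
    then show ?thesis using q e(2) by blast
  qed
  then have "\<forall>t\<in>?I. \<exists>q. q \<in> \<rat> \<and> t < q \<and> N \<inter> {t<..q} = {}" by blast
  from bchoice[OF this] obtain q where "\<forall>t\<in>?I. q t \<in> \<rat> \<and> t < q t \<and> N \<inter> {t<..q t} = {}" ..
  then have q: "q t \<in> \<rat>" "t < q t" "N \<inter> {t<..q t} = {}" if "t \<in> ?I" for t using that by blast+
  have less: "q s \<noteq> q t" if "s \<in> ?I" "t \<in> ?I" "s < t" for s t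
  proof
    assume eq: "q s = q t"
    have "t \<in> {s<..q s}" using q(2)[OF that(2)] that(3) eq by simp
    moreover have "t \<in> N" using that(2) by blast
    ultimately show False using q(3)[OF that(1)] by blast
  qed
  have "inj_on q ?I"
  proof (rule inj_onI)
    fix s t assume st: "s \<in> ?I" "t \<in> ?I" "q s = q t"
    show "s = t" using less[OF st(1,2)] less[OF st(2,1)] st(3) by (cases s t rule: linorder_cases) auto
  qed
  moreover have "countable (q ` ?I)" by (rule countable_subset[OF _ countable_rat]) (use q(1) in blast)
  ultimately show ?thesis using countable_image_inj_on by blast
qed

lemma countable_left_isolated:
  fixes N :: "real set"
  shows "countable {t\<in>N. \<exists>e>0. N \<inter> {t - e<..<t} = {}}"
proof -
  have "uminus ` {t\<in>N. \<exists>e>0. N \<inter> {t - e<..<t} = {}} \<subseteq> {t\<in>uminus ` N. \<exists>e>0. uminus ` N \<inter> {t<..<t + e} = {}}"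
  proof (rule image_subsetI)
    fix t assume "t \<in> {t\<in>N. \<exists>e>0. N \<inter> {t - e<..<t} = {}}"
    then obtain e where e: "t \<in> N" "e > 0" "N \<inter> {t - e<..<t} = {}" by blast
    have "uminus ` N \<inter> {- t<..< - t + e} = {}"
    proof (rule ccontr)
      assume "uminus ` N \<inter> {- t<..< - t + e} \<noteq> {}"
      then obtain s where "s \<in> N" "- t < - s" "- s < - t + e" by auto
      then have "s \<in> N \<inter> {t - e<..<t}" by auto
      then show False using e(3) by blast
    qed
    then show "- t \<in> {t\<in>uminus ` N. \<exists>e>0. uminus ` N \<inter> {t<..<t + e} = {}}" using e by blast
  qed
  then have "countable (uminus ` {t\<in>N. \<exists>e>0. N \<inter> {t - e<..<t} = {}})"
    using countable_right_isolated countable_subset by blast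
  then show ?thesis by (rule countable_image_inj_on) (auto simp: inj_on_def)
qed

lemma has_density_1_if_ball_subset:
  assumes "\<And>r. 0 < r \<Longrightarrow> 0 < measure M (ball x r)" "e > 0" "ball x e \<subseteq> A"
  shows "has_density M A x 1"
  unfolding has_density_def
proof (rule tendsto_eventually)
  have "eventually (\<lambda>r. r \<in> {0<..<e}) (at_right 0)" using assms by (intro eventually_at_right_real)
  then show "eventually (\<lambda>r. measure M (A \<inter> ball x r) / measure M (ball x r) = 1) (at_right 0)"
  proof eventually_elim
    case (elim r)
    then have "ball x r \<subseteq> A" using assms(3) subset_ball[of r e x] by auto
    then have "A \<inter> ball x r = ball x r" by blast
    then show ?case using assms(1)[of r] elim by simp
  qed
qed

section \<open>Density dichotomy on the sets \<open>Lambda_level\<close>\<close>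

context doubling_poincare
begin

lemma has_density_0_subset:
  assumes "A \<subseteq> B" "A \<in> sets M" "B \<in> sets M" "has_density M B x 0"
  shows "has_density M A x 0"
  unfolding has_density_def
proof (rule tendsto_sandwich[OF always_eventually always_eventually tendsto_const])
  show "((\<lambda>r. measure M (B \<inter> ball x r) / measure M (ball x r)) \<longlongrightarrow> 0) (at_right 0)"
    using assms(4) by (simp add: has_density_def)
  show "\<forall>r. measure M (A \<inter> ball x r) / measure M (ball x r) \<le> measure M (B \<inter> ball x r) / measure M (ball x r)"
  proof (intro allI divide_right_mono measure_mono_fmeasurable)
    show "B \<inter> ball x r \<in> fmeasurable M" for r
      by (rule Int_ball_fmeasurable[OF assms(3)])
  qed (use assms in auto)
qed auto

text \<open>Off the null set \<open>Z\<close> the density exceeds \<open>low_density\<close> at some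
  radius below \<open>R\<close>, while at \<open>R\<close> it is at most 3/4. So
  \<open>density_crossing\<close> finds a ball with density between \<open>low_density / C\<close>
  and 3/4, as the isoperimetric inequality requires.\<close>

lemma coH1_delta_crossing_le:
  assumes E: "E \<in> sets M" and \<Omega>: "open \<Omega>" and fin: "perimeter E \<Omega> < \<infinity>"
    and U: "open U" "U \<subseteq> \<Omega>" and B: "bounded B" and sub: "\<And>x. x \<in> B \<Longrightarrow> ball x R1 \<subseteq> U" "0 < R1"
    and R: "0 < R" "2 * L * R < R1" "5 * L * R < \<delta>"
  shows "coH1_delta M \<delta> {x\<in>B. measure M (E \<inter> ball x R) \<le> 3/4 * measure M (ball x R) \<and> \<not> has_density M E x 0}
    \<le> ennreal (cover_const / (low_density / C)) * perimeter E U"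
proof -
  define Z where "Z = {x\<in>\<Omega>. (\<exists>\<rho>>0. \<forall>r. 0 < r \<and> r < \<rho> \<longrightarrow> measure M (E \<inter> ball x r) \<le> low_density * measure M (ball x r))
     \<and> \<not> has_density M E x 0}"
  have Z0: "coH1 M Z = 0" unfolding Z_def by (rule coH1_low_density_null[OF E \<Omega> fin])
  define X where "X = {x\<in>B. measure M (E \<inter> ball x R) \<le> 3/4 * measure M (ball x R) \<and> \<not> has_density M E x 0}"
  \<comment> \<open>A midpoint leaves room on both sides: below it for the covering radii, above it
    for the strict inequality in the subadditivity of the content.\<close>
  define \<delta>' where "\<delta>' = (5 * L * R + \<delta>) / 2"
  have "0 < 5 * L * R" using L_ge_1 R(1) by simp
  then have \<delta>': "5 * L * R < \<delta>'" "\<delta>' < \<delta>" "0 < \<delta>'" using R(3) by (auto simp: \<delta>'_def)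
  have \<theta>: "0 < low_density / C" using low_density(1) C_ge_1 by simp
  have "low_density \<le> low_density * C" using low_density(1) C_ge_1 by simp
  then have \<theta>4: "low_density / C \<le> 1/4" using low_density(1,3) C_ge_1 by (simp add: pos_divide_le_eq)
  have "coH1_delta M \<delta>' (X - Z) \<le> ennreal (cover_const / (low_density / C)) * perimeter E U"
  proof (rule coH1_delta_le_perimeter[OF U(1) _ \<theta> \<delta>'(1) R(1)])
    show "bounded (X - Z)" using B by (rule bounded_subset) (auto simp: X_def)
    fix x assume x: "x \<in> X - Z"
    then have xB: "x \<in> B" "measure M (E \<inter> ball x R) \<le> 3/4 * measure M (ball x R)" "\<not> has_density M E x 0"
      by (auto simp: X_def)
    have "x \<in> \<Omega>" using sub(1)[OF xB(1)] sub(2) U(2) centre_in_ball[of x R1] by blast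
    then have "\<not> (\<exists>\<rho>>0. \<forall>r. 0 < r \<and> r < \<rho> \<longrightarrow> measure M (E \<inter> ball x r) \<le> low_density * measure M (ball x r))"
      using x xB(3) by (auto simp: Z_def)
    then obtain \<rho> where \<rho>: "0 < \<rho>" "\<rho> < R" "low_density * measure M (ball x \<rho>) < measure M (E \<inter> ball x \<rho>)"
      using R(1) by (meson not_le)
    obtain r where r: "0 < r" "r \<le> R" "low_density / C * measure M (ball x r) \<le> measure M (E \<inter> ball x r)"
      "measure M (E \<inter> ball x r) \<le> 3/4 * measure M (ball x r)"
      by (rule density_crossing[OF E R(1) less_imp_le[OF \<theta>] _ xB(2), of \<rho>])
         (use \<rho> low_density C_ge_1 in auto)
    have hi: "measure M (E \<inter> ball x r) \<le> (1 - low_density / C) * measure M (ball x r)"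
    proof -
      have "3/4 * measure M (ball x r) \<le> (1 - low_density / C) * measure M (ball x r)"
        using \<theta>4 by (intro mult_right_mono) auto
      then show ?thesis using r(4) by linarith
    qed
    have Lr: "L * r \<le> L * R" "0 < L * r" using r L_ge_1 by (auto intro: mult_left_mono)
    have Lr1: "2 * (L * r) < R1" using Lr R(2) by simp
    have "cball x (2 * L * r) \<subseteq> ball x R1"
    proof
      fix y assume "y \<in> cball x (2 * L * r)"
      then have "dist x y \<le> 2 * (L * r)" by simp
      then show "y \<in> ball x R1" using Lr1 by simp
    qed
    then have sub': "cball x (2 * L * r) \<subseteq> \<Omega>" using sub(1)[OF xB(1)] U(2) by blast
    have "ball x (L * r) \<subseteq> U"
      using sub(1)[OF xB(1)] subset_ball[of "L * r" R1 x] Lr Lr1 by force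
    then show "\<exists>r>0. r \<le> R \<and> ball x (L * r) \<subseteq> U \<and>
        ennreal (low_density / C * measure M (ball x r)) \<le> ennreal (P * r) * perimeter E (ball x (L * r))"
      using relative_isoperimetric[OF E \<Omega> fin r(1) sub' less_imp_le[OF \<theta>] r(3) hi] r by blast
  qed
  moreover have "coH1_delta M \<delta> X \<le> coH1_delta M \<delta> ((X - Z) \<union> Z)" by (rule coH1_delta_mono) blast
  moreover have "coH1_delta M \<delta> ((X - Z) \<union> Z) \<le> coH1_delta M \<delta>' (X - Z) + coH1_delta M \<delta>' Z"
    by (rule coH1_delta_Un_le[OF \<delta>'(3,2)])
  moreover have "coH1_delta M \<delta>' Z = 0" using coH1_delta_le_coH1[OF \<delta>'(3), of M Z] Z0 by simp
  ultimately show ?thesis unfolding X_def by simp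
qed

lemma superlevel_sets:
  assumes "open \<Omega>" "u \<in> L1_loc M \<Omega>"
  shows "{y\<in>\<Omega>. s < u y} \<in> sets M" "{y\<in>\<Omega>. u y < s} \<in> sets M"
proof -
  have [measurable]: "(\<lambda>y. u y * indicator \<Omega> y) \<in> borel_measurable M" by (rule L1_loc_measurable[OF assms])
  have [measurable]: "\<Omega> \<in> sets M" using assms(1) by (rule open_sets)
  have "{y\<in>\<Omega>. s < u y} = {y\<in>space M. s < u y * indicator \<Omega> y} \<inter> \<Omega>" by auto
  moreover have "\<dots> \<in> sets M" by measurable
  ultimately show "{y\<in>\<Omega>. s < u y} \<in> sets M" by simp
  have "{y\<in>\<Omega>. u y < s} = {y\<in>space M. u y * indicator \<Omega> y < s} \<inter> \<Omega>" by auto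
  moreover have "\<dots> \<in> sets M" by measurable
  ultimately show "{y\<in>\<Omega>. u y < s} \<in> sets M" by simp
qed

lemma total_variation_sublevel_le:
  assumes "U \<subseteq> \<Omega>"
  shows "perimeter (\<Omega> - E) U \<le> perimeter E U"
proof -
  have "perimeter (\<Omega> - E) U = total_variation M (\<lambda>y. 1 - indicator E y) U"
    using assms by (intro total_variation_cong) (auto simp: indicator_def)
  then show ?thesis using total_variation_one_minus_le[of M "indicator E" U] by simp
qed

text \<open>The second set is written as a complement because perimeter bounds pass to complements.
  It contains \<open>{y\<in>\<Omega>. u y < s}\<close>, whose density decides the lower
  limit.\<close>

lemma Lambda_level_not_has_density:
  assumes \<Omega>: "open \<Omega>" and u: "u \<in> L1_loc M \<Omega>" and x: "x \<in> Lambda_level M \<Omega> u t"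
  shows "s' < t \<Longrightarrow> \<not> has_density M {y\<in>\<Omega>. s' < u y} x 0"
    and "t < s \<Longrightarrow> \<not> has_density M (\<Omega> - {y\<in>\<Omega>. s < u y}) x 0"
proof -
  have lo: "approx_lower M \<Omega> u x \<le> ereal t" and up: "ereal t \<le> approx_upper M \<Omega> u x"
    using x by (auto simp: Lambda_level_def)
  show "\<not> has_density M {y\<in>\<Omega>. s' < u y} x 0" if "s' < t"
  proof
    assume "has_density M {y\<in>\<Omega>. s' < u y} x 0"
    then have "approx_upper M \<Omega> u x \<le> ereal s'" unfolding approx_upper_def by (intro Inf_lower) blast
    then show False using order_trans[OF up, of "ereal s'"] that by simp
  qed
  show "\<not> has_density M (\<Omega> - {y\<in>\<Omega>. s < u y}) x 0" if "t < s"
  proof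
    assume *: "has_density M (\<Omega> - {y\<in>\<Omega>. s < u y}) x 0"
    have "has_density M {y\<in>\<Omega>. u y < s} x 0"
      by (rule has_density_0_subset[OF _ superlevel_sets(2)[OF \<Omega> u] sets.Diff[OF open_sets[OF \<Omega>] superlevel_sets(1)[OF \<Omega> u]] *]) auto
    then have "ereal s \<le> approx_lower M \<Omega> u x" unfolding approx_lower_def by (intro Sup_upper) blast
    then show False using order_trans[OF _ lo, of "ereal s"] that by simp
  qed
qed

text \<open>\<open>{u > s'}\<close> and \<open>{u \<le> s}\<close> overlap where
  \<open>s' < u \<le> s\<close>. On a bounded set the measure of this overlap tends to that of
  \<open>{u = t}\<close>, which is 0, so for close levels it is at most half of every ball of radius
  \<open>R\<close> about \<open>S\<close>. The two densities then add up to at most 3/2, and one of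
  them is at most 3/4. How close the levels must be depends on \<open>R\<close>, hence on
  \<delta>.\<close>

lemma coH1_delta_level_le:
  assumes \<Omega>: "open \<Omega>" and u: "u \<in> L1_loc M \<Omega>" and null: "emeasure M {y\<in>\<Omega>. u y = t} = 0"
    and U: "open U" "U \<subseteq> \<Omega>" and S: "bounded S" and sub: "\<And>x. x \<in> S \<Longrightarrow> ball x R1 \<subseteq> U" "0 < R1" and \<delta>: "0 < \<delta>"
  obtains \<eta> where "\<eta> > 0" "\<And>s' s. t - \<eta> < s' \<Longrightarrow> s' < t \<Longrightarrow> t < s \<Longrightarrow> s < t + \<eta> \<Longrightarrow>
      perimeter {y\<in>\<Omega>. s' < u y} \<Omega> < \<infinity> \<Longrightarrow>
      perimeter {y\<in>\<Omega>. s < u y} \<Omega> < \<infinity> \<Longrightarrow>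
      coH1_delta M \<delta> (Lambda_level M \<Omega> u t \<inter> S) \<le> ennreal (cover_const / (low_density / C)) *
        (perimeter {y\<in>\<Omega>. s' < u y} U + perimeter {y\<in>\<Omega>. s < u y} U)"
proof -
  \<comment> \<open>Small against \<open>R1\<close>, so that dilated balls stay in \<open>U\<close>,
    and against \<open>\<delta> / 2\<close>, since the content of the union of two sets is split at
    half the scale.\<close>
  define R where "R = min (R1 / (4 * L)) (\<delta> / (20 * L))"
  have R: "0 < R" "R \<le> R1 / (4 * L)" "R \<le> \<delta> / (20 * L)" using sub(2) \<delta> L_ge_1 by (auto simp: R_def)
  have "0 < L * R" using R L_ge_1 by simp
  moreover have "4 * (L * R) \<le> R1" "20 * (L * R) \<le> \<delta>" using R L_ge_1 by (auto simp: field_simps)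
  ultimately have R': "2 * L * R < R1" "5 * L * R < \<delta> / 2" by (simp_all add: mult.assoc)
  obtain c D where D: "S \<subseteq> cball c D" using S bounded_subset_cball by blast
  define D1 where "D1 = \<bar>D\<bar> + 1"
  obtain j :: nat where j: "2 * D1 / R < 2 ^ j" using real_arch_pow[of 2] by auto
  \<comment> \<open>Uniform lower bound, by doubling, for the measure of the balls of radius
    \<open>R\<close> centred in \<open>S\<close>; the overlap is compared with it.\<close>
  define c0 where "c0 = measure M (ball c D1) / C ^ j"
  have c0: "0 < c0" unfolding c0_def using measure_ball_pos[of D1 c] C_ge_1 by (simp add: D1_def)
  have cx: "dist x c \<le> D1" if "x \<in> S" for x
  proof -
    have "dist c x \<le> D" using that D by auto
    then show ?thesis by (simp add: D1_def dist_commute)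
  qed
  have low: "c0 \<le> measure M (ball x R)" if x: "x \<in> S" for x
  proof -
    have "measure M (ball c D1) \<le> C ^ j * measure M (ball x R)"
      using cx[OF x] j R(1) by (intro measure_doubling_le) (auto simp: field_simps)
    then show ?thesis unfolding c0_def using C_ge_1 by (simp add: pos_divide_le_eq mult.commute)
  qed
  define W where "W = ball c (D1 + R)"
  define T where "T = (\<lambda>k. {y\<in>\<Omega>. t - 1 / real (Suc k) < u y \<and> u y \<le> t + 1 / real (Suc k)} \<inter> W)"
  have Tm: "T k \<in> sets M" for k
  proof -
    have "T k = ({y\<in>\<Omega>. t - 1 / real (Suc k) < u y} - {y\<in>\<Omega>. t + 1 / real (Suc k) < u y}) \<inter> W"
      by (auto simp: T_def)
    moreover have "W \<in> sets M" by (simp add: W_def open_sets)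
    ultimately show ?thesis using superlevel_sets(1)[OF \<Omega> u] by auto
  qed
  have "(\<lambda>k. emeasure M (T k)) \<longlonglongrightarrow> emeasure M (\<Inter>k. T k)"
  proof (rule Lim_emeasure_decseq)
    show "range T \<subseteq> sets M" using Tm by auto
    show "decseq T"
    proof (rule decseq_SucI)
      fix k
      have "1 / real (Suc (Suc k)) \<le> 1 / real (Suc k)" by (intro divide_left_mono) auto
      then show "T (Suc k) \<subseteq> T k" unfolding T_def by auto
    qed
    show "emeasure M (T k) \<noteq> \<infinity>" for k
      using bounded_emeasure_finite[of "T k"] bounded_subset[OF bounded_ball, of "T k" c "D1 + R"] by (auto simp: T_def W_def)
  qed
  moreover have "emeasure M (\<Inter>k. T k) = 0"
  proof -
    have m: "{y\<in>\<Omega>. u y = t} \<in> sets M"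
    proof -
      have "{y\<in>\<Omega>. u y = t} = \<Omega> - {y\<in>\<Omega>. t < u y} - {y\<in>\<Omega>. u y < t}" by auto
      then show ?thesis using superlevel_sets[OF \<Omega> u] open_sets[OF \<Omega>] by auto
    qed
    have "(\<Inter>k. T k) \<subseteq> {y\<in>\<Omega>. u y = t}"
    proof
      fix y assume "y \<in> (\<Inter>k. T k)"
      then have y: "y \<in> T k" for k by blast
      have "\<not> 0 < \<bar>u y - t\<bar>"
      proof
        assume "0 < \<bar>u y - t\<bar>"
        then obtain k where "1 / real (Suc k) < \<bar>u y - t\<bar>" using nat_approx_posE by blast
        then show False using y[of k] by (auto simp: T_def)
      qed
      then show "y \<in> {y\<in>\<Omega>. u y = t}" using y[of 0] by (auto simp: T_def)
    qed
    then show ?thesis using emeasure_mono[OF _ m] null by (metis le_zero_eq)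
  qed
  ultimately have "eventually (\<lambda>k. emeasure M (T k) < ennreal (c0 / 2)) sequentially"
    using c0 by (intro order_tendstoD(2)[of _ 0]) auto
  then obtain k where k: "emeasure M (T k) < ennreal (c0 / 2)" unfolding eventually_sequentially by blast
  show thesis
  proof (rule that[of "1 / real (Suc k)"])
    fix s' s
    assume s: "t - 1 / real (Suc k) < s'" "s' < t" "t < s" "s < t + 1 / real (Suc k)"
      and fin: "perimeter {y\<in>\<Omega>. s' < u y} \<Omega> < \<infinity>" "perimeter {y\<in>\<Omega>. s < u y} \<Omega> < \<infinity>"
    define E where "E = {y\<in>\<Omega>. s' < u y}"
    define F where "F = \<Omega> - {y\<in>\<Omega>. s < u y}"
    have EF[measurable]: "E \<in> sets M" "F \<in> sets M"
      using superlevel_sets[OF \<Omega> u] open_sets[OF \<Omega>] by (auto simp: E_def F_def)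
    have finF: "perimeter F \<Omega> < \<infinity>"
      using total_variation_sublevel_le[of \<Omega> \<Omega> "{y\<in>\<Omega>. s < u y}"] fin(2) by (simp add: F_def)
    let ?X = "\<lambda>E. {x\<in>S. measure M (E \<inter> ball x R) \<le> 3/4 * measure M (ball x R) \<and> \<not> has_density M E x 0}"
    have "Lambda_level M \<Omega> u t \<inter> S \<subseteq> ?X E \<union> ?X F"
    proof
      fix x assume x: "x \<in> Lambda_level M \<Omega> u t \<inter> S"
      let ?B = "ball x R"
      have fm: "A \<inter> ?B \<in> fmeasurable M" if "A \<in> sets M" for A
        by (rule Int_ball_fmeasurable[OF that])
      have "?B \<subseteq> W"
      proof
        fix y assume "y \<in> ?B"
        then show "y \<in> W" using cx[of x] x dist_triangle[of c y x] by (auto simp: W_def dist_commute)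
      qed
      then have "E \<inter> F \<inter> ?B \<subseteq> T k" using s by (auto simp: T_def E_def F_def)
      then have "emeasure M (E \<inter> F \<inter> ?B) \<le> emeasure M (T k)" using Tm by (intro emeasure_mono) auto
      also note k
      finally have "measure M (E \<inter> F \<inter> ?B) < c0 / 2"
        using fm[of "E \<inter> F"] c0 by (simp add: emeasure_eq_measure2 ennreal_less_iff)
      then have small: "measure M (E \<inter> F \<inter> ?B) \<le> measure M ?B / 2" using low[of x] x by auto
      have "measure M (F \<inter> ?B) = measure M ((F - E) \<inter> ?B) + measure M (E \<inter> F \<inter> ?B)"
        using fm[of "F - E"] fm[of "E \<inter> F"]
        by (subst measure_Union[symmetric]) (auto simp: fmeasurableD2 intro!: arg_cong[where f="measure M"])
      moreover have "measure M ((F - E) \<inter> ?B) + measure M (E \<inter> ?B) \<le> measure M ?B"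
        using fm[of "F - E"] fm[of E]
        by (subst measure_Union[symmetric]) (auto simp: fmeasurableD2 intro!: measure_mono_fmeasurable)
      ultimately have "measure M (E \<inter> ?B) + measure M (F \<inter> ?B) \<le> 3/2 * measure M ?B" using small by linarith
      then have "measure M (E \<inter> ?B) \<le> 3/4 * measure M ?B \<or> measure M (F \<inter> ?B) \<le> 3/4 * measure M ?B" by linarith
      then show "x \<in> ?X E \<union> ?X F"
        using x Lambda_level_not_has_density[OF \<Omega> u, of x t] s unfolding E_def F_def by blast
    qed
    then have "coH1_delta M \<delta> (Lambda_level M \<Omega> u t \<inter> S) \<le> coH1_delta M \<delta> (?X E \<union> ?X F)" by (rule coH1_delta_mono)
    also have "\<dots> \<le> coH1_delta M (\<delta>/2) (?X E) + coH1_delta M (\<delta>/2) (?X F)"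
      using \<delta> by (intro coH1_delta_Un_le) auto
    also have "\<dots> \<le> ennreal (cover_const / (low_density / C)) * perimeter E U +
        ennreal (cover_const / (low_density / C)) * perimeter F U"
      using fin(1) finF
      by (intro add_mono coH1_delta_crossing_le[OF _ \<Omega> _ U S sub R(1) R'] EF) (auto simp: E_def)
    also have "\<dots> \<le> ennreal (cover_const / (low_density / C)) *
        (perimeter {y\<in>\<Omega>. s' < u y} U + perimeter {y\<in>\<Omega>. s < u y} U)"
      unfolding distrib_left[symmetric] E_def F_def
      by (intro mult_left_mono add_mono total_variation_sublevel_le U order_refl) simp
    finally show "coH1_delta M \<delta> (Lambda_level M \<Omega> u t \<inter> S) \<le> ennreal (cover_const / (low_density / C)) *
        (perimeter {y\<in>\<Omega>. s' < u y} U + perimeter {y\<in>\<Omega>. s < u y} U)" .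
  qed simp
qed

section \<open>Shells of the open set and summation over them\<close>

text \<open>Two empty sets are prepended so that the first shells need no separate treatment.\<close>

definition shell_bound :: "'a set \<Rightarrow> nat \<Rightarrow> 'a set" where
  "shell_bound \<Omega> k = (if k < 2 then {} else exhaust \<Omega> (k - 2))"

lemma shell_bound_mono: "k \<le> l \<Longrightarrow> shell_bound \<Omega> k \<subseteq> shell_bound \<Omega> l"
  unfolding shell_bound_def using exhaust_mono[of "k - 2" "l - 2" \<Omega>] by auto

lemma closed_shell_bound: "closed (shell_bound \<Omega> k)"
  by (auto simp: shell_bound_def closed_exhaust)

lemma shell_bound_nbhd: "\<exists>e>0. \<forall>x\<in>shell_bound \<Omega> k. ball x e \<subseteq> shell_bound \<Omega> (Suc k)"
proof (cases "k < 2")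
  case False
  define e where "e = 1 / real (Suc (k - 2)) - 1 / real (Suc (Suc (k - 2)))"
  have e: "0 < e" unfolding e_def by (rule exhaust_radius_pos)
  have "ball x e \<subseteq> shell_bound \<Omega> (Suc k)" if x: "x \<in> shell_bound \<Omega> k" for x
  proof
    fix y assume "y \<in> ball x e"
    then have "y \<in> exhaust \<Omega> (Suc (k - 2))"
      using x False by (intro exhaust_nbhd[of x]) (auto simp: shell_bound_def e_def)
    moreover have "Suc (k - 2) = Suc k - 2" using False by simp
    ultimately show "y \<in> shell_bound \<Omega> (Suc k)" using False by (simp add: shell_bound_def)
  qed
  then show ?thesis using e by blast
qed (auto simp: shell_bound_def intro: exI[of _ 1])

definition shell :: "'a set \<Rightarrow> nat \<Rightarrow> 'a set" where
  "shell \<Omega> m = shell_bound \<Omega> (m + 2) - shell_bound \<Omega> (m + 1)"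

text \<open>One stage of room on either side of the shell: enough for a uniform neighbourhood of it,
  while indices at least 3 apart still give disjoint sets.\<close>

definition shell_nbhd :: "'a set \<Rightarrow> nat \<Rightarrow> 'a set" where
  "shell_nbhd \<Omega> m = interior (shell_bound \<Omega> (m + 3)) - shell_bound \<Omega> m"

lemma open_shell_nbhd: "open (shell_nbhd \<Omega> m)"
  unfolding shell_nbhd_def by (intro open_Diff open_interior closed_shell_bound)

lemma shell_nbhd_subset: "shell_nbhd \<Omega> m \<subseteq> \<Omega>"
  unfolding shell_nbhd_def shell_bound_def using interior_subset exhaust_subset by fastforce

lemma bounded_shell: "bounded (shell \<Omega> m)"
proof -
  have "bounded (exhaust \<Omega> m)" by (rule compact_imp_bounded[OF compact_exhaust])
  then show ?thesis by (rule bounded_subset) (auto simp: shell_def shell_bound_def)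
qed

lemma shell_subset_shell_nbhd:
  obtains e where "e > 0" "\<And>x. x \<in> shell \<Omega> m \<Longrightarrow> ball x e \<subseteq> shell_nbhd \<Omega> m"
proof -
  obtain e1 where e1: "e1 > 0" "\<And>x. x \<in> shell_bound \<Omega> (m + 2) \<Longrightarrow> ball x e1 \<subseteq> shell_bound \<Omega> (m + 3)"
    using shell_bound_nbhd[of \<Omega> "m + 2"] by (auto simp: numeral_eq_Suc)
  obtain e2 where e2: "e2 > 0" "\<And>x. x \<in> shell_bound \<Omega> m \<Longrightarrow> ball x e2 \<subseteq> shell_bound \<Omega> (m + 1)"
    using shell_bound_nbhd[of \<Omega> m] by auto
  show thesis
  proof (rule that[of "min e1 e2"])
    fix x assume x: "x \<in> shell \<Omega> m"
    have "ball x (min e1 e2) \<subseteq> ball x e1" by (rule subset_ball) simp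
    then have "ball x (min e1 e2) \<subseteq> shell_bound \<Omega> (m + 3)" using e1(2)[of x] x by (auto simp: shell_def)
    then have "ball x (min e1 e2) \<subseteq> interior (shell_bound \<Omega> (m + 3))" by (intro interior_maximal) auto
    moreover have "y \<notin> shell_bound \<Omega> m" if y: "y \<in> ball x (min e1 e2)" for y
    proof
      assume "y \<in> shell_bound \<Omega> m"
      moreover have "x \<in> ball y e2" using y by (simp add: dist_commute)
      ultimately have "x \<in> shell_bound \<Omega> (m + 1)" using e2(2)[of y] by blast
      then show False using x by (simp add: shell_def)
    qed
    ultimately show "ball x (min e1 e2) \<subseteq> shell_nbhd \<Omega> m" by (auto simp: shell_nbhd_def)
  qed (use e1 e2 in simp)
qed

lemma UN_shell: assumes "open \<Omega>" shows "\<Omega> \<subseteq> (\<Union>m. shell \<Omega> m)"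
proof
  fix x assume "x \<in> \<Omega>"
  then have ex: "\<exists>n. x \<in> exhaust \<Omega> n" using eventually_in_exhaust[OF assms] by (auto simp: eventually_sequentially)
  define n where "n = (LEAST n. x \<in> exhaust \<Omega> n)"
  have "x \<in> exhaust \<Omega> n" unfolding n_def using ex by (rule LeastI_ex)
  moreover have "x \<notin> shell_bound \<Omega> (n + 1)"
  proof (cases n)
    case (Suc k)
    then have "x \<notin> exhaust \<Omega> k" unfolding n_def using not_less_Least by (metis lessI)
    then show ?thesis using Suc by (simp add: shell_bound_def)
  qed (simp add: shell_bound_def)
  ultimately have "x \<in> shell \<Omega> n" by (simp add: shell_def shell_bound_def)
  then show "x \<in> (\<Union>m. shell \<Omega> m)" by blast
qed

text \<open>Within a residue class modulo 3 the neighbourhoods are disjoint, so superadditivity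
  applies to each of the three classes.\<close>

lemma sum_total_variation_shell_nbhd_le:
  "(\<Sum>m<N. total_variation M f (shell_nbhd \<Omega> m)) \<le> 3 * total_variation M f \<Omega>"
proof -
  have "(\<Sum>m<N. total_variation M f (shell_nbhd \<Omega> m))
      = (\<Sum>c\<in>{..<3::nat}. \<Sum>m\<in>{m\<in>{..<N}. m mod 3 = c}. total_variation M f (shell_nbhd \<Omega> m))"
    by (rule sum.group[symmetric]) auto
  also have "\<dots> \<le> (\<Sum>c\<in>{..<3::nat}. total_variation M f \<Omega>)"
  proof (intro sum_mono total_variation_superadditive open_shell_nbhd shell_nbhd_subset)
    fix c :: nat
    have disj: "shell_nbhd \<Omega> k \<inter> shell_nbhd \<Omega> l = {}" if "k + 3 \<le> l" for k l
      using shell_bound_mono[OF that, of \<Omega>] interior_subset[of "shell_bound \<Omega> (k + 3)"]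
      by (auto simp: shell_nbhd_def)
    show "disjoint_family_on (shell_nbhd \<Omega>) {m\<in>{..<N}. m mod 3 = c}"
      unfolding disjoint_family_on_def
    proof (intro ballI impI)
      fix k l assume "k \<in> {m\<in>{..<N}. m mod 3 = c}" "l \<in> {m\<in>{..<N}. m mod 3 = c}" "k \<noteq> l"
      then have "k mod 3 = l mod 3" "k \<noteq> l" by simp_all
      then have "k + 3 \<le> l \<or> l + 3 \<le> k" by presburger
      then show "shell_nbhd \<Omega> k \<inter> shell_nbhd \<Omega> l = {}" using disj[of k l] disj[of l k] by blast
    qed
  qed auto
  also have "\<dots> = 3 * total_variation M f \<Omega>" by simp
  finally show ?thesis .
qed

text \<open>The admissible distance of the levels from t may shrink to 0 along the shells. Only
  partial sums are therefore estimated, each with levels depending on \<open>N\<close> and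
  \<open>\<delta>\<close>; the resulting bound involves only \<open>p\<close>.\<close>

lemma coH1_Lambda_level_finite:
  assumes \<Omega>: "open \<Omega>" and u: "u \<in> L1_loc M \<Omega>" and null: "emeasure M {y\<in>\<Omega>. u y = t} = 0"
    and p: "p < \<infinity>"
    and acc: "\<And>\<eta>. 0 < \<eta> \<Longrightarrow> \<exists>s'. t - \<eta> < s' \<and> s' < t \<and> perimeter {y\<in>\<Omega>. s' < u y} \<Omega> \<le> p"
      "\<And>\<eta>. 0 < \<eta> \<Longrightarrow> \<exists>s. t < s \<and> s < t + \<eta> \<and> perimeter {y\<in>\<Omega>. s < u y} \<Omega> \<le> p"
  shows "coH1 M (Lambda_level M \<Omega> u t) < \<infinity>"
proof -
  define c where "c = ennreal (cover_const / (low_density / C))"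
  define V where "V = (\<lambda>s U. perimeter {y\<in>\<Omega>. s < u y} U)"
  let ?\<Lambda> = "Lambda_level M \<Omega> u t"
  have "coH1_delta M \<delta> ?\<Lambda> \<le> c * (3 * p + 3 * p)" if \<delta>: "0 < \<delta>" for \<delta>
  proof -
    have "?\<Lambda> \<subseteq> (\<Union>m. ?\<Lambda> \<inter> shell \<Omega> m)" using UN_shell[OF \<Omega>] by (auto simp: Lambda_level_def)
    then have "coH1_delta M \<delta> ?\<Lambda> \<le> coH1_delta M \<delta> (\<Union>m. ?\<Lambda> \<inter> shell \<Omega> m)" by (rule coH1_delta_mono)
    also have "\<dots> \<le> (\<Sum>m. coH1_delta M (\<delta>/2) (?\<Lambda> \<inter> shell \<Omega> m))" using \<delta> by (intro coH1_delta_UN_le) auto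
    also have "\<dots> \<le> c * (3 * p + 3 * p)"
      unfolding suminf_eq_SUP
    proof (rule SUP_least)
      fix N
      have "\<exists>\<eta>>0. \<forall>s' s. t - \<eta> < s' \<and> s' < t \<and> t < s \<and> s < t + \<eta> \<and> V s' \<Omega> < \<infinity> \<and> V s \<Omega> < \<infinity> \<longrightarrow>
          coH1_delta M (\<delta>/2) (?\<Lambda> \<inter> shell \<Omega> m) \<le> c * (V s' (shell_nbhd \<Omega> m) + V s (shell_nbhd \<Omega> m))" for m
      proof -
        obtain e where e: "e > 0" "\<And>x. x \<in> shell \<Omega> m \<Longrightarrow> ball x e \<subseteq> shell_nbhd \<Omega> m"
          using shell_subset_shell_nbhd by blast
        have "0 < \<delta>/2" using \<delta> by simp
        from coH1_delta_level_le[OF \<Omega> u null open_shell_nbhd shell_nbhd_subset bounded_shell e(2,1) this]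
        obtain \<eta> where "\<eta> > 0" "\<And>s' s. t - \<eta> < s' \<Longrightarrow> s' < t \<Longrightarrow> t < s \<Longrightarrow> s < t + \<eta> \<Longrightarrow>
            V s' \<Omega> < \<infinity> \<Longrightarrow> V s \<Omega> < \<infinity> \<Longrightarrow>
            coH1_delta M (\<delta>/2) (?\<Lambda> \<inter> shell \<Omega> m) \<le> c * (V s' (shell_nbhd \<Omega> m) + V s (shell_nbhd \<Omega> m))"
          unfolding V_def c_def by blast
        then show ?thesis by blast
      qed
      then obtain \<eta> where \<eta>: "\<And>m. \<eta> m > 0" "\<And>m s' s. t - \<eta> m < s' \<and> s' < t \<and> t < s \<and> s < t + \<eta> m \<and> V s' \<Omega> < \<infinity> \<and> V s \<Omega> < \<infinity> \<longrightarrow>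
          coH1_delta M (\<delta>/2) (?\<Lambda> \<inter> shell \<Omega> m) \<le> c * (V s' (shell_nbhd \<Omega> m) + V s (shell_nbhd \<Omega> m))"
        by metis
      \<comment> \<open>The inserted 1 keeps the set nonempty when \<open>N = 0\<close>.\<close>
      define h where "h = Min (insert 1 (\<eta> ` {..<N}))"
      have h: "0 < h" unfolding h_def using \<eta>(1) by (subst Min_gr_iff) auto
      have h\<eta>: "h \<le> \<eta> m" if "m < N" for m unfolding h_def using that by (intro Min_le) auto
      obtain s' where s': "t - h < s'" "s' < t" "V s' \<Omega> \<le> p" using acc(1)[OF h] by (auto simp: V_def)
      obtain s where s: "t < s" "s < t + h" "V s \<Omega> \<le> p" using acc(2)[OF h] by (auto simp: V_def)
      have "(\<Sum>m<N. coH1_delta M (\<delta>/2) (?\<Lambda> \<inter> shell \<Omega> m)) \<le> (\<Sum>m<N. c * (V s' (shell_nbhd \<Omega> m) + V s (shell_nbhd \<Omega> m)))"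
      proof (intro sum_mono \<eta>(2)[rule_format] conjI)
        fix m assume "m \<in> {..<N}"
        then have "h \<le> \<eta> m" using h\<eta> by simp
        then show "t - \<eta> m < s'" "s < t + \<eta> m" using s s' by auto
      qed (use s s' p in auto)
      also have "\<dots> = c * ((\<Sum>m<N. V s' (shell_nbhd \<Omega> m)) + (\<Sum>m<N. V s (shell_nbhd \<Omega> m)))"
        by (simp only: sum.distrib sum_distrib_left[symmetric])
      also have "\<dots> \<le> c * (3 * V s' \<Omega> + 3 * V s \<Omega>)"
        unfolding V_def by (intro mult_left_mono add_mono sum_total_variation_shell_nbhd_le) simp
      also have "\<dots> \<le> c * (3 * p + 3 * p)"
        by (intro mult_left_mono add_mono s s') auto
      finally show "(\<Sum>m<N. coH1_delta M (\<delta>/2) (?\<Lambda> \<inter> shell \<Omega> m)) \<le> c * (3 * p + 3 * p)" .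
    qed
    finally show ?thesis .
  qed
  then have "coH1 M ?\<Lambda> \<le> c * (3 * p + 3 * p)" unfolding coH1_def by (intro SUP_least) auto
  also have "\<dots> < \<infinity>" using p unfolding c_def by (simp add: ennreal_mult_less_top)
  finally show ?thesis .
qed

text \<open>On a bounded piece of \<Omega> the distribution of \<open>u\<close> is a finite measure
  and has at most countably many atoms; countably many pieces exhaust \<Omega>.\<close>

lemma countable_level_positive:
  assumes \<Omega>: "open \<Omega>" and u: "u \<in> L1_loc M \<Omega>"
  shows "countable {t. emeasure M {y\<in>\<Omega>. u y = t} \<noteq> 0}"
proof -
  have um[measurable]: "(\<lambda>y. u y * indicator \<Omega> y) \<in> borel_measurable M" by (rule L1_loc_measurable[OF assms])
  have \<Omega>m[measurable]: "\<Omega> \<in> sets M" using \<Omega> by (rule open_sets)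
  define W where "W = (\<lambda>n. \<Omega> \<inter> ball undefined (real n))"
  have Wm[measurable]: "W n \<in> sets M" for n by (auto simp: W_def open_sets)
  have m[measurable]: "{y\<in>\<Omega>. u y = t} \<in> sets M" for t
  proof -
    have "{y\<in>\<Omega>. u y = t} = \<Omega> - {y\<in>\<Omega>. t < u y} - {y\<in>\<Omega>. u y < t}" by auto
    then show ?thesis using superlevel_sets[OF \<Omega> u] \<Omega>m by auto
  qed
  have count: "countable {t. emeasure M ({y\<in>\<Omega>. u y = t} \<inter> W n) \<noteq> 0}" for n
  proof -
    define D where "D = distr (restrict_space M (W n)) borel (\<lambda>y. u y * indicator \<Omega> y)"
    have rm: "(\<lambda>y. u y * indicator \<Omega> y) \<in> borel_measurable (restrict_space M (W n))"
      using um by (rule measurable_restrict_space1)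
    have em: "emeasure D {t} = emeasure M ({y\<in>\<Omega>. u y = t} \<inter> W n)" for t
    proof -
      have "emeasure D {t} = emeasure (restrict_space M (W n)) ((\<lambda>y. u y * indicator \<Omega> y) -` {t} \<inter> space (restrict_space M (W n)))"
        unfolding D_def by (rule emeasure_distr[OF rm]) simp
      also have "(\<lambda>y. u y * indicator \<Omega> y) -` {t} \<inter> space (restrict_space M (W n)) = {y\<in>\<Omega>. u y = t} \<inter> W n"
        by (auto simp: space_restrict_space W_def)
      also have "emeasure (restrict_space M (W n)) \<dots> = emeasure M ({y\<in>\<Omega>. u y = t} \<inter> W n)"
        by (rule emeasure_restrict_space) auto
      finally show ?thesis .
    qed
    have "finite_measure D"
    proof
      have "emeasure D (space D) \<le> emeasure M (W n)"
        unfolding D_def using rm by (subst emeasure_distr) (auto simp: emeasure_restrict_space space_restrict_space)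
      also have "\<dots> < \<infinity>" by (rule bounded_emeasure_finite) (auto simp: W_def)
      finally show "emeasure D (space D) \<noteq> \<infinity>" by simp
    qed
    then interpret D: finite_measure D .
    have "countable {t. measure D {t} \<noteq> 0}" by (rule D.countable_support)
    then show ?thesis unfolding em[symmetric] by (simp add: D.emeasure_eq_measure)
  qed
  have "{t. emeasure M {y\<in>\<Omega>. u y = t} \<noteq> 0} \<subseteq> (\<Union>n. {t. emeasure M ({y\<in>\<Omega>. u y = t} \<inter> W n) \<noteq> 0})"
  proof (rule subsetI, rule ccontr)
    fix t assume t: "t \<in> {t. emeasure M {y\<in>\<Omega>. u y = t} \<noteq> 0}"
      "t \<notin> (\<Union>n. {t. emeasure M ({y\<in>\<Omega>. u y = t} \<inter> W n) \<noteq> 0})"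
    have "(\<Union>n. {y\<in>\<Omega>. u y = t} \<inter> W n) \<in> null_sets M"
      using t(2) by (intro null_sets_UN null_setsI) auto
    moreover have "(\<Union>n. {y\<in>\<Omega>. u y = t} \<inter> W n) = {y\<in>\<Omega>. u y = t}"
      by (auto simp: W_def reals_Archimedean2)
    ultimately show False using t(1) by auto
  qed
  then show ?thesis by (rule countable_subset) (intro countable_UN count countableI_type)
qed

text \<open>A level of finite perimeter lies in some \<open>N n\<close>. Unless it is one of the
  countably many one-sided isolated points of that set, it is approached from both sides inside
  \<open>N n\<close>, which supplies the uniform bound n.\<close>

lemma AE_coH1_Lambda_level_finite:
  assumes \<Omega>: "open \<Omega>" and u: "u \<in> BV M \<Omega>"
  shows "AE t in lborel. coH1 M (Lambda_level M \<Omega> u t) < \<infinity>"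
proof -
  have u1: "u \<in> L1_loc M \<Omega>" using u by (simp add: BV_def)
  define V where "V = (\<lambda>s. perimeter {y\<in>\<Omega>. s < u y} \<Omega>)"
  define N where "N = (\<lambda>n::nat. {s. V s \<le> of_nat n})"
  define Z where "Z = {t. emeasure M {y\<in>\<Omega>. u y = t} \<noteq> 0} \<union>
    (\<Union>n. {t\<in>N n. \<exists>e>0. N n \<inter> {t<..<t + e} = {}} \<union> {t\<in>N n. \<exists>e>0. N n \<inter> {t - e<..<t} = {}})"
  have "countable Z" unfolding Z_def
    by (intro countable_Un countable_UN countableI_type countable_right_isolated countable_left_isolated
        countable_level_positive \<Omega> u1)
  then have "AE t in lborel. t \<notin> Z" by (intro AE_not_in countable_imp_null_set_lborel)
  moreover have "AE t in lborel. V t < \<infinity>" unfolding V_def by (rule AE_finite_perimeter[OF \<Omega> u])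
  ultimately show ?thesis
  proof eventually_elim
    case (elim t)
    obtain n where n: "V t \<le> of_nat n"
    proof -
      obtain v where v: "V t = ennreal v" "0 \<le> v" using elim(2) by (cases "V t") auto
      obtain n where "v \<le> real n" using real_arch_simple by blast
      then have "V t \<le> of_nat n" unfolding v(1) by (simp add: ennreal_of_nat_eq_real_of_nat ennreal_leI)
      then show thesis by (rule that)
    qed
    then have tN: "t \<in> N n" by (simp add: N_def)
    show ?case
    proof (rule coH1_Lambda_level_finite[OF \<Omega> u1, of _ "of_nat n"])
      show "emeasure M {y\<in>\<Omega>. u y = t} = 0" using elim(1) by (auto simp: Z_def)
      show "of_nat n < (\<infinity>::ennreal)" by (simp add: of_nat_less_top)
      fix \<eta> :: real assume \<eta>: "0 < \<eta>"
      have "N n \<inter> {t<..<t + \<eta>} \<noteq> {}" "N n \<inter> {t - \<eta><..<t} \<noteq> {}"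
        using elim(1) tN \<eta> by (auto simp: Z_def)
      then show "\<exists>s. t < s \<and> s < t + \<eta> \<and> perimeter {y\<in>\<Omega>. s < u y} \<Omega> \<le> of_nat n"
        "\<exists>s'. t - \<eta> < s' \<and> s' < t \<and> perimeter {y\<in>\<Omega>. s' < u y} \<Omega> \<le> of_nat n"
        by (auto simp: N_def V_def)
    qed
  qed
qed

text \<open>For \<open>s > u x\<close> the set \<open>{y\<in>\<Omega>. u y < s}\<close> contains a
  ball about \<open>x\<close> and has density 1 there, so no such \<open>s\<close> enters the
  supremum that defines the lower limit. The upper limit is symmetric.\<close>

lemma continuous_imp_level_subset_Lambda_level:
  assumes \<Omega>: "open \<Omega>" and u: "continuous_on \<Omega> u"
  shows "{x\<in>\<Omega>. u x = t} \<subseteq> Lambda_level M \<Omega> u t"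
proof safe
  fix x assume x: "x \<in> \<Omega>" "t = u x"
  have unique: "\<not> has_density M A x 0" if A: "e > 0" "ball x e \<subseteq> A" for A e
  proof
    assume "has_density M A x 0"
    moreover have "has_density M A x 1" using measure_ball_pos A by (rule has_density_1_if_ball_subset)
    ultimately have "(0::real) = 1" unfolding has_density_def by (rule tendsto_unique[rotated]) simp
    then show False by simp
  qed
  have nbhd: "\<exists>e>0. ball x e \<subseteq> u -` W \<inter> \<Omega>" if W: "open W" "u x \<in> W" for W
  proof -
    have "open (u -` W \<inter> \<Omega>)" using continuous_on_open_vimage[OF \<Omega>] u W(1) by metis
    moreover have "x \<in> u -` W \<inter> \<Omega>" using x(1) W(2) by simp
    ultimately show ?thesis unfolding open_contains_ball by blast
  qed
  have "approx_lower M \<Omega> u x \<le> ereal (u x)"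
    unfolding approx_lower_def
  proof (rule Sup_least, safe)
    fix s assume "has_density M {y\<in>\<Omega>. u y < s} x 0"
    show "ereal s \<le> ereal (u x)"
    proof (rule ccontr)
      assume "\<not> ereal s \<le> ereal (u x)"
      then obtain e where "e > 0" "ball x e \<subseteq> u -` {..<s} \<inter> \<Omega>" using nbhd[of "{..<s}"] by auto
      then show False using unique[of e "{y\<in>\<Omega>. u y < s}"] \<open>has_density M {y\<in>\<Omega>. u y < s} x 0\<close> by blast
    qed
  qed
  moreover have "ereal (u x) \<le> approx_upper M \<Omega> u x"
    unfolding approx_upper_def
  proof (rule Inf_greatest, safe)
    fix s assume "has_density M {y\<in>\<Omega>. s < u y} x 0"
    show "ereal (u x) \<le> ereal s"
    proof (rule ccontr)
      assume "\<not> ereal (u x) \<le> ereal s"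
      then obtain e where "e > 0" "ball x e \<subseteq> u -` {s<..} \<inter> \<Omega>" using nbhd[of "{s<..}"] by auto
      then show False using unique[of e "{y\<in>\<Omega>. s < u y}"] \<open>has_density M {y\<in>\<Omega>. s < u y} x 0\<close> by blast
    qed
  qed
  ultimately show "x \<in> Lambda_level M \<Omega> u (u x)" using x by (simp add: Lambda_level_def)
qed

end

lemma standard_assumptions_imp_doubling_poincare:
  assumes "standard_assumptions M"
  shows "\<exists>C P L. doubling_poincare M C P L"
proof -
  obtain C where C: "\<And>x r. 0 < r \<Longrightarrow> emeasure M (ball x (2 * r)) \<le> ennreal C * emeasure M (ball x r)"
    and pos: "\<And>x r. 0 < r \<Longrightarrow> 0 < emeasure M (ball x r) \<and> emeasure M (ball x r) < \<infinity>"
    using assms unfolding standard_assumptions_def doubling_measure_def by blast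
  obtain P L where PL: "P \<ge> 1" "L \<ge> 1" "\<And>x r u. 0 < r \<Longrightarrow> u \<in> BV M UNIV \<Longrightarrow>
       (\<integral>\<^sup>+y\<in>ball x r. ennreal \<bar>u y - mean_value M (ball x r) u\<bar> \<partial>M)
         \<le> ennreal (P * r) * total_variation M u (ball x (L * r))"
    using assms unfolding standard_assumptions_def BV_poincare_def by blast
  \<comment> \<open>The doubling constant is raised to at least 1 so that powers of it are monotone
    and divisions by it harmless.\<close>
  have "doubling_poincare M (max 1 C) P L"
  proof
    show "complete (UNIV :: 'a set)" "sets borel \<subseteq> sets M"
      using assms by (auto simp: standard_assumptions_def borel_regular_def)
    fix x r assume r: "(0::real) < r"
    have "ennreal C * emeasure M (ball x r) \<le> ennreal (max 1 C) * emeasure M (ball x r)"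
      by (intro mult_right_mono ennreal_leI) auto
    then show "emeasure M (ball x (2 * r)) \<le> ennreal (max 1 C) * emeasure M (ball x r)"
      using C[OF r, of x] by (rule order_trans[rotated])
  qed (use pos PL in auto)
  then show ?thesis by blast
qed

theorem corollary6p3:
  fixes M :: "'a::metric_space measure" and \<Omega> :: "'a set" and u :: "'a \<Rightarrow> real"
  assumes "standard_assumptions M"
    and "open \<Omega>"
    and "u \<in> BV M \<Omega>"
  shows "(AE t in lborel. coH1 M (Lambda_level M \<Omega> u t) < \<infinity>) \<and>
         (continuous_on \<Omega> u \<or> (\<forall>x\<in>\<Omega>. approx_continuous_at M \<Omega> u x) \<longrightarrow>
            (AE t in lborel. coH1 M {x\<in>\<Omega>. u x = t} < \<infinity>))"
proof -
  obtain C P L where "doubling_poincare M C P L"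
    using standard_assumptions_imp_doubling_poincare[OF assms(1)] by blast
  then interpret doubling_poincare M C P L .
  have \<Lambda>: "AE t in lborel. coH1 M (Lambda_level M \<Omega> u t) < \<infinity>"
    by (rule AE_coH1_Lambda_level_finite[OF assms(2,3)])
  moreover have "AE t in lborel. coH1 M {x\<in>\<Omega>. u x = t} < \<infinity>"
    if "continuous_on \<Omega> u \<or> (\<forall>x\<in>\<Omega>. approx_continuous_at M \<Omega> u x)"
  proof -
    have "{x\<in>\<Omega>. u x = t} \<subseteq> Lambda_level M \<Omega> u t" for t
      using that
    proof
      assume "continuous_on \<Omega> u"
      then show ?thesis by (rule continuous_imp_level_subset_Lambda_level[OF assms(2)])
    next
      assume "\<forall>x\<in>\<Omega>. approx_continuous_at M \<Omega> u x"
      then show ?thesis by (auto simp: approx_continuous_at_def Lambda_level_def)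
    qed
    then have le: "coH1 M {x\<in>\<Omega>. u x = t} \<le> coH1 M (Lambda_level M \<Omega> u t)" for t by (rule coH1_mono)
    show ?thesis using \<Lambda> by eventually_elim (rule le_less_trans[OF le])
  qed
  ultimately show ?thesis by blast
qed

end
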